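(* For any absolute constants $0<c_1\le c_2$ there exist constants $c_3,c_4,s>0$ depending only on $c_1,c_2$ such that the following holds in the setting of the context (with $\varphi$ $\mu$-strongly-convex-strongly-concave and $M$-Lipschitz, $\varepsilon>0$, $N\ge1$ an integer). If $$c_1\le\tau\left(\sqrt[3]{\frac{\sigma^2}{\mu M}}\cdot\sqrt[3]{\frac{n^2}{N}}\right)^{-1}\le c_2,\qquad\Delta\le c_3\,\frac{\varepsilon\tau}{\Omega n},$$ and $$\frac{N}{(\log(N+1))^s}\ge c_4\left(\frac{nM^2}{\mu\varepsilon}+\frac{M^2n^2\sigma^2}{\mu\varepsilon^3}\right),$$ then $\mathbb E\left[\varphi(\bar x_N,y^* )-\varphi(x^*,\bar y_N)\right]\le\varepsilon$. That is, up to logarithmic factors, $N=\tilde{\mathcal O}\left(\frac{nM^2}{\mu\varepsilon}+\frac{M^2n^2\sigma^2}{\mu\varepsilon^3}\right)$ iterations suffice to find an $\varepsilon$-solution.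
   Context: Problem: $\min_{x\in\mathcal X}\max_{y\in\mathcal Y}\varphi(x,y)$, where $\mathcal X\subset\mathbb R^{n_x}$, $\mathcal Y\subset\mathbb R^{n_y}$ are nonempty compact convex sets, $\mathcal Z=\mathcal X\times\mathcal Y$, $n=n_x+n_y$, $z=(x,y)$, $\varphi(z)=\varphi(x,y)$. $\Omega>0$ is the Euclidean diameter of $\mathcal Z$, and $\Pi_{\mathcal Z}$ is the Euclidean projection onto $\mathcal Z$ (the prox-operator step with Bregman divergence $V_z(w)=\frac12\|z-w\|_2^2$). The function $\varphi$ is defined on $U=U_X\times U_Y$, with $U_X\subset\mathbb R^{n_x}$, $U_Y\subset\mathbb R^{n_y}$ open convex, such that $U$ contains all points $z+\tau e$ with $z\in\mathcal Z$, $\|e\|_2\le1$; the assumptions on $\varphi$ hold on $U$. A function $f$ is $\mu$-strongly convex ($\mu>0$) on a set if it is continuously differentiable and $f(y)\ge f(x)+\langle\nabla f(x),y-x\rangle+\frac\mu2\|y-x\|_2^2$ for all $x,y$ in the set; $f$ is $\mu$-strongly concave if $-f$ is $\mu$-strongly convex. $\varphi$ is $\mu$-strongly-convex-strongly-concave if $\varphi(\cdot,y)$ is $\mu$-strongly convex for all $y$ and $\varphi(x,\cdot)$ is $\mu$-strongly concave for all $x$. $M$-Lipschitz ($M>0$): $|\varphi(z)-\varphi(z')|\le M\|z-z'\|_2$ for all $z,z'\in U$. $(x^*,y^* )$ is the saddle point of $\varphi$ on $\mathcal X\times\mathcal Y$: $\varphi(x^*,y)\le\varphi(x^*,y^* )\le\varphi(x,y^*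 )$ for all $x\in\mathcal X,y\in\mathcal Y$. Oracle: only noisy values $\tilde\varphi(z,\xi)=\varphi(z)+\xi+\delta(z)$ are available, where $\delta$ is a deterministic measurable function on $U$ with $|\delta|\le\Delta$, and $\xi$ is a real random variable with $\mathbb E\xi=0$, $\mathbb E[\xi^2]\le\sigma^2$ ($\Delta,\sigma>0$), generated independently of the query point. Gradient estimator: for $\mathbf e=(\mathbf e_x,\mathbf e_y)$ uniformly distributed on the Euclidean unit sphere of $\mathbb R^n$, $$g(z,\mathbf e,\tau,\xi^{\pm})=\frac{n\left(\tilde\varphi(z+\tau\mathbf e,\xi^+)-\tilde\varphi(z-\tau\mathbf e,\xi^-)\right)}{2\tau}\begin{pmatrix}\mathbf e_x\\-\mathbf e_y\end{pmatrix}.$$ Algorithm: $z_0\in\mathcal Z$, $z_{k+1}=\Pi_{\mathcal Z}\big(z_k-\gamma_kg(z_k,\mathbf e_k,\tau,\xi_k^\pm)\big)$ with $\gamma_k=\frac1{\mu(k+1)}$, $k=0,\dots,N$, with output $\bar z_N=(\bar x_N,\bar y_N)=\frac1{N+1}\sum_{k=0}^Nz_k$. At each iteration $k$, $\mathbf e_k$ and the noises $\xi_k^+,\xi_k^-$ are generated independently of each other and of the previous iterations. *)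

theory Defs
  imports "HOL-Probability.Probability"
begin

text \<open>
  The constants in the result must not depend on the dimension, so the dimension has to be a
  natural number that can be quantified inside a formula.  We therefore realise all Euclidean
  spaces inside one inner product space, the finitely supported real sequences with the
  \<open>\<ell>\<^sup>2\<close> inner product: the space of dimension \<open>n\<close> is the subspace of sequences
  vanishing from index \<open>n\<close> on.  Norm, topology, convexity, compactness and derivatives on these
  subspaces, and on their products, are then the library notions.
\<close>

typedef fseq = "{f :: nat \<Rightarrow> real. finite {i. f i \<noteq> 0}}"
  morphisms coord Abs_fseq
  by (rule exI[of _ "\<lambda>_. 0"]) simp

setup_lifting type_definition_fseq

lemma fseq_eqI: "(\<And>i. coord x i = coord y i) \<Longrightarrow> x = y"
  by (simp add: coord_inject[symmetric] fun_eq_iff)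

lemma finite_coord [simp]: "finite {i. coord x i \<noteq> 0}"
  using coord[of x] by simp

instantiation fseq :: real_vector
begin

lift_definition zero_fseq :: fseq is "\<lambda>_. 0" by simp

lift_definition plus_fseq :: "fseq \<Rightarrow> fseq \<Rightarrow> fseq" is "\<lambda>f g i. f i + g i"
  subgoal for f g
    by (rule finite_subset[of _ "{i. f i \<noteq> 0} \<union> {i. g i \<noteq> 0}"]) auto
  done

lift_definition minus_fseq :: "fseq \<Rightarrow> fseq \<Rightarrow> fseq" is "\<lambda>f g i. f i - g i"
  subgoal for f g
    by (rule finite_subset[of _ "{i. f i \<noteq> 0} \<union> {i. g i \<noteq> 0}"]) auto
  done

lift_definition uminus_fseq :: "fseq \<Rightarrow> fseq" is "\<lambda>f i. - f i" by simp

lift_definition scaleR_fseq :: "real \<Rightarrow> fseq \<Rightarrow> fseq" is "\<lambda>r f i. r * f i"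
  subgoal for r f
    by (rule finite_subset[of _ "{i. f i \<noteq> 0}"]) auto
  done

instance
  by standard (transfer; simp add: fun_eq_iff algebra_simps)+

end

instantiation fseq :: real_inner
begin

definition inner_fseq :: "fseq \<Rightarrow> fseq \<Rightarrow> real"
  where "inner_fseq x y = (\<Sum>i | coord x i \<noteq> 0. coord x i * coord y i)"

definition norm_fseq :: "fseq \<Rightarrow> real" where "norm_fseq x = sqrt (inner x x)"

definition dist_fseq :: "fseq \<Rightarrow> fseq \<Rightarrow> real" where "dist_fseq x y = norm (x - y)"

definition sgn_fseq :: "fseq \<Rightarrow> fseq" where "sgn_fseq x = x /\<^sub>R norm x"

definition uniformity_fseq :: "(fseq \<times> fseq) filter"
  where "uniformity_fseq = (INF e\<in>{0<..}. principal {(x, y). dist x y < e})"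

definition open_fseq :: "fseq set \<Rightarrow> bool"
  where "open_fseq U \<longleftrightarrow> (\<forall>x\<in>U. \<forall>\<^sub>F (x', y) in uniformity. x' = x \<longrightarrow> y \<in> U)"

lemma inner_fseq_alt:
  assumes "finite A" "{i. coord x i \<noteq> 0} \<subseteq> A"
  shows "inner x y = (\<Sum>i\<in>A. coord x i * coord y i)"
  unfolding inner_fseq_def using assms by (intro sum.mono_neutral_left) auto

instance
proof
  fix x y z :: fseq and r :: real
  let ?A = "{i. coord x i \<noteq> 0} \<union> {i. coord y i \<noteq> 0}"
  have subs: "{i. coord (x + y) i \<noteq> 0} \<subseteq> ?A"
    by (auto simp: plus_fseq.rep_eq)
  show "inner x y = inner y x"
    by (simp add: inner_fseq_alt[of ?A] mult.commute)
  show "inner (x + y) z = inner x z + inner y z"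
    using subs by (simp add: inner_fseq_alt[of ?A] plus_fseq.rep_eq sum.distrib[symmetric] algebra_simps)
  have sub: "{i. coord (r *\<^sub>R x) i \<noteq> 0} \<subseteq> {i. coord x i \<noteq> 0}"
    by (auto simp: scaleR_fseq.rep_eq)
  show "inner (r *\<^sub>R x) y = r * inner x y"
    by (subst inner_fseq_alt[OF finite_coord sub])
      (simp add: inner_fseq_def scaleR_fseq.rep_eq sum_distrib_left mult.assoc)
  show "0 \<le> inner x x"
    by (simp add: inner_fseq_def sum_nonneg)
  show "inner x x = 0 \<longleftrightarrow> x = 0"
    by (auto simp: inner_fseq_def sum_nonneg_eq_0_iff zero_fseq.rep_eq intro!: fseq_eqI)
qed (simp_all only: norm_fseq_def dist_fseq_def sgn_fseq_def uniformity_fseq_def open_fseq_def)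

end

definition Rn :: "nat \<Rightarrow> fseq set"
  where "Rn n = {x. \<forall>i\<ge>n. coord x i = 0}"

definition vec_of :: "nat \<Rightarrow> (nat \<Rightarrow> real) \<Rightarrow> fseq"
  where "vec_of n f = Abs_fseq (\<lambda>i. if i < n then f i else 0)"

lemma coord_vec_of: "coord (vec_of n f) i = (if i < n then f i else 0)"
  unfolding vec_of_def by (subst Abs_fseq_inverse) auto

text \<open>Lebesgue measure on \<open>Rn nx \<times> Rn ny\<close>, as a Borel measure on the ambient type.\<close>

definition lebesgue_prod :: "nat \<Rightarrow> nat \<Rightarrow> (fseq \<times> fseq) measure"
  where "lebesgue_prod nx ny =
    distr (Pi\<^sub>M {..<nx + ny} (\<lambda>_. lborel)) borel (\<lambda>f. (vec_of nx f, vec_of ny (\<lambda>i. f (nx + i))))"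

text \<open>
  The uniform distribution on the unit sphere of \<open>Rn nx \<times> Rn ny\<close> (normalised surface measure)
  is the law of \<open>w / \<parallel>w\<parallel>\<close> for \<open>w\<close> uniform in the unit ball.  The underlying space is the
  sphere itself rather than the whole type, so that functions given only near the domain of the
  problem yield measurable iterates.
\<close>

definition unif_sphere :: "nat \<Rightarrow> nat \<Rightarrow> (fseq \<times> fseq) measure"
  where "unif_sphere nx ny =
    restrict_space (distr (uniform_measure (lebesgue_prod nx ny) (cball 0 1)) borel sgn)
      {e \<in> Rn nx \<times> Rn ny. norm e = 1}"

text \<open>
  Continuously differentiable and strongly convex on \<open>S \<subseteq> Rn n\<close>, with gradient \<open>G\<close>; in use
  \<open>S\<close> is relatively open in \<open>Rn n\<close>, so that \<open>G\<close> is unique.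
\<close>

definition strongly_convex_on :: "nat \<Rightarrow> real \<Rightarrow> fseq set \<Rightarrow> (fseq \<Rightarrow> real) \<Rightarrow> bool"
  where "strongly_convex_on n \<mu> S f \<longleftrightarrow>
    (\<exists>G. G \<in> S \<rightarrow> Rn n \<and> continuous_on S G \<and>
      (\<forall>x\<in>S. (f has_derivative (\<lambda>h. G x \<bullet> h)) (at x within S)) \<and>
      (\<forall>x\<in>S. \<forall>y\<in>S. f y \<ge> f x + G x \<bullet> (y - x) + \<mu> / 2 * (norm (y - x))\<^sup>2))"

definition strongly_concave_on :: "nat \<Rightarrow> real \<Rightarrow> fseq set \<Rightarrow> (fseq \<Rightarrow> real) \<Rightarrow> bool"
  where "strongly_concave_on n \<mu> S f \<longleftrightarrow> strongly_convex_on n \<mu> S (\<lambda>x. - f x)"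

definition scsc_on ::
    "nat \<Rightarrow> nat \<Rightarrow> real \<Rightarrow> fseq set \<Rightarrow> fseq set \<Rightarrow> (fseq \<times> fseq \<Rightarrow> real) \<Rightarrow> bool"
  where "scsc_on nx ny \<mu> UX UY \<phi> \<longleftrightarrow>
    (\<forall>y\<in>UY. strongly_convex_on nx \<mu> UX (\<lambda>x. \<phi> (x, y))) \<and>
    (\<forall>x\<in>UX. strongly_concave_on ny \<mu> UY (\<lambda>y. \<phi> (x, y)))"

definition saddle_point ::
    "fseq set \<Rightarrow> fseq set \<Rightarrow> (fseq \<times> fseq \<Rightarrow> real) \<Rightarrow> fseq \<Rightarrow> fseq \<Rightarrow> bool"
  where "saddle_point X Y \<phi> x' y' \<longleftrightarrow> x' \<in> X \<and> y' \<in> Y \<and>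
    (\<forall>x\<in>X. \<forall>y\<in>Y. \<phi> (x', y) \<le> \<phi> (x', y') \<and> \<phi> (x', y') \<le> \<phi> (x, y'))"

definition noise_law :: "real \<Rightarrow> real measure \<Rightarrow> bool"
  where "noise_law \<sigma> D \<longleftrightarrow> prob_space D \<and> sets D = sets borel \<and>
    integrable D (\<lambda>\<xi>. \<xi>) \<and> (\<integral>\<xi>. \<xi> \<partial>D) = 0 \<and>
    integrable D (\<lambda>\<xi>. \<xi>\<^sup>2) \<and> (\<integral>\<xi>. \<xi>\<^sup>2 \<partial>D) \<le> \<sigma>\<^sup>2"

definition noisy_value :: "('a \<Rightarrow> real) \<Rightarrow> ('a \<Rightarrow> real) \<Rightarrow> 'a \<Rightarrow> real \<Rightarrow> real"
  where "noisy_value \<phi> \<delta> z \<xi> = \<phi> z + \<xi> + \<delta> z"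

definition grad_est :: "nat \<Rightarrow> (fseq \<times> fseq \<Rightarrow> real) \<Rightarrow> (fseq \<times> fseq \<Rightarrow> real) \<Rightarrow> real \<Rightarrow>
    fseq \<times> fseq \<Rightarrow> fseq \<times> fseq \<Rightarrow> real \<Rightarrow> real \<Rightarrow> fseq \<times> fseq"
  where "grad_est n \<phi> \<delta> \<tau> z e \<xi>p \<xi>m =
    (real n * (noisy_value \<phi> \<delta> (z + \<tau> *\<^sub>R e) \<xi>p - noisy_value \<phi> \<delta> (z - \<tau> *\<^sub>R e) \<xi>m) / (2 * \<tau>))
      *\<^sub>R (fst e, - snd e)"

text \<open>The library's \<^const>\<open>closest_point\<close> is not available on a type without the Heine-Borel property.\<close>

definition proj :: "(fseq \<times> fseq) set \<Rightarrow> fseq \<times> fseq \<Rightarrow> fseq \<times> fseq"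
  where "proj Z w = arg_min_on (dist w) Z"

text \<open>A sample \<open>\<omega>\<close> lists, for each iteration, the direction and the two noises.\<close>

type_synonym sample = "nat \<Rightarrow> (fseq \<times> fseq) \<times> real \<times> real"

primrec iterate :: "(fseq \<times> fseq) set \<Rightarrow> nat \<Rightarrow> real \<Rightarrow> (fseq \<times> fseq \<Rightarrow> real) \<Rightarrow>
    (fseq \<times> fseq \<Rightarrow> real) \<Rightarrow> real \<Rightarrow> fseq \<times> fseq \<Rightarrow> sample \<Rightarrow> nat \<Rightarrow> fseq \<times> fseq"
  where
    "iterate Z n \<mu> \<phi> \<delta> \<tau> z0 \<omega> 0 = z0"
  | "iterate Z n \<mu> \<phi> \<delta> \<tau> z0 \<omega> (Suc k) =
      (let z = iterate Z n \<mu> \<phi> \<delta> \<tau> z0 \<omega> k; (e, \<xi>p, \<xi>m) = \<omega> k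
       in proj Z (z - (1 / (\<mu> * (real k + 1))) *\<^sub>R grad_est n \<phi> \<delta> \<tau> z e \<xi>p \<xi>m))"

definition avg_iterate :: "(fseq \<times> fseq) set \<Rightarrow> nat \<Rightarrow> real \<Rightarrow> (fseq \<times> fseq \<Rightarrow> real) \<Rightarrow>
    (fseq \<times> fseq \<Rightarrow> real) \<Rightarrow> real \<Rightarrow> fseq \<times> fseq \<Rightarrow> nat \<Rightarrow> sample \<Rightarrow> fseq \<times> fseq"
  where "avg_iterate Z n \<mu> \<phi> \<delta> \<tau> z0 N \<omega> =
    (1 / (real N + 1)) *\<^sub>R (\<Sum>k\<le>N. iterate Z n \<mu> \<phi> \<delta> \<tau> z0 \<omega> k)"

text \<open>
  The joint law of the randomness of the algorithm: all directions and noises are independent, the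
  directions uniform on the sphere.  The noise laws may differ between queries.
\<close>

definition sample_space ::
    "nat \<Rightarrow> nat \<Rightarrow> (nat \<Rightarrow> real measure) \<Rightarrow> (nat \<Rightarrow> real measure) \<Rightarrow> sample measure"
  where "sample_space nx ny Dp Dm =
    Pi\<^sub>M UNIV (\<lambda>k. unif_sphere nx ny \<Otimes>\<^sub>M (Dp k \<Otimes>\<^sub>M Dm k))"

locale noisy_saddle_problem =
  fixes nx ny :: nat and X Y UX UY :: "fseq set"
    and \<phi> \<delta> :: "fseq \<times> fseq \<Rightarrow> real" and Dp Dm :: "nat \<Rightarrow> real measure"
    and \<mu> M \<sigma> \<Delta> \<tau> :: real and xs ys :: fseq and z0 :: "fseq \<times> fseq"
  assumes X: "X \<subseteq> Rn nx" "X \<noteq> {}" "compact X" "convex X"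
    and Y: "Y \<subseteq> Rn ny" "Y \<noteq> {}" "compact Y" "convex Y"
    and diameter_pos: "0 < diameter (X \<times> Y)"
    and UX: "openin (top_of_set (Rn nx)) UX" "convex UX"
    and UY: "openin (top_of_set (Rn ny)) UY" "convex UY"
    and neighbourhood:
      "\<And>z e. z \<in> X \<times> Y \<Longrightarrow> e \<in> Rn nx \<times> Rn ny \<Longrightarrow> norm e \<le> 1 \<Longrightarrow> z + \<tau> *\<^sub>R e \<in> UX \<times> UY"
    and pos: "0 < \<mu>" "0 < M" "0 < \<sigma>" "0 < \<Delta>"
    and scsc: "scsc_on nx ny \<mu> UX UY \<phi>"
    and lipschitz: "M-lipschitz_on (UX \<times> UY) \<phi>"
    and saddle: "saddle_point X Y \<phi> xs ys"
    and \<delta>_measurable: "\<delta> \<in> borel_measurable (restrict_space borel (UX \<times> UY))"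
    and \<delta>_bound: "\<And>z. z \<in> UX \<times> UY \<Longrightarrow> \<bar>\<delta> z\<bar> \<le> \<Delta>"
    and noise: "\<And>k. noise_law \<sigma> (Dp k)" "\<And>k. noise_law \<sigma> (Dm k)"
    and z0: "z0 \<in> X \<times> Y"

end

theory Submission
  imports Defs
begin

text \<open>
  Averaging \<open>\<phi>\<close> over balls of radius \<open>\<tau>\<close> changes it by at most \<open>M \<tau>\<close>, and the
  gradient of the averaged function is \<open>n / \<tau>\<close> times the average of \<open>\<phi>(z + \<tau> e) e\<close> over
  the sphere.  So the estimator correlates with \<open>z - u\<close> as a subgradient of a strongly
  convex-concave function does, up to a bias of order \<open>M \<tau> + n \<Delta> \<Omega> / \<tau>\<close>.  Its second
  moment is of order \<open>n M\<^sup>2 + n\<^sup>2 (\<sigma>\<^sup>2 + \<Delta>\<^sup>2) / \<tau>\<^sup>2\<close>, where the factor \<open>n\<close> instead of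
  \<open>n\<^sup>2\<close> in the first term is the Poincare inequality on the sphere.  Projected stochastic
  descent with step \<open>1 / (\<mu> (k + 1))\<close> then has expected gap at most the bias plus
  \<open>O(ln N / (\<mu> N))\<close> times the second moment, and the prescribed \<open>\<tau>\<close> balances the two.

  Both facts about the sphere are derived from the translation invariance and the homogeneity of
  Lebesgue measure alone: the gradient formula by translating a radial cutoff, the Poincare
  inequality by integrating along random great circles, which uses only plane rotations of pairs
  of vectors.
\<close>

subsection \<open>Polar decomposition of a homogeneous measure\<close>

text \<open>The dimension is a variable, so Lebesgue measure sits on a subspace \<open>V\<close> of
  one fixed type. The locale records all that is used of it: \<open>V\<close> carries the mass,
  shifts by \<open>V\<close> preserve it, dilation by \<open>r\<close> multiplies it by
  \<open>r ^ n\<close>, and the unit ball has finite positive measure.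

  Two obstacles shape the rest. First, \<open>\<phi>\<close> is controlled only on \<open>U\<close>,
  convex only in each block, and differentiable only in each block. The averaged function is
  therefore never formed: chords of \<open>\<phi>\<close> are compared with sphere integrals
  directly, one block at a time, and Poincare is arranged to need only a Lipschitz bound and
  one-sided derivatives along lines. Second, the queries are meaningful only near \<open>Z\<close>,
  so integrands are cut off by indicators or live on restricted spaces.

  The power 3 of the logarithm: the bias is of order \<open>M * \<tau>\<close>, and with
  \<open>\<tau> ^ 3\<close> proportional to \<open>1 / N\<close> the noise part of the variance is
  of order \<open>M * \<tau> * ln N\<close>. Making this at most \<open>\<epsilon>\<close> and
  cubing produces \<open>(ln N) ^ 3\<close>.\<close>

locale homogeneous_measure =
  fixes L :: "'a::{real_inner, second_countable_topology} measure"
    and V :: "'a set" and n :: nat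
  assumes sets_L [measurable_cong, simp]: "sets L = sets borel"
    and subspace_V: "subspace V" and closed_V: "closed V"
    and AE_V: "AE w in L. w \<in> V"
    and translate: "\<And>d. d \<in> V \<Longrightarrow> distr L borel (\<lambda>w. w + d) = L"
    and scale: "\<And>r A. 0 < r \<Longrightarrow> A \<in> sets borel \<Longrightarrow>
      emeasure L ((\<lambda>w. w /\<^sub>R r) -` A) = ennreal (r ^ n) * emeasure L A"
    and ball: "0 < emeasure L (cball 0 1)" "emeasure L (cball 0 1) < \<infinity>"
    and n_pos: "0 < n"
begin

lemma space_L [simp]: "space L = UNIV"
  using sets_eq_imp_space_eq[OF sets_L] by simp

text \<open>The measure underlying \<open>unif_sphere\<close> before restriction to the sphere.
  Keeping the ambient space lets Borel functions on the whole type be integrated.\<close>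

definition sphere_law :: "'a measure"
  where "sphere_law = distr (uniform_measure L (cball 0 1)) borel sgn"

lemma sets_sphere_law [measurable_cong, simp]: "sets sphere_law = sets borel"
  by (simp add: sphere_law_def)

lemma space_sphere_law [simp]: "space sphere_law = UNIV"
  by (simp add: sphere_law_def)

lemma measurable_sgn [measurable]: "sgn \<in> borel_measurable (borel :: 'a measure)"
  unfolding sgn_div_norm by measurable

lemma prob_space_sphere_law: "prob_space sphere_law"
proof -
  interpret U: prob_space "uniform_measure L (cball 0 1)"
    using ball by (intro prob_space_uniform_measure) auto
  show ?thesis
    unfolding sphere_law_def by (rule U.prob_space_distr) measurable
qed

lemma emeasure_sphere_law:
  assumes [measurable]: "A \<in> sets borel"
  shows "emeasure L {w. norm w \<le> 1 \<and> sgn w \<in> A} = emeasure sphere_law A * emeasure L (cball 0 1)"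
proof -
  have "emeasure sphere_law A = emeasure L (cball 0 1 \<inter> sgn -` A) / emeasure L (cball 0 1)"
    unfolding sphere_law_def
    by (subst emeasure_distr) (auto intro!: emeasure_uniform_measure measurable_sets_borel[of sgn borel])
  moreover have "cball 0 1 \<inter> sgn -` A = {w. norm w \<le> 1 \<and> sgn w \<in> A}"
    by auto
  ultimately show ?thesis
    using ball by (simp add: ennreal_divide_times mult_divide_eq_ennreal)
qed

text \<open>Directions are unchanged by positive dilation, so a sector of radius \<open>r\<close> is
  the dilated unit sector.\<close>

lemma emeasure_sector:
  assumes [measurable]: "A \<in> sets borel" and "0 < r"
  shows "emeasure L {w. norm w \<le> r \<and> sgn w \<in> A} =
    ennreal (r ^ n) * emeasure L {w. norm w \<le> 1 \<and> sgn w \<in> A}"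
proof -
  have "{w. norm w \<le> r \<and> sgn w \<in> A} = (\<lambda>w. w /\<^sub>R r) -` {w. norm w \<le> 1 \<and> sgn w \<in> A}"
    using \<open>0 < r\<close> by (auto simp: sgn_scaleR field_simps)
  moreover have "{w. norm w \<le> 1 \<and> sgn w \<in> A} \<in> sets borel"
    by measurable
  ultimately show ?thesis
    using \<open>0 < r\<close> scale by metis
qed

lemma emeasure_cball_pos:
  assumes "0 < r"
  shows "emeasure L (cball 0 r) = ennreal (r ^ n) * emeasure L (cball 0 1)"
  using emeasure_sector[of UNIV r] assms by (simp add: cball_def)

lemma emeasure_cball_finite: "emeasure L (cball 0 r) < \<infinity>"
proof -
  have "emeasure L (cball 0 r) \<le> emeasure L (cball 0 (max r 1))"
    by (intro emeasure_mono) auto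
  also have "\<dots> < \<infinity>"
    using ball emeasure_cball_pos[of "max r 1"] by (simp add: ennreal_mult_less_top)
  finally show ?thesis .
qed

text \<open>Dilation by 2 fixes \<open>{0}\<close> but multiplies its measure by
  \<open>2 ^ n > 1\<close>; a finite value with this property is 0.\<close>

lemma emeasure_0: "emeasure L {0} = 0"
proof (rule ccontr)
  assume *: "emeasure L {0} \<noteq> 0"
  have fin: "emeasure L {0} < \<infinity>"
    by (rule le_less_trans[OF _ emeasure_cball_finite[of 1]]) (auto intro!: emeasure_mono)
  have "(\<lambda>w. w /\<^sub>R 2) -` {0::'a} = {0}" by auto
  then have "emeasure L {0} = ennreal (2 ^ n) * emeasure L {0}"
    using scale[of 2 "{0}"] by simp
  moreover obtain a where a: "emeasure L {0} = ennreal a" "0 < a"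
    using * fin by (cases "emeasure L {0}") (auto simp: less_le)
  ultimately have "ennreal a = ennreal (2 ^ n * a)"
    by (simp add: ennreal_mult)
  then have "(2::real) ^ n = 1" using a(2) by simp
  moreover have "(1::real) < 2 ^ n" using n_pos by (intro one_less_power) auto
  ultimately show False by simp
qed

lemma emeasure_cball:
  assumes "0 \<le> r"
  shows "emeasure L (cball 0 r) = ennreal (r ^ n) * emeasure L (cball 0 1)"
  using assms emeasure_cball_pos[of r] emeasure_0 n_pos by (cases "r = 0") auto

lemma sigma_finite_L: "sigma_finite_measure L"
proof (rule sigma_finite_measure.intro, intro exI[of _ "range (\<lambda>i::nat. cball (0::'a) (real i))"] conjI ballI)
  show "\<Union> (range (\<lambda>i::nat. cball (0::'a) (real i))) = space L"
    using real_arch_simple by (auto simp: dist_norm)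
qed (use emeasure_cball_finite in \<open>auto simp: less_top\<close>)

sublocale L: sigma_finite_measure L
  by (rule sigma_finite_L)

sublocale S: prob_space sphere_law
  by (rule prob_space_sphere_law)

text \<open>Known as the measure with density proportional to \<open>r ^ (n - 1)\<close> on the
  positive half-line; as an image measure it needs no explicit density.\<close>

definition radial_law :: "real measure"
  where "radial_law = distr L borel norm"

lemma sets_radial_law [measurable_cong, simp]: "sets radial_law = sets borel"
  by (simp add: radial_law_def)

lemma space_radial_law [simp]: "space radial_law = UNIV"
  by (simp add: radial_law_def)

lemma emeasure_radial_law:
  "T \<in> sets borel \<Longrightarrow> emeasure radial_law T = emeasure L {w. norm w \<in> T}"
  unfolding radial_law_def by (subst emeasure_distr) (auto simp: vimage_def)

sublocale R: sigma_finite_measure radial_law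
proof (rule sigma_finite_measure.intro, intro exI[of _ "range (\<lambda>i::nat. {..real i})"] conjI ballI)
  show "\<Union> (range (\<lambda>i::nat. {..real i})) = space radial_law"
    using real_arch_simple by auto
  fix a assume "a \<in> range (\<lambda>i::nat. {..real i})"
  then obtain i :: nat where "a = {..real i}" by auto
  moreover have "{w::'a. norm w \<in> {..real i}} = cball 0 (real i)" by auto
  ultimately show "emeasure radial_law a \<noteq> \<infinity>"
    using emeasure_cball_finite[of "real i"] by (simp add: emeasure_radial_law less_top)
qed auto

text \<open>For fixed \<open>A\<close> both sides are measures in \<open>T\<close>. They agree on
  the half-lines \<open>{..r}\<close> by dilation of the unit sector, and half-lines are closed
  under intersection and generate the Borel sets.\<close>

lemma emeasure_polar_rectangle:
  assumes T: "T \<in> sets borel" and A [measurable]: "A \<in> sets borel"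
  shows "emeasure L {w. norm w \<in> T \<and> sgn w \<in> A} = emeasure radial_law T * emeasure sphere_law A"
proof -
  let ?D = "density L (indicator (sgn -` A))"
  have meas [measurable]: "sgn -` A \<in> sets (borel :: 'a measure)"
    by (rule measurable_sets_borel[of sgn borel]) auto
  have em: "emeasure (distr ?D borel norm) T = emeasure L {w. norm w \<in> T \<and> sgn w \<in> A}"
    if [measurable]: "T \<in> sets borel" for T
  proof -
    have "emeasure (distr ?D borel norm) T = emeasure ?D (norm -` T)"
      by (subst emeasure_distr) auto
    also have "\<dots> = (\<integral>\<^sup>+w. indicator (sgn -` A) w * indicator (norm -` T) w \<partial>L)"
      by (rule emeasure_density) (auto intro!: measurable_sets_borel[of norm borel])
    also have "\<dots> = (\<integral>\<^sup>+w. indicator {w. norm w \<in> T \<and> sgn w \<in> A} w \<partial>L)"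
      by (intro nn_integral_cong) (auto split: split_indicator)
    also have "\<dots> = emeasure L {w. norm w \<in> T \<and> sgn w \<in> A}"
      by (rule nn_integral_indicator) measurable
    finally show ?thesis .
  qed
  have "distr ?D borel norm = scale_measure (emeasure sphere_law A) radial_law"
  proof (rule measure_eqI_generator_eq[where E="range atMost" and \<Omega>=UNIV and A="\<lambda>i. {..real i}"])
    show "Int_stable (range atMost :: real set set)"
      by (auto simp: Int_stable_def)
    fix X :: "real set" assume "X \<in> range atMost"
    then obtain r where X: "X = {..r}" by auto
    have "emeasure L {w. norm w \<le> r \<and> sgn w \<in> A} = emeasure sphere_law A * emeasure L (cball 0 r)"
    proof (cases "0 < r")
      case True
      then show ?thesis
        by (simp only: emeasure_sector[OF A True] emeasure_sphere_law[OF A] emeasure_cball_pos[OF True] mult_ac)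
    next
      case False
      then have "w = 0" if "norm w \<le> r" for w :: 'a
        using that False order_trans[OF norm_ge_zero that] by simp
      then have sub: "{w. norm w \<le> r \<and> sgn w \<in> A} \<subseteq> {0::'a}" "cball (0::'a) r \<subseteq> {0}"
        by auto
      have "emeasure L {w. norm w \<le> r \<and> sgn w \<in> A} \<le> 0" "emeasure L (cball 0 r) \<le> 0"
        using emeasure_mono[OF sub(1), of L] emeasure_mono[OF sub(2), of L] emeasure_0 by auto
      then show ?thesis by auto
    qed
    moreover have "{w::'a. norm w \<in> {..r}} = cball 0 r" by auto
    ultimately show "emeasure (distr ?D borel norm) X = emeasure (scale_measure (emeasure sphere_law A) radial_law) X"
      by (simp add: em X emeasure_radial_law)
  next
    fix i :: nat
    have "emeasure L {w. norm w \<le> real i \<and> sgn w \<in> A} \<le> emeasure L (cball 0 (real i))"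
      by (intro emeasure_mono) auto
    also have "\<dots> < \<infinity>" by (rule emeasure_cball_finite)
    finally show "emeasure (distr ?D borel norm) {..real i} \<noteq> \<infinity>"
      by (simp add: em)
  next
    show "(\<Union>i. {..real i}) = UNIV" using real_arch_simple by auto
  qed (auto simp: borel_eq_atMost)
  then have "emeasure (distr ?D borel norm) T = emeasure sphere_law A * emeasure radial_law T"
    by simp
  then show ?thesis using em[OF T] by (simp add: mult.commute)
qed

lemma polar: "distr L (borel \<Otimes>\<^sub>M borel) (\<lambda>w. (norm w, sgn w)) = radial_law \<Otimes>\<^sub>M sphere_law"
proof (rule pair_measure_eqI[symmetric])
  fix A B assume AB [measurable]: "A \<in> sets radial_law" "B \<in> sets sphere_law"
  have "emeasure (distr L (borel \<Otimes>\<^sub>M borel) (\<lambda>w. (norm w, sgn w))) (A \<times> B) =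
    emeasure L {w. norm w \<in> A \<and> sgn w \<in> B}"
    using AB by (subst emeasure_distr) (auto intro!: arg_cong[where f="emeasure L"])
  then show "emeasure radial_law A * emeasure sphere_law B =
    emeasure (distr L (borel \<Otimes>\<^sub>M borel) (\<lambda>w. (norm w, sgn w))) (A \<times> B)"
    using AB by (simp add: emeasure_polar_rectangle)
qed (auto intro: R.sigma_finite_measure_axioms S.sigma_finite_measure_axioms intro!: sets_pair_measure_cong)

lemma nn_integral_polar:
  fixes f :: "real \<Rightarrow> 'a \<Rightarrow> ennreal"
  assumes [measurable]: "case_prod f \<in> borel_measurable (borel \<Otimes>\<^sub>M borel)"
  shows "(\<integral>\<^sup>+w. f (norm w) (sgn w) \<partial>L) = (\<integral>\<^sup>+r. (\<integral>\<^sup>+e. f r e \<partial>sphere_law) \<partial>radial_law)"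
proof -
  have "(\<integral>\<^sup>+w. f (norm w) (sgn w) \<partial>L) =
    (\<integral>\<^sup>+z. case_prod f z \<partial>distr L (borel \<Otimes>\<^sub>M borel) (\<lambda>w. (norm w, sgn w)))"
    by (subst nn_integral_distr) auto
  also have "\<dots> = (\<integral>\<^sup>+r. (\<integral>\<^sup>+e. f r e \<partial>sphere_law) \<partial>radial_law)"
    unfolding polar by (subst S.nn_integral_fst[symmetric]) (auto simp: cong: measurable_cong_sets)
  finally show ?thesis .
qed

lemma nn_integral_radial:
  fixes q :: "real \<Rightarrow> ennreal"
  assumes [measurable]: "q \<in> borel_measurable borel"
  shows "(\<integral>\<^sup>+w. q (norm w) \<partial>L) = (\<integral>\<^sup>+r. q r \<partial>radial_law)"
  unfolding radial_law_def by (subst nn_integral_distr) auto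

lemma nn_integral_polar_mult:
  fixes q :: "real \<Rightarrow> ennreal" and \<psi> :: "'a \<Rightarrow> ennreal"
  assumes [measurable]: "q \<in> borel_measurable borel" "\<psi> \<in> borel_measurable borel"
  shows "(\<integral>\<^sup>+w. q (norm w) * \<psi> (sgn w) \<partial>L) = (\<integral>\<^sup>+w. q (norm w) \<partial>L) * (\<integral>\<^sup>+e. \<psi> e \<partial>sphere_law)"
  by (subst nn_integral_polar[of "\<lambda>r e. q r * \<psi> e"])
    (auto simp: nn_integral_cmult nn_integral_multc nn_integral_radial)

lemma integral_polar_mult:
  fixes q :: "real \<Rightarrow> real" and \<psi> :: "'a \<Rightarrow> real"
  assumes [measurable]: "q \<in> borel_measurable borel" "\<psi> \<in> borel_measurable borel"
    and q: "integrable L (\<lambda>w. q (norm w))" and \<psi>: "integrable sphere_law \<psi>"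
  shows "integrable L (\<lambda>w. q (norm w) * \<psi> (sgn w))"
    and "(\<integral>w. q (norm w) * \<psi> (sgn w) \<partial>L) = (\<integral>w. q (norm w) \<partial>L) * (\<integral>e. \<psi> e \<partial>sphere_law)"
proof -
  interpret P: pair_sigma_finite radial_law sphere_law ..
  have q': "integrable radial_law q"
    using q by (simp add: radial_law_def integrable_distr_eq)
  have *: "integrable (radial_law \<Otimes>\<^sub>M sphere_law) (\<lambda>z. q (fst z) * \<psi> (snd z))"
    using q' \<psi> by (intro P.Fubini_integrable) (auto simp: abs_mult)
  then show "integrable L (\<lambda>w. q (norm w) * \<psi> (sgn w))"
    unfolding polar[symmetric] by (subst (asm) integrable_distr_eq) auto
  have "(\<integral>w. q (norm w) * \<psi> (sgn w) \<partial>L) =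
     (\<integral>z. q (fst z) * \<psi> (snd z) \<partial>(radial_law \<Otimes>\<^sub>M sphere_law))"
    unfolding polar[symmetric] by (subst integral_distr) auto
  also have "\<dots> = (\<integral>r. (\<integral>e. q r * \<psi> e \<partial>sphere_law) \<partial>radial_law)"
    using P.integral_fst'[OF *] by simp
  also have "\<dots> = (\<integral>r. q r \<partial>radial_law) * (\<integral>e. \<psi> e \<partial>sphere_law)"
    by simp
  also have "(\<integral>r. q r \<partial>radial_law) = (\<integral>w. q (norm w) \<partial>L)"
    unfolding radial_law_def by (subst integral_distr) auto
  finally show "(\<integral>w. q (norm w) * \<psi> (sgn w) \<partial>L) = (\<integral>w. q (norm w) \<partial>L) * (\<integral>e. \<psi> e \<partial>sphere_law)" .
qed

section \<open>Volumes of balls and shells; spheres are null sets\<close>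

lemma fmeasurable_cball [simp]: "cball 0 r \<in> fmeasurable L"
  using emeasure_cball_finite[of r] by (simp add: fmeasurable_def)

lemma measure_cball:
  assumes "0 \<le> r"
  shows "measure L (cball 0 r) = r ^ n * measure L (cball 0 1)"
  using assms by (simp add: measure_def emeasure_cball[of r] enn2real_mult)

lemma measure_cball_pos: "0 < measure L (cball 0 1)"
  using ball by (simp add: measure_def enn2real_positive_iff)

lemma measure_shell:
  assumes "0 \<le> r" "r \<le> R"
  shows "measure L {w. r < norm w \<and> norm w \<le> R} = (R ^ n - r ^ n) * measure L (cball 0 1)"
proof -
  have "{w. r < norm w \<and> norm w \<le> R} = cball 0 R - cball (0::'a) r" by auto
  moreover have "measure L (cball 0 R - cball 0 r) = measure L (cball 0 R) - measure L (cball 0 r)"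
    using assms by (intro measurable_measure_Diff) auto
  ultimately show ?thesis using assms by (simp add: measure_cball[of r] measure_cball[of R] left_diff_distrib)
qed

text \<open>The sphere of radius \<open>r\<close> lies in every shell between \<open>t * r\<close>
  and \<open>r\<close>, whose volume tends to 0 as \<open>t\<close> tends to 1. This makes the kinks
  of a radial cutoff negligible.\<close>

lemma AE_norm_neq: "AE w in L. norm w \<noteq> r"
proof (cases "0 < r")
  case True
  have "measure L ({w::'a. norm w = r}) \<le> (r ^ n - (t * r) ^ n) * measure L (cball 0 1)" if "0 < t" "t < 1" for t
  proof -
    have tr: "0 < t * r" "t * r < r" using that True by auto
    have "measure L ({w::'a. norm w = r}) \<le> measure L {w. t * r < norm w \<and> norm w \<le> r}"
    proof (rule measure_mono_fmeasurable)
      show "{w::'a. t * r < norm w \<and> norm w \<le> r} \<in> fmeasurable L"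
        by (rule fmeasurableI2[of "cball 0 r"]) auto
    qed (use tr in auto)
    then show ?thesis using measure_shell[OF less_imp_le less_imp_le, OF tr] by simp
  qed
  moreover have "((\<lambda>t. (r ^ n - (t * r) ^ n) * measure L (cball 0 1)) \<longlongrightarrow> (r ^ n - (1 * r) ^ n) * measure L (cball 0 1)) (at_left 1)"
    by (intro tendsto_intros)
  ultimately have "measure L ({w::'a. norm w = r}) \<le> (r ^ n - (1 * r) ^ n) * measure L (cball 0 1)"
    by (intro tendsto_lowerbound[where F="at_left (1::real)"]) (auto intro!: eventually_at_leftI[of 0])
  moreover have "{w::'a. norm w = r} \<in> fmeasurable L"
    by (rule fmeasurableI2[of "cball 0 r"]) auto
  ultimately have "{w::'a. norm w = r} \<in> null_sets L"
    by (auto simp: emeasure_eq_measure2 measure_le_0_iff)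
  then show ?thesis
    by (rule AE_I') auto
next
  case False
  have "{0} \<in> null_sets L" using emeasure_0 by auto
  then show ?thesis
    by (rule AE_I') (use False in auto)
qed

lemma AE_sphere_law: "AE e in sphere_law. e \<in> V \<and> norm e = 1"
proof -
  have [measurable]: "V \<in> sets borel" using closed_V by auto
  have "AE w in L. sgn w \<in> V \<and> norm (sgn w) = 1"
    using AE_V AE_norm_neq[of 0]
    by eventually_elim (auto simp: sgn_div_norm subspace_V subspace_scale)
  then have "AE w in L. w \<in> cball 0 1 \<longrightarrow> sgn w \<in> V \<and> norm (sgn w) = 1"
    by eventually_elim auto
  then have "AE w in uniform_measure L (cball 0 1). sgn w \<in> V \<and> norm (sgn w) = 1"
    using ball by (intro AE_uniform_measureI) auto
  then show ?thesis
    unfolding sphere_law_def by (subst AE_distr_iff) auto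
qed

end

subsection \<open>Gradients from sphere averages\<close>

context homogeneous_measure
begin

lemma borel_V [measurable]: "V \<in> sets borel"
  using closed_V by auto

lemma borel_openin_V:
  assumes "openin (top_of_set V) W"
  shows "W \<in> sets borel"
proof -
  obtain T where "open T" "W = V \<inter> T" using assms by (auto simp: openin_open)
  then show ?thesis by auto
qed

lemma integral_translate:
  fixes f :: "'a \<Rightarrow> real"
  assumes "d \<in> V" and [measurable]: "f \<in> borel_measurable borel"
  shows "(\<integral>w. f (w + d) \<partial>L) = (\<integral>w. f w \<partial>L)"
proof -
  have "(\<integral>w. f w \<partial>L) = (\<integral>w. f w \<partial>distr L borel (\<lambda>w. w + d))"
    by (simp add: translate[OF \<open>d \<in> V\<close>])
  also have "\<dots> = (\<integral>w. f (w + d) \<partial>L)"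
    by (subst integral_distr) auto
  finally show ?thesis ..
qed

lemma integrable_bounded_support:
  fixes f :: "'a \<Rightarrow> real"
  assumes [measurable]: "f \<in> borel_measurable borel"
    and f: "\<And>w. norm w \<le> r \<Longrightarrow> \<bar>f w\<bar> \<le> C" "\<And>w. r < norm w \<Longrightarrow> f w = 0"
  shows "integrable L f"
proof (rule Bochner_Integration.integrable_bound)
  show "integrable L (\<lambda>w. C * indicator (cball 0 r) w)"
    using emeasure_cball_finite[of r]
    by (intro integrable_mult_right integrable_real_indicator) (auto simp: less_top)
  show "AE w in L. norm (f w) \<le> norm (C * indicator (cball 0 r) w)"
    using f by (intro AE_I2) (auto split: split_indicator intro: order_trans[OF _ abs_ge_self])
qed measurable

text \<open>
  This replaces the divergence theorem.  The increments of \<open>\<Phi>\<close> along \<open>h d\<close> are integrated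
  against the radial cutoff \<open>\<kappa>(r) = max 0 (min 1 ((1 - r) / \<eta>))\<close>, and translation moves the
  increment onto \<open>\<kappa>\<close>.  For \<open>h \<rightarrow> 0\<close> only the shell \<open>1 - \<eta> < norm p \<le> 1\<close> contributes, and
  for \<open>\<eta> \<rightarrow> 0\<close> the shell becomes the sphere.
\<close>

lemma sphere_gradient_bound:
  fixes \<Phi> :: "'a \<Rightarrow> real"
  assumes W: "openin (top_of_set V) W" and Lip: "K-lipschitz_on W \<Phi>"
    and ball_W: "V \<inter> cball 0 1 \<subseteq> W" and d: "d \<in> V"
    and shift: "\<And>p h. p \<in> V \<Longrightarrow> norm p \<le> 1 \<Longrightarrow> 0 \<le> h \<Longrightarrow> h \<le> 1 \<Longrightarrow> p - h *\<^sub>R d \<in> W"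
    and conv: "\<And>p h. p \<in> V \<Longrightarrow> norm p \<le> 1 \<Longrightarrow> 0 < h \<Longrightarrow> h < 1 \<Longrightarrow>
      \<Phi> (p - h *\<^sub>R d) \<le> (1 - h) * \<Phi> p + h * \<Phi> (p - d) - h * (1 - h) * c"
  shows "\<Phi> 0 - \<Phi> (- d) + c - 2 * K \<le>
    real n * (\<integral>e. (indicator W e * \<Phi> e) * (e \<bullet> d) \<partial>sphere_law)"
proof -
  \<comment> \<open>\<open>\<Phi>\<close> is controlled on \<open>W\<close> only. The extension by
    zero is Borel everywhere and agrees with \<open>\<Phi>\<close> at the points of \<open>V\<close>
    that the cutoffs below select.\<close>
  define \<Phi>0 where "\<Phi>0 = (\<lambda>w. indicator W w * \<Phi> w)"
  have W_V: "W \<subseteq> V" using W by (simp add: openin_imp_subset)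
  have K: "0 \<le> K" using Lip by (rule lipschitz_on_nonneg)
  have in_W: "p \<in> W" if "p \<in> V" "norm p \<le> 1" for p using ball_W that by auto
  have zero_V: "0 \<in> V" using subspace_V by (rule subspace_0)
  have zero_W: "0 \<in> W" using in_W[OF zero_V] by simp
  have lip: "\<bar>\<Phi> p - \<Phi> q\<bar> \<le> K * norm (p - q)" if "p \<in> W" "q \<in> W" for p q
    using lipschitz_onD[OF Lip that] by (simp add: dist_norm)
  have [measurable]: "\<Phi>0 \<in> borel_measurable borel"
    using borel_measurable_continuous_on_indicator[OF borel_openin_V[OF W] lipschitz_on_continuous_on[OF Lip]]
    by (simp add: \<Phi>0_def)
  \<comment> \<open>The radius \<open>1 + norm d\<close> covers the unit ball and all its shifts by
    \<open>h *\<^sub>R d\<close> with \<open>h\<close> at most 1, so one constant serves every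
    domination argument.\<close>
  define C where "C = \<bar>\<Phi> 0\<bar> + K * (1 + norm d)"
  have C: "\<bar>\<Phi>0 p\<bar> \<le> C" if "norm p \<le> 1 + norm d" for p
  proof (cases "p \<in> W")
    case True
    have "\<bar>\<Phi> p\<bar> \<le> \<bar>\<Phi> 0\<bar> + K * norm p"
      using lip[OF True zero_W] by simp
    also have "\<dots> \<le> C"
      unfolding C_def using that K by (intro add_left_mono mult_left_mono) auto
    finally show ?thesis using True by (simp add: \<Phi>0_def)
  qed (use K in \<open>simp add: \<Phi>0_def C_def\<close>)
  have C0: "0 \<le> C" using C[of 0] by simp
  define E where "E = (\<integral>e. \<Phi>0 e * (e \<bullet> d) \<partial>sphere_law)"
  \<comment> \<open>A lower bound for \<open>\<Phi> p - \<Phi> (p - d)\<close> on the whole unit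
    ball: replacing \<open>p\<close> by 0 changes each of the two values by at most
    \<open>K\<close>.\<close>
  define A where "A = \<Phi> 0 - \<Phi> (- d) - 2 * K"
  define vol where "vol = measure L (cball 0 1)"
  have vol: "0 < vol" unfolding vol_def by (rule measure_cball_pos)
  have neg_d: "- d \<in> W" using shift[OF zero_V, of 1] by simp
  have int_E: "integrable sphere_law (\<lambda>e. \<Phi>0 e * (e \<bullet> d))"
  proof (rule S.integrable_const_bound[where B="C * norm d"])
    show "AE e in sphere_law. norm (\<Phi>0 e * (e \<bullet> d)) \<le> C * norm d"
      using AE_sphere_law
    proof eventually_elim
      case (elim e)
      then have "\<bar>\<Phi>0 e\<bar> \<le> C" "\<bar>e \<bullet> d\<bar> \<le> norm d"
        using C[of e] Cauchy_Schwarz_ineq2[of e d] by auto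
      then show ?case using C0 by (simp add: abs_mult mult_mono)
    qed
  qed measurable
  define J where "J = (\<lambda>\<eta>. \<integral>p. max 0 (min 1 ((1 - norm p) / \<eta>)) \<partial>L)"
  \<comment> \<open>All three estimates pass to the limit \<open>\<eta> \<rightarrow> 0\<close>:
    \<open>J \<eta>\<close> is squeezed to \<open>vol\<close>, the quotient tends to
    \<open>real n\<close>, and the term with \<open>K * norm d * \<eta>\<close> vanishes.\<close>
  have main: "(1 - \<eta>) ^ n * vol \<le> J \<eta> \<and> J \<eta> \<le> vol \<and>
      (A + c) * J \<eta> \<le> (1 - (1 - \<eta>) ^ n) / \<eta> * vol * (E + K * norm d * \<eta>)"
    if \<eta>: "0 < \<eta>" "\<eta> < 1" for \<eta>
  proof -
    define \<kappa> where "\<kappa> = (\<lambda>r. max 0 (min 1 ((1 - r) / \<eta>)) :: real)"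
    have [measurable]: "\<kappa> \<in> borel_measurable borel" unfolding \<kappa>_def by measurable
    have \<kappa>01: "0 \<le> \<kappa> r" "\<kappa> r \<le> 1" for r unfolding \<kappa>_def by auto
    have \<kappa>0: "\<kappa> r = 0" if "1 \<le> r" for r using that \<eta> by (simp add: \<kappa>_def divide_nonpos_pos max_absorb1 min_absorb2)
    have \<kappa>1: "\<kappa> r = 1" if "r \<le> 1 - \<eta>" for r using that \<eta> by (simp add: \<kappa>_def min_absorb1)
    have \<kappa>mid: "\<kappa> r = (1 - r) / \<eta>" if "1 - \<eta> \<le> r" "r \<le> 1" for r using that \<eta> by (simp add: \<kappa>_def)
    have \<kappa>_lip: "\<bar>\<kappa> r - \<kappa> s\<bar> \<le> \<bar>r - s\<bar> / \<eta>" for r s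
    proof -
      have "\<bar>\<kappa> r - \<kappa> s\<bar> \<le> \<bar>(1 - r) / \<eta> - (1 - s) / \<eta>\<bar>" unfolding \<kappa>_def by linarith
      also have "\<dots> = \<bar>r - s\<bar> / \<eta>" using \<eta> by (simp add: diff_divide_distrib[symmetric] abs_minus_commute)
      finally show ?thesis .
    qed
    have J: "J \<eta> = (\<integral>p. \<kappa> (norm p) \<partial>L)" by (simp add: J_def \<kappa>_def)
    have int_\<kappa>: "integrable L (\<lambda>p. \<kappa> (norm p))"
      by (rule integrable_bounded_support[where r=1 and C=1]) (use \<kappa>0 \<kappa>01 in \<open>auto simp: abs_le_iff intro: order_trans[of _ 0]\<close>)
    have int_ball: "integrable L (indicator (cball 0 r) :: 'a \<Rightarrow> real)" for r
      by (rule integrable_bounded_support[where r=r and C=1]) (auto split: split_indicator intro!: borel_measurable_indicator)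
    have "(\<integral>p. indicator (cball 0 (1 - \<eta>)) p \<partial>L) \<le> J \<eta>"
      unfolding J using \<kappa>1 \<kappa>01 by (intro integral_mono int_\<kappa> int_ball) (auto split: split_indicator)
    then have J1: "(1 - \<eta>) ^ n * vol \<le> J \<eta>" using \<eta> by (simp add: measure_cball[of "1 - \<eta>"] vol_def)
    have "J \<eta> \<le> (\<integral>p. indicator (cball 0 1) p \<partial>L)"
      unfolding J using \<kappa>0 \<kappa>01 by (intro integral_mono int_\<kappa> int_ball) (auto split: split_indicator)
    then have J2: "J \<eta> \<le> vol" by (simp add: vol_def)
    have step1: "(A + (1 - h) * c) * J \<eta> \<le> (\<integral>p. \<Phi>0 p * ((\<kappa> (norm p) - \<kappa> (norm (p + h *\<^sub>R d))) / h) \<partial>L)"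
      if h: "0 < h" "h < 1" for h
    proof -
      have hd: "norm (h *\<^sub>R d) \<le> norm d" using h by (simp add: mult_left_le_one_le)
      have hdV: "h *\<^sub>R d \<in> V" using d subspace_V by (simp add: subspace_scale)
      have i1: "integrable L (\<lambda>p. \<kappa> (norm p) * \<Phi>0 p)"
      proof (rule integrable_bounded_support[where r=1 and C=C])
        fix w :: 'a assume "norm w \<le> 1"
        then have "\<bar>\<Phi>0 w\<bar> \<le> C" using norm_ge_zero[of d] by (intro C) linarith
        then show "\<bar>\<kappa> (norm w) * \<Phi>0 w\<bar> \<le> C"
          using \<kappa>01[of "norm w"] C0 mult_mono[of "\<bar>\<kappa> (norm w)\<bar>" 1 "\<bar>\<Phi>0 w\<bar>" C] by (simp add: abs_mult)
      qed (use \<kappa>0 in auto)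
      have i2: "integrable L (\<lambda>p. \<kappa> (norm p) * \<Phi>0 (p - h *\<^sub>R d))"
      proof (rule integrable_bounded_support[where r=1 and C=C])
        fix w :: 'a assume "norm w \<le> 1"
        then have "norm (w - h *\<^sub>R d) \<le> 1 + norm d"
          using hd norm_triangle_ineq4[of w "h *\<^sub>R d"] by linarith
        then show "\<bar>\<kappa> (norm w) * \<Phi>0 (w - h *\<^sub>R d)\<bar> \<le> C"
          using C[of "w - h *\<^sub>R d"] \<kappa>01[of "norm w"] C0
            mult_mono[of "\<bar>\<kappa> (norm w)\<bar>" 1 "\<bar>\<Phi>0 (w - h *\<^sub>R d)\<bar>" C] by (simp add: abs_mult)
      qed (use \<kappa>0 in auto)
      have i3: "integrable L (\<lambda>p. \<kappa> (norm (p + h *\<^sub>R d)) * \<Phi>0 p)"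
      proof (rule integrable_bounded_support[where r="1 + norm d" and C=C])
        fix w :: 'a assume "norm w \<le> 1 + norm d"
        then show "\<bar>\<kappa> (norm (w + h *\<^sub>R d)) * \<Phi>0 w\<bar> \<le> C"
          using C[of "w"] \<kappa>01[of "norm (w + h *\<^sub>R d)"] C0
            mult_mono[of "\<bar>\<kappa> (norm (w + h *\<^sub>R d))\<bar>" 1 "\<bar>\<Phi>0 w\<bar>" C] by (simp add: abs_mult)
      next
        fix w :: 'a assume "1 + norm d < norm w"
        then have "1 \<le> norm (w + h *\<^sub>R d)"
          using hd norm_diff_ineq[of w "h *\<^sub>R d"] by linarith
        then show "\<kappa> (norm (w + h *\<^sub>R d)) * \<Phi>0 w = 0" using \<kappa>0 by simp
      qed auto
      have tr: "(\<integral>p. \<kappa> (norm p) * \<Phi>0 (p - h *\<^sub>R d) \<partial>L) = (\<integral>p. \<kappa> (norm (p + h *\<^sub>R d)) * \<Phi>0 p \<partial>L)"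
        using integral_translate[OF hdV, of "\<lambda>p. \<kappa> (norm p) * \<Phi>0 (p - h *\<^sub>R d)"] by simp
      have "(A + (1 - h) * c) * J \<eta> = (\<integral>p. (A + (1 - h) * c) * \<kappa> (norm p) \<partial>L)"
        unfolding J by simp
      also have "\<dots> \<le> (\<integral>p. (\<kappa> (norm p) * \<Phi>0 p - \<kappa> (norm p) * \<Phi>0 (p - h *\<^sub>R d)) / h \<partial>L)"
      proof (rule integral_mono_AE)
        show "AE p in L. (A + (1 - h) * c) * \<kappa> (norm p) \<le>
          (\<kappa> (norm p) * \<Phi>0 p - \<kappa> (norm p) * \<Phi>0 (p - h *\<^sub>R d)) / h"
          using AE_V
        proof eventually_elim
          case (elim p)
          show ?case
          proof (cases "norm p \<le> 1")
            case True
            have W1: "p \<in> W" "p - h *\<^sub>R d \<in> W" "p - d \<in> W"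
              using elim True h shift[of p h] shift[of p 1] in_W by auto
            have "\<bar>\<Phi> p - \<Phi> 0\<bar> \<le> K" "\<bar>\<Phi> (p - d) - \<Phi> (- d)\<bar> \<le> K"
              using lip[OF W1(1) zero_W] lip[OF W1(3) neg_d] True mult_left_mono[OF True K] by auto
            then have "A \<le> \<Phi> p - \<Phi> (p - d)" unfolding A_def by linarith
            then have "h * (A + (1 - h) * c) \<le> h * (\<Phi> p - \<Phi> (p - d) + (1 - h) * c)"
              using h by (intro mult_left_mono) auto
            also have "\<dots> \<le> \<Phi> p - \<Phi> (p - h *\<^sub>R d)"
              using conv[OF elim True h] by (simp add: algebra_simps)
            finally have "(A + (1 - h) * c) \<le> (\<Phi> p - \<Phi> (p - h *\<^sub>R d)) / h"
              using h by (simp add: field_simps)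
            then have "\<kappa> (norm p) * (A + (1 - h) * c) \<le> \<kappa> (norm p) * ((\<Phi> p - \<Phi> (p - h *\<^sub>R d)) / h)"
              using \<kappa>01 by (intro mult_left_mono)
            then show ?thesis using W1 by (simp add: \<Phi>0_def algebra_simps)
          qed (use \<kappa>0 in auto)
        qed
      qed (use i1 i2 int_\<kappa> in auto)
      also have "\<dots> = ((\<integral>p. \<kappa> (norm p) * \<Phi>0 p \<partial>L) - (\<integral>p. \<kappa> (norm (p + h *\<^sub>R d)) * \<Phi>0 p \<partial>L)) / h"
        using i1 i2 tr by simp
      also have "\<dots> = (\<integral>p. (\<kappa> (norm p) * \<Phi>0 p - \<kappa> (norm (p + h *\<^sub>R d)) * \<Phi>0 p) / h \<partial>L)"
        using i1 i3 by simp
      also have "\<dots> = (\<integral>p. \<Phi>0 p * ((\<kappa> (norm p) - \<kappa> (norm (p + h *\<^sub>R d))) / h) \<partial>L)"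
        by (intro Bochner_Integration.integral_cong) (auto simp: algebra_simps diff_divide_distrib)
      finally show ?thesis .
    qed
    define q where "q = (\<lambda>r. indicator {1 - \<eta><..1} r :: real)"
    have [measurable]: "q \<in> borel_measurable borel" unfolding q_def by measurable
    define f where "f = (\<lambda>p. \<Phi>0 p * (q (norm p) / \<eta> * (sgn p \<bullet> d)))"
    define h where "h = (\<lambda>j::nat. 1 / (real j + 2))"
    let ?q = "\<lambda>p j. (\<kappa> (norm p) - \<kappa> (norm (p + h j *\<^sub>R d))) / h j"
    have h: "0 < h j" "h j < 1" for j by (auto simp: h_def)
    have h0: "h \<longlonglongrightarrow> 0" unfolding h_def by real_asymp
    have [measurable]: "f \<in> borel_measurable borel" unfolding f_def by measurable
    \<comment> \<open>Off the two null spheres the quotient converges to minus the derivative of the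
      cutoff, \<open>1 / \<eta>\<close> on the shell and 0 elsewhere, times the directional
      derivative \<open>sgn p \<bullet> d\<close> of the norm. The cutoff is Lipschitz with constant
      \<open>1 / \<eta>\<close>, which gives the dominating function.\<close>
    have lim: "(\<lambda>j. \<integral>p. \<Phi>0 p * ?q p j \<partial>L) \<longlonglongrightarrow> (\<integral>p. f p \<partial>L)"
    proof (rule integral_dominated_convergence[where w="\<lambda>p. C * (norm d / \<eta>) * indicator (cball 0 (1 + norm d)) p"])
      show "integrable L (\<lambda>p. C * (norm d / \<eta>) * indicator (cball 0 (1 + norm d)) p)"
        using int_ball by simp
      show "AE p in L. norm (\<Phi>0 p * ?q p j)
        \<le> C * (norm d / \<eta>) * indicator (cball 0 (1 + norm d)) p" for j
      proof (rule AE_I2)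
        fix p :: 'a
        show "norm (\<Phi>0 p * ?q p j)
          \<le> C * (norm d / \<eta>) * indicator (cball 0 (1 + norm d)) p"
        proof (cases "norm p \<le> 1 + norm d")
          case True
          have "\<bar>\<kappa> (norm p) - \<kappa> (norm (p + h j *\<^sub>R d))\<bar> \<le> \<bar>norm p - norm (p + h j *\<^sub>R d)\<bar> / \<eta>"
            by (rule \<kappa>_lip)
          also have "\<dots> \<le> (h j * norm d) / \<eta>"
            using norm_triangle_ineq3[of p "p + h j *\<^sub>R d"] h[of j] \<eta> by (intro divide_right_mono) auto
          finally have "\<bar>?q p j\<bar> \<le> norm d / \<eta>"
            using h[of j] by (simp add: field_simps abs_divide)
          then have b: "\<bar>\<Phi>0 p\<bar> * \<bar>?q p j\<bar> \<le> C * (norm d / \<eta>)"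
            using C[OF True] C0 by (intro mult_mono) auto
          have ind: "indicator (cball 0 (1 + norm d)) p = (1::real)" using True by simp
          show ?thesis unfolding ind real_norm_def abs_mult mult_1_right by (rule b)
        next
          case False
          have "norm (h j *\<^sub>R d) \<le> norm d" using h[of j] by (simp add: mult_left_le_one_le)
          then have "1 \<le> norm (p + h j *\<^sub>R d)"
            using False norm_diff_ineq[of p "h j *\<^sub>R d"] by linarith
          moreover have "1 \<le> norm p" using False norm_ge_zero[of d] by linarith
          ultimately show ?thesis using False \<kappa>0 by simp
        qed
      qed
      show "AE p in L. (\<lambda>j. \<Phi>0 p * ?q p j) \<longlonglongrightarrow> f p"
        using AE_norm_neq[of 1] AE_norm_neq[of "1 - \<eta>"]
      proof eventually_elim
        case (elim p)
        have l: "(\<lambda>j. norm (p + h j *\<^sub>R d)) \<longlonglongrightarrow> norm p"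
          by (rule tendsto_eq_intros h0 refl | simp)+
        consider "norm p < 1 - \<eta>" | "1 - \<eta> < norm p" "norm p < 1" | "1 < norm p"
          using elim by linarith
        then have "(\<lambda>j. ?q p j) \<longlonglongrightarrow> q (norm p) / \<eta> * (sgn p \<bullet> d)"
        proof cases
          case 1
          have "eventually (\<lambda>j. ?q p j = 0) sequentially"
            using order_tendstoD(2)[OF l 1] by eventually_elim (use 1 \<kappa>1 in auto)
          then show ?thesis using 1 by (simp add: q_def tendsto_eventually)
        next
          case 3
          have "eventually (\<lambda>j. ?q p j = 0) sequentially"
            using order_tendstoD(1)[OF l 3] by eventually_elim (use 3 \<kappa>0 in auto)
          then show ?thesis using 3 by (simp add: q_def tendsto_eventually)
        next
          case 2
          have pos: "0 < norm p" using 2 \<eta> by linarith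
          have ev: "eventually (\<lambda>j. (2 * (p \<bullet> d) + h j * (d \<bullet> d)) / (norm (p + h j *\<^sub>R d) + norm p) / \<eta> =
            ?q p j) sequentially"
            using order_tendstoD(1)[OF l 2(1)] order_tendstoD(2)[OF l 2(2)]
          proof eventually_elim
            case (elim j)
            let ?s = "norm (p + h j *\<^sub>R d)"
            have sp: "?s + norm p \<noteq> 0"
              using pos norm_ge_zero[of "p + h j *\<^sub>R d"] by linarith
            have "(?s - norm p) * (?s + norm p) = ?s\<^sup>2 - (norm p)\<^sup>2"
              by (simp add: power2_eq_square algebra_simps)
            also have "\<dots> = h j * (2 * (p \<bullet> d) + h j * (d \<bullet> d))"
              by (simp add: power2_norm_eq_inner inner_add_left inner_add_right inner_commute algebra_simps)
            finally have "?s - norm p = h j * (2 * (p \<bullet> d) + h j * (d \<bullet> d)) / (?s + norm p)"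
              by (rule nonzero_eq_divide_eq[OF sp, THEN iffD2])
            moreover have "(\<kappa> (norm p) - \<kappa> ?s) / h j = (?s - norm p) / h j / \<eta>"
              using elim 2 \<kappa>mid by (simp add: diff_divide_distrib mult.commute)
            ultimately show ?case using h[of j] by simp
          qed
          have "(\<lambda>j. (2 * (p \<bullet> d) + h j * (d \<bullet> d)) / (norm (p + h j *\<^sub>R d) + norm p) / \<eta>) \<longlonglongrightarrow>
            (2 * (p \<bullet> d) + 0 * (d \<bullet> d)) / (norm p + norm p) / \<eta>"
            using pos \<eta> by (intro tendsto_intros h0 l) auto
          moreover have "(2 * (p \<bullet> d) + 0 * (d \<bullet> d)) / (norm p + norm p) / \<eta> = q (norm p) / \<eta> * (sgn p \<bullet> d)"
            using 2 pos by (simp add: q_def sgn_div_norm divide_simps)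
          ultimately show ?thesis
            by (intro Lim_transform_eventually[OF _ ev]) (simp only:)
        qed
        then show ?case unfolding f_def by (intro tendsto_intros)
      qed
    qed measurable
    have "(\<lambda>j. (A + (1 - h j) * c) * J \<eta>) \<longlonglongrightarrow> (A + (1 - 0) * c) * J \<eta>"
      by (intro tendsto_intros h0)
    then have "(A + (1 - 0) * c) * J \<eta> \<le> (\<integral>p. f p \<partial>L)"
      by (rule LIMSEQ_le[OF _ lim]) (use step1 h in auto)
    \<comment> \<open>On the shell \<open>p\<close> and \<open>sgn p\<close> are at most
      \<open>\<eta>\<close> apart, so reading \<open>\<Phi>\<close> on the sphere instead of at
      \<open>p\<close> costs \<open>K * \<eta> * norm d\<close>. Afterwards radius and direction
      separate.\<close>
    also have "(\<integral>p. f p \<partial>L) \<le> (\<integral>p. q (norm p) / \<eta> * (\<Phi>0 (sgn p) * (sgn p \<bullet> d)) + K * norm d * q (norm p) \<partial>L)"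
    proof (rule integral_mono_AE)
      have iq: "integrable L (\<lambda>p. q (norm p))"
        by (rule integrable_bounded_support[where r=1 and C=1]) (auto simp: q_def split: split_indicator)
      then have "integrable L (\<lambda>p. q (norm p) / \<eta>)" by simp
      from integral_polar_mult(1)[OF _ _ this int_E]
      show "integrable L (\<lambda>p. q (norm p) / \<eta> * (\<Phi>0 (sgn p) * (sgn p \<bullet> d)) + K * norm d * q (norm p))"
        using iq by auto
      have sd: "\<bar>sgn p \<bullet> d\<bar> \<le> norm d" for p :: 'a
        using Cauchy_Schwarz_ineq2[of "sgn p" d] by (cases "p = 0") (auto simp: norm_sgn)
      show "integrable L f"
      proof (rule integrable_bounded_support[where r=1 and C="C * (1 / \<eta> * norm d)"])
        fix w :: 'a assume w: "norm w \<le> 1"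
        then show "\<bar>f w\<bar> \<le> C * (1 / \<eta> * norm d)"
          using C[of w] C0 \<eta> sd[of w] unfolding f_def abs_mult
          by (intro mult_mono) (auto simp: q_def split: split_indicator)
      qed (auto simp: f_def q_def)
      show "AE p in L. f p \<le> q (norm p) / \<eta> * (\<Phi>0 (sgn p) * (sgn p \<bullet> d)) + K * norm d * q (norm p)"
        using AE_V
      proof eventually_elim
        case (elim p)
        show ?case
        proof (cases "1 - \<eta> < norm p \<and> norm p \<le> 1")
          case True
          then have p0: "p \<noteq> 0" using \<eta> by auto
          have W2: "p \<in> W" "sgn p \<in> W"
            using in_W[of p] in_W[of "sgn p"] elim True p0
            by (auto simp: norm_sgn sgn_div_norm subspace_V subspace_scale)
          have "norm (p - sgn p) = \<bar>norm p - 1\<bar>"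
          proof -
            have "p - sgn p = (norm p - 1) *\<^sub>R sgn p"
              using p0 by (simp add: sgn_div_norm algebra_simps)
            then show ?thesis using p0 by (simp add: norm_sgn)
          qed
          then have "norm (p - sgn p) \<le> \<eta>" using True by auto
          then have "\<bar>\<Phi> p - \<Phi> (sgn p)\<bar> \<le> K * \<eta>"
            using lip[OF W2] mult_left_mono[OF _ K] order_trans by blast
          then have "\<bar>(\<Phi> p - \<Phi> (sgn p)) * (sgn p \<bullet> d)\<bar> \<le> (K * \<eta>) * norm d"
            unfolding abs_mult using sd[of p] by (intro mult_mono) (use K \<eta> in auto)
          then have "(\<Phi> p - \<Phi> (sgn p)) * (sgn p \<bullet> d) \<le> (K * \<eta>) * norm d" by linarith
          then show ?thesis using True W2 \<eta> by (simp add: f_def q_def \<Phi>0_def field_simps)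
        qed (auto simp: f_def q_def)
      qed
    qed
    also have "\<dots> = (\<integral>p. q (norm p) \<partial>L) / \<eta> * (E + K * norm d * \<eta>)"
    proof -
      have iq: "integrable L (\<lambda>p. q (norm p))"
        by (rule integrable_bounded_support[where r=1 and C=1]) (auto simp: q_def split: split_indicator)
      then have iq': "integrable L (\<lambda>p. q (norm p) / \<eta>)" by simp
      have i1: "integrable L (\<lambda>p. q (norm p) / \<eta> * (\<Phi>0 (sgn p) * (sgn p \<bullet> d)))"
        by (rule integral_polar_mult(1)[OF _ _ iq' int_E]) measurable
      have e1: "(\<integral>p. q (norm p) / \<eta> * (\<Phi>0 (sgn p) * (sgn p \<bullet> d)) \<partial>L) = (\<integral>p. q (norm p) / \<eta> \<partial>L) * E"
        unfolding E_def by (rule integral_polar_mult(2)[OF _ _ iq' int_E]) measurable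
      show ?thesis
        unfolding Bochner_Integration.integral_add[OF i1 integrable_mult_right[OF iq]] e1
        using \<eta> by (simp add: field_simps)
    qed
    also have "(\<integral>p. q (norm p) \<partial>L) = (1 - (1 - \<eta>) ^ n) * vol"
    proof -
      have "(\<integral>p. q (norm p) \<partial>L) = (\<integral>p. indicator {w. 1 - \<eta> < norm w \<and> norm w \<le> 1} p \<partial>L)"
        by (intro Bochner_Integration.integral_cong) (auto simp: q_def split: split_indicator)
      also have "\<dots> = measure L {w. 1 - \<eta> < norm w \<and> norm w \<le> 1}" by simp
      finally show ?thesis using measure_shell[of "1 - \<eta>" 1] \<eta> by (simp add: vol_def)
    qed
    finally show ?thesis using J1 J2 by simp
  qed
  have ev: "eventually (\<lambda>\<eta>::real. 0 < \<eta> \<and> \<eta> < 1) (at_right 0)"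
    by (intro eventually_at_rightI[of 0 1]) auto
  have J_lim: "(J \<longlongrightarrow> vol) (at_right 0)"
  proof (rule tendsto_sandwich[of "\<lambda>\<eta>. (1 - \<eta>) ^ n * vol" _ _ "\<lambda>_. vol"])
    have "((\<lambda>\<eta>. (1 - \<eta>) ^ n * vol) \<longlongrightarrow> (1 - 0) ^ n * vol) (at_right 0)"
      by (intro tendsto_intros)
    then show "((\<lambda>\<eta>. (1 - \<eta>) ^ n * vol) \<longlongrightarrow> vol) (at_right 0)" by simp
  qed (use ev main in \<open>auto elim!: eventually_mono\<close>)
  \<comment> \<open>The factor \<open>n\<close> of the estimator arises here, as the ratio of
    surface to volume of the unit ball.\<close>
  have n_lim: "((\<lambda>\<eta>. (1 - (1 - \<eta>) ^ n) / \<eta>) \<longlongrightarrow> real n) (at_right 0)"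
  proof -
    have "((\<lambda>\<eta>::real. 1 - (1 - \<eta>) ^ n) has_real_derivative real n) (at 0)"
      by (auto intro!: derivative_eq_intros)
    then have "((\<lambda>\<eta>::real. (1 - (1 - \<eta>) ^ n) / \<eta>) \<longlongrightarrow> real n) (at 0)"
      by (simp add: has_field_derivative_iff)
    then show ?thesis by (rule filterlim_mono) (auto simp: at_le)
  qed
  have "((\<lambda>\<eta>. (1 - (1 - \<eta>) ^ n) / \<eta> * vol * (E + K * norm d * \<eta>)) \<longlongrightarrow> real n * vol * (E + K * norm d * 0)) (at_right 0)"
    by (intro tendsto_intros n_lim)
  then have "(A + c) * vol \<le> real n * vol * (E + K * norm d * 0)"
    by (rule tendsto_le[OF trivial_limit_at_right_real _ tendsto_mult_left[OF J_lim]])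
      (use ev main in \<open>auto elim!: eventually_mono\<close>)
  then have "(A + c) * vol \<le> (real n * E) * vol" by (simp add: mult_ac)
  then have "A + c \<le> real n * E" using vol by simp
  then show ?thesis by (simp add: A_def E_def \<Phi>0_def)
qed

text \<open>The gradient bound for the linear map \<open>p \<mapsto> p \<bullet> a\<close> and \<open>d = - t a\<close>, with \<open>t \<rightarrow> \<infinity>\<close>.\<close>

lemma sphere_second_moment:
  assumes a: "a \<in> V"
  shows "(\<integral>e. (e \<bullet> a)\<^sup>2 \<partial>sphere_law) \<le> (norm a)\<^sup>2 / real n"
proof -
  let ?I = "\<integral>e. (e \<bullet> a)\<^sup>2 \<partial>sphere_law"
  have "real n * ?I \<le> (norm a)\<^sup>2 + e" if e: "0 < e" for e
  proof -
    \<comment> \<open>The Lipschitz loss \<open>2 * norm a\<close> does not grow with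
      \<open>t\<close>, whereas the main terms are linear in \<open>t\<close>; this choice makes the
      loss at most \<open>t * e\<close>.\<close>
    define t where "t = (2 * norm a + 1) / e"
    have t: "0 < t" using e by (auto simp: t_def intro!: divide_pos_pos add_nonneg_pos)
    have Lip: "(norm a)-lipschitz_on V (\<lambda>p. p \<bullet> a)"
    proof (rule lipschitz_onI)
      fix x y show "dist (x \<bullet> a) (y \<bullet> a) \<le> norm a * dist x y"
        using Cauchy_Schwarz_ineq2[of "x - y" a] by (simp add: dist_norm inner_diff_left mult.commute)
    qed auto
    have aV: "- (t *\<^sub>R a) \<in> V" using a subspace_V by (simp add: subspace_scale subspace_neg)
    have "(0 \<bullet> a) - (- (- (t *\<^sub>R a))) \<bullet> a + 0 - 2 * norm a \<le>
      real n * (\<integral>e. (indicator V e * (e \<bullet> a)) * (e \<bullet> (- (t *\<^sub>R a))) \<partial>sphere_law)"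
      using subspace_V aV
      by (intro sphere_gradient_bound[OF _ Lip _ aV])
        (auto simp: inner_diff_left inner_simps algebra_simps subspace_add subspace_scale subspace_diff a)
    also have "(\<integral>e. (indicator V e * (e \<bullet> a)) * (e \<bullet> (- (t *\<^sub>R a))) \<partial>sphere_law) =
      (\<integral>e. - t * (e \<bullet> a)\<^sup>2 \<partial>sphere_law)"
      by (intro integral_cong_AE) (use AE_sphere_law in \<open>auto elim!: eventually_mono simp: power2_eq_square\<close>)
    finally have "- t * (norm a)\<^sup>2 - 2 * norm a \<le> - t * (real n * ?I)"
      by (simp add: power2_norm_eq_inner mult_ac)
    then have "t * (real n * ?I) \<le> t * (norm a)\<^sup>2 + (2 * norm a + 1)" by simp
    also have "\<dots> = t * ((norm a)\<^sup>2 + e)" using e by (simp add: t_def field_simps)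
    finally show ?thesis using t by simp
  qed
  then have "real n * ?I \<le> (norm a)\<^sup>2" by (rule field_le_epsilon)
  then show ?thesis using n_pos by (simp add: field_simps)
qed

end

subsection \<open>A Poincare inequality on the sphere\<close>

text \<open>Curve and tangent line differ by \<open>o(h)\<close>, which a Lipschitz function cannot
  enlarge in order. Derivatives along lines thus suffice for derivatives along the circular arcs
  used below, without a Frechet derivative.\<close>

lemma lipschitz_curve_derivative:
  fixes \<Phi> :: "'a::real_normed_vector \<Rightarrow> real" and c :: "real \<Rightarrow> 'a"
  assumes Lip: "K-lipschitz_on W \<Phi>"
    and c: "(c has_vector_derivative v) (at 0)" "c 0 = p"
    and W: "\<forall>\<^sub>F h in at_right 0. c h \<in> W" "\<forall>\<^sub>F h in at_right 0. p + h *\<^sub>R v \<in> W"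
    and \<Phi>: "((\<lambda>h. (\<Phi> (p + h *\<^sub>R v) - \<Phi> p) / h) \<longlongrightarrow> l) (at_right 0)"
  shows "((\<lambda>h. (\<Phi> (c h) - \<Phi> p) / h) \<longlongrightarrow> l) (at_right 0)"
proof -
  have "((\<lambda>h. norm (c h - c 0 - h *\<^sub>R v) / norm h) \<longlongrightarrow> 0) (at 0)"
    using c(1) unfolding has_vector_derivative_def has_derivative_iff_norm by simp
  then have "((\<lambda>h. norm (c h - p - h *\<^sub>R v) / norm h) \<longlongrightarrow> 0) (at_right 0)"
    unfolding c(2) by (rule filterlim_mono) (auto simp: at_le)
  then have "((\<lambda>h. K * (norm (c h - p - h *\<^sub>R v) / norm h)) \<longlongrightarrow> K * 0) (at_right 0)"
    by (intro tendsto_intros)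
  then have lim: "((\<lambda>h. K * (norm (c h - p - h *\<^sub>R v) / norm h)) \<longlongrightarrow> 0) (at_right 0)"
    by simp
  have "((\<lambda>h. (\<Phi> (c h) - \<Phi> (p + h *\<^sub>R v)) / h) \<longlongrightarrow> 0) (at_right 0)"
  proof (rule Lim_null_comparison[OF _ lim])
    show "\<forall>\<^sub>F h in at_right 0. norm ((\<Phi> (c h) - \<Phi> (p + h *\<^sub>R v)) / h) \<le>
      K * (norm (c h - p - h *\<^sub>R v) / norm h)"
      using W eventually_at_right_less[of 0]
    proof eventually_elim
      case (elim h)
      then have "\<bar>\<Phi> (c h) - \<Phi> (p + h *\<^sub>R v)\<bar> \<le> K * norm (c h - (p + h *\<^sub>R v))"
        using lipschitz_onD[OF Lip elim(1,2)] by (simp add: dist_norm)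
      then show ?case using elim(3) by (simp add: divide_right_mono diff_diff_add)
    qed
  qed
  from tendsto_add[OF this \<Phi>] show ?thesis
    by (simp add: add_divide_distrib[symmetric])
qed

lemma eventually_openin_subspace:
  assumes "subspace V" "openin (top_of_set V) W" "p \<in> W" "v \<in> V"
  shows "\<forall>\<^sub>F h in at_right 0. p + h *\<^sub>R v \<in> (W :: 'a::real_normed_vector set)"
proof -
  obtain T where T: "open T" "W = V \<inter> T" using assms(2) by (auto simp: openin_open)
  have "((\<lambda>h. p + h *\<^sub>R v) \<longlongrightarrow> p + 0 *\<^sub>R v) (at_right 0)" by (intro tendsto_intros)
  then have "\<forall>\<^sub>F h in at_right 0. p + h *\<^sub>R v \<in> T"
    using T assms(3) by (intro topological_tendstoD) auto
  then show ?thesis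
    by eventually_elim (use T assms in \<open>auto intro: subspace_add subspace_scale\<close>)
qed

section \<open>Rotation invariance of pairs of vectors\<close>

context homogeneous_measure
begin

abbreviation "L2 \<equiv> L \<Otimes>\<^sub>M L"

sublocale LL: pair_sigma_finite L L ..

text \<open>For almost every fixed second argument \<open>y\<close> the shear translates the first
  argument by \<open>t *\<^sub>R y\<close>, a vector of \<open>V\<close>.\<close>

lemma nn_integral_shear1:
  assumes [measurable]: "f \<in> borel_measurable (borel \<Otimes>\<^sub>M borel)"
  shows "(\<integral>\<^sup>+z. f (fst z + t *\<^sub>R snd z, snd z) \<partial>L2) = (\<integral>\<^sup>+z. f z \<partial>L2)"
proof -
  have f: "f \<in> borel_measurable L2" by measurable
  have g: "(\<lambda>z. f (fst z + t *\<^sub>R snd z, snd z)) \<in> borel_measurable L2" by measurable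
  have "(\<integral>\<^sup>+y. \<integral>\<^sup>+x. f (x + t *\<^sub>R y, y) \<partial>L \<partial>L) = (\<integral>\<^sup>+y. \<integral>\<^sup>+x. f (x, y) \<partial>L \<partial>L)"
  proof (rule nn_integral_cong_AE)
    show "AE y in L. (\<integral>\<^sup>+x. f (x + t *\<^sub>R y, y) \<partial>L) = (\<integral>\<^sup>+x. f (x, y) \<partial>L)"
      using AE_V
    proof eventually_elim
      case (elim y)
      then have "t *\<^sub>R y \<in> V" using subspace_V by (simp add: subspace_scale)
      then have "(\<integral>\<^sup>+x. f (x, y) \<partial>L) = (\<integral>\<^sup>+x. f (x, y) \<partial>distr L borel (\<lambda>x. x + t *\<^sub>R y))"
        by (simp add: translate)
      also have "\<dots> = (\<integral>\<^sup>+x. f (x + t *\<^sub>R y, y) \<partial>L)"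
        by (subst nn_integral_distr) auto
      finally show ?case ..
    qed
  qed
  then show ?thesis
    using LL.nn_integral_snd[OF f] LL.nn_integral_snd[OF g] by simp
qed

lemma nn_integral_shear2:
  assumes [measurable]: "f \<in> borel_measurable (borel \<Otimes>\<^sub>M borel)"
  shows "(\<integral>\<^sup>+z. f (fst z, snd z + t *\<^sub>R fst z) \<partial>L2) = (\<integral>\<^sup>+z. f z \<partial>L2)"
proof -
  have f: "f \<in> borel_measurable L2" by measurable
  have g: "(\<lambda>z. f (fst z, snd z + t *\<^sub>R fst z)) \<in> borel_measurable L2" by measurable
  have "(\<integral>\<^sup>+x. \<integral>\<^sup>+y. f (x, y + t *\<^sub>R x) \<partial>L \<partial>L) = (\<integral>\<^sup>+x. \<integral>\<^sup>+y. f (x, y) \<partial>L \<partial>L)"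
  proof (rule nn_integral_cong_AE)
    show "AE x in L. (\<integral>\<^sup>+y. f (x, y + t *\<^sub>R x) \<partial>L) = (\<integral>\<^sup>+y. f (x, y) \<partial>L)"
      using AE_V
    proof eventually_elim
      case (elim x)
      then have "t *\<^sub>R x \<in> V" using subspace_V by (simp add: subspace_scale)
      then have "(\<integral>\<^sup>+y. f (x, y) \<partial>L) = (\<integral>\<^sup>+y. f (x, y) \<partial>distr L borel (\<lambda>y. y + t *\<^sub>R x))"
        by (simp add: translate)
      also have "\<dots> = (\<integral>\<^sup>+y. f (x, y + t *\<^sub>R x) \<partial>L)"
        by (subst nn_integral_distr) auto
      finally show ?case ..
    qed
  qed
  then show ?thesis
    using L.nn_integral_fst[OF f] L.nn_integral_fst[OF g] by simp
qed

text \<open>A plane rotation is a composition of three shears, each of which is a translation in one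
  argument.\<close>

lemma nn_integral_rotate:
  assumes f [measurable]: "f \<in> borel_measurable (borel \<Otimes>\<^sub>M borel)" and \<theta>: "0 \<le> \<theta>" "\<theta> < pi"
  shows "(\<integral>\<^sup>+z. f (cos \<theta> *\<^sub>R fst z + sin \<theta> *\<^sub>R snd z, - sin \<theta> *\<^sub>R fst z + cos \<theta> *\<^sub>R snd z) \<partial>L2) =
    (\<integral>\<^sup>+z. f z \<partial>L2)"
proof (cases "\<theta> = 0")
  case False
  then have s: "0 < sin \<theta>" using \<theta> by (intro sin_gt_zero) auto
  \<comment> \<open>This is the tangent of \<open>\<theta> / 2\<close>, as in the classical
    factorisation of a rotation into shears with parameters \<open>t\<close>,
    \<open>- sin \<theta>\<close>, \<open>t\<close>. Its pole is the reason for
    \<open>\<theta> < pi\<close>.\<close>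
  define t where "t = (1 - cos \<theta>) / sin \<theta>"
  have ts: "t * sin \<theta> = 1 - cos \<theta>" using s by (simp add: t_def)
  have tc: "t * (1 + cos \<theta>) = sin \<theta>"
  proof -
    have "(1 - cos \<theta>) * (1 + cos \<theta>) = sin \<theta> * sin \<theta>"
      using sin_cos_squared_add[of \<theta>] by (simp add: algebra_simps power2_eq_square)
    then show ?thesis using s by (simp add: t_def field_simps)
  qed
  define A where "A = (\<lambda>z::'a \<times> 'a. (fst z + t *\<^sub>R snd z, snd z))"
  define B where "B = (\<lambda>z::'a \<times> 'a. (fst z, snd z + (- sin \<theta>) *\<^sub>R fst z))"
  have [measurable]: "A \<in> borel \<Otimes>\<^sub>M borel \<rightarrow>\<^sub>M borel \<Otimes>\<^sub>M borel" unfolding A_def by measurable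
  have [measurable]: "B \<in> borel \<Otimes>\<^sub>M borel \<rightarrow>\<^sub>M borel \<Otimes>\<^sub>M borel" unfolding B_def by measurable
  have ABA: "A (B (A z)) = (cos \<theta> *\<^sub>R fst z + sin \<theta> *\<^sub>R snd z, - sin \<theta> *\<^sub>R fst z + cos \<theta> *\<^sub>R snd z)" for z
  proof -
    have 2: "snd z + (- sin \<theta>) *\<^sub>R (fst z + t *\<^sub>R snd z) = - sin \<theta> *\<^sub>R fst z + cos \<theta> *\<^sub>R snd z"
    proof -
      have "snd z + (- sin \<theta>) *\<^sub>R (fst z + t *\<^sub>R snd z) = - sin \<theta> *\<^sub>R fst z + (1 - t * sin \<theta>) *\<^sub>R snd z"
        by (simp add: algebra_simps)
      then show ?thesis by (simp add: ts)
    qed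
    have "fst z + t *\<^sub>R snd z + t *\<^sub>R (- sin \<theta> *\<^sub>R fst z + cos \<theta> *\<^sub>R snd z) =
      (1 - t * sin \<theta>) *\<^sub>R fst z + (t * (1 + cos \<theta>)) *\<^sub>R snd z"
      by (simp add: algebra_simps)
    then show ?thesis unfolding A_def B_def fst_conv snd_conv 2 by (simp add: ts tc)
  qed
  have A: "(\<integral>\<^sup>+z. g (A z) \<partial>L2) = (\<integral>\<^sup>+z. g z \<partial>L2)"
    if "g \<in> borel_measurable (borel \<Otimes>\<^sub>M borel)" for g
    unfolding A_def using that by (rule nn_integral_shear1)
  have B: "(\<integral>\<^sup>+z. g (B z) \<partial>L2) = (\<integral>\<^sup>+z. g z \<partial>L2)"
    if "g \<in> borel_measurable (borel \<Otimes>\<^sub>M borel)" for g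
    unfolding B_def using that by (rule nn_integral_shear2)
  have "(\<integral>\<^sup>+z. f (A (B (A z))) \<partial>L2) = (\<integral>\<^sup>+z. f (A (B z)) \<partial>L2)"
    by (rule A[of "\<lambda>z. f (A (B z))"]) measurable
  also have "\<dots> = (\<integral>\<^sup>+z. f (A z) \<partial>L2)"
    by (rule B[of "\<lambda>z. f (A z)"]) measurable
  also have "\<dots> = (\<integral>\<^sup>+z. f z \<partial>L2)"
    by (rule A[OF f])
  finally show ?thesis by (simp add: ABA)
qed simp

lemma emeasure_cball_gt_0: "0 < r \<Longrightarrow> 0 < emeasure L (cball 0 r)"
  using ball by (simp add: emeasure_cball_pos[of r] ennreal_zero_less_mult_iff)

end

lemma norm_scaleR_sgn: "norm x *\<^sub>R sgn x = (x :: 'a::real_normed_vector)"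
  by (cases "x = 0") (auto simp: sgn_div_norm)

text \<open>
  With \<open>F(x) = norm x * (\<Phi> (sgn x) - \<Phi> 0)\<close>, the difference \<open>F(x) - F(- x)\<close> is the sum of
  \<open>m\<close> increments along the half circle from \<open>x\<close> through \<open>y\<close> to \<open>- x\<close>.  By rotation invariance
  they have the same law for \<open>(x, y)\<close> uniform in the unit ball of \<open>V \<times> V\<close>, so the squared
  difference is at most \<open>m\<^sup>2\<close> times one squared increment.  For \<open>m \<rightarrow> \<infinity>\<close> this becomes
  \<open>\<pi>\<^sup>2 (g x \<bullet> y)\<^sup>2\<close> with the gradient \<open>g\<close> of \<open>F\<close>, and averaging over the direction of
  \<open>y\<close> yields the factor \<open>1 / n\<close>.
\<close>

lemma (in homogeneous_measure) sphere_poincare_nn: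
  fixes \<Phi> :: "'a \<Rightarrow> real"
  assumes W: "openin (top_of_set V) W" and Lip: "K-lipschitz_on W \<Phi>"
    and ball_W: "V \<inter> cball 0 1 \<subseteq> W"
    and grad: "\<And>p. p \<in> V \<Longrightarrow> norm p = 1 \<Longrightarrow> \<exists>g\<in>V. norm g \<le> K \<and>
      (\<forall>v\<in>V. ((\<lambda>h. (\<Phi> (p + h *\<^sub>R v) - \<Phi> p) / h) \<longlongrightarrow> g \<bullet> v) (at_right 0))"
  shows "(\<integral>\<^sup>+e. ennreal ((indicator W e * \<Phi> e - indicator W (- e) * \<Phi> (- e))\<^sup>2) \<partial>sphere_law) \<le>
    ennreal (4 * pi\<^sup>2 * K\<^sup>2 / real n)"
proof -
  define \<Phi>0 where "\<Phi>0 = (\<lambda>w. indicator W w * \<Phi> w)"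
  have W_V: "W \<subseteq> V" using W by (simp add: openin_imp_subset)
  have K: "0 \<le> K" using Lip by (rule lipschitz_on_nonneg)
  have in_W: "p \<in> W" if "p \<in> V" "norm p \<le> 1" for p using ball_W that by auto
  have zero_W: "0 \<in> W" using in_W[of 0] subspace_V by (simp add: subspace_0)
  have lip: "\<bar>\<Phi> p - \<Phi> q\<bar> \<le> K * norm (p - q)" if "p \<in> W" "q \<in> W" for p q
    using lipschitz_onD[OF Lip that] by (simp add: dist_norm)
  have [measurable]: "\<Phi>0 \<in> borel_measurable borel"
    using borel_measurable_continuous_on_indicator[OF borel_openin_V[OF W] lipschitz_on_continuous_on[OF Lip]]
    by (simp add: \<Phi>0_def)
  have sgn_W: "sgn x \<in> W" if "x \<in> V" for x
  proof -
    have "norm (sgn x) \<le> 1" by (simp add: norm_sgn)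
    then show ?thesis using that subspace_V by (auto intro!: in_W simp: sgn_div_norm subspace_scale)
  qed
  obtain G where G: "\<And>p. p \<in> V \<Longrightarrow> norm p = 1 \<Longrightarrow> G p \<in> V \<and> norm (G p) \<le> K \<and>
      (\<forall>v\<in>V. ((\<lambda>h. (\<Phi> (p + h *\<^sub>R v) - \<Phi> p) / h) \<longlongrightarrow> G p \<bullet> v) (at_right 0))"
  proof -
    have "\<forall>p\<in>{p\<in>V. norm p = 1}. \<exists>g. g \<in> V \<and> norm g \<le> K \<and>
      (\<forall>v\<in>V. ((\<lambda>h. (\<Phi> (p + h *\<^sub>R v) - \<Phi> p) / h) \<longlongrightarrow> g \<bullet> v) (at_right 0))"
      using grad by blast
    from bchoice[OF this] show ?thesis using that by blast
  qed
  \<comment> \<open>The extension of the values on the sphere that is homogeneous of degree 1, so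
    that points off the sphere can be rotated. Subtracting \<open>\<Phi> 0\<close> bounds the
    angular factor by \<open>K\<close> and so keeps the Lipschitz constant of \<open>F\<close>
    proportional to \<open>K\<close>; it cancels in \<open>F x - F (- x)\<close>.\<close>
  define F where "F = (\<lambda>x. norm x * (\<Phi>0 (sgn x) - \<Phi> 0))"
  have [measurable]: "F \<in> borel_measurable borel" unfolding F_def by measurable
  have F_V: "F x = norm x * (\<Phi> (sgn x) - \<Phi> 0)" if "x \<in> V" for x
    using sgn_W[OF that] by (simp add: F_def \<Phi>0_def)
  have F_lip: "\<bar>F x - F y\<bar> \<le> 3 * K * norm (x - y)" if "x \<in> V" "y \<in> V" for x y
  proof -
    have *: "\<bar>F x - F y\<bar> \<le> 3 * K * norm (x - y)" if xy: "x \<in> V" "y \<in> V" "norm y \<le> norm x" for x y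
    proof -
      have 1: "\<bar>\<Phi> (sgn x) - \<Phi> 0\<bar> \<le> K"
      proof -
        have "\<bar>\<Phi> (sgn x) - \<Phi> 0\<bar> \<le> K * norm (sgn x)" using lip[OF sgn_W[OF xy(1)] zero_W] by simp
        also have "\<dots> \<le> K * 1" using K by (intro mult_left_mono) (auto simp: norm_sgn)
        finally show ?thesis by simp
      qed
      have 2: "norm y * \<bar>\<Phi> (sgn x) - \<Phi> (sgn y)\<bar> \<le> K * (2 * norm (x - y))"
      proof -
        have "norm y * \<bar>\<Phi> (sgn x) - \<Phi> (sgn y)\<bar> \<le> norm y * (K * norm (sgn x - sgn y))"
          using lip[OF sgn_W[OF xy(1)] sgn_W[OF xy(2)]] by (intro mult_left_mono) auto
        also have "\<dots> = K * norm (norm y *\<^sub>R sgn x - y)"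
        proof -
          have "norm y *\<^sub>R (sgn x - sgn y) = norm y *\<^sub>R sgn x - y"
            by (simp add: norm_scaleR_sgn algebra_simps)
          then have "norm y * norm (sgn x - sgn y) = norm (norm y *\<^sub>R sgn x - y)"
            by (metis abs_norm_cancel norm_scaleR)
          then show ?thesis by (simp add: mult.left_commute)
        qed
        also have "norm (norm y *\<^sub>R sgn x - y) \<le> 2 * norm (x - y)"
        proof -
          have "norm y *\<^sub>R sgn x - y = (norm y - norm x) *\<^sub>R sgn x + (x - y)"
            by (simp add: norm_scaleR_sgn algebra_simps)
          then have "norm (norm y *\<^sub>R sgn x - y) \<le> norm ((norm y - norm x) *\<^sub>R sgn x) + norm (x - y)"
            using norm_triangle_ineq by metis
          also have "norm ((norm y - norm x) *\<^sub>R sgn x) \<le> \<bar>norm y - norm x\<bar>"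
            by (simp add: norm_sgn)
          also have "\<bar>norm y - norm x\<bar> \<le> norm (x - y)"
            using norm_triangle_ineq3[of x y] by (simp add: abs_minus_commute)
          finally show ?thesis by simp
        qed
        finally show ?thesis using K by (simp add: mult_left_mono)
      qed
      have "F x - F y = (norm x - norm y) * (\<Phi> (sgn x) - \<Phi> 0) + norm y * (\<Phi> (sgn x) - \<Phi> (sgn y))"
        using xy by (simp add: F_V algebra_simps)
      then have "\<bar>F x - F y\<bar> \<le> \<bar>norm x - norm y\<bar> * \<bar>\<Phi> (sgn x) - \<Phi> 0\<bar> + norm y * \<bar>\<Phi> (sgn x) - \<Phi> (sgn y)\<bar>"
        using abs_triangle_ineq[of "(norm x - norm y) * (\<Phi> (sgn x) - \<Phi> 0)" "norm y * (\<Phi> (sgn x) - \<Phi> (sgn y))"]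
        by (simp add: abs_mult)
      also have "\<dots> \<le> norm (x - y) * K + K * (2 * norm (x - y))"
      proof (rule add_mono)
        show "\<bar>norm x - norm y\<bar> * \<bar>\<Phi> (sgn x) - \<Phi> 0\<bar> \<le> norm (x - y) * K"
          using 1 K norm_triangle_ineq3[of x y] by (intro mult_mono) auto
      qed (rule 2)
      finally show ?thesis by (simp add: algebra_simps)
    qed
    show ?thesis
      using *[of x y] *[of y x] that by (cases "norm y \<le> norm x") (auto simp: abs_minus_commute norm_minus_commute)
  qed
  \<comment> \<open>The gradient of \<open>F\<close> at a nonzero \<open>x\<close>: a radial part
    from homogeneity, and the component of \<open>G (sgn x)\<close> tangent to the sphere. Each has
    norm at most \<open>K\<close>.\<close>
  define g where "g = (\<lambda>x. (\<Phi> (sgn x) - \<Phi> 0) *\<^sub>R sgn x + (G (sgn x) - (sgn x \<bullet> G (sgn x)) *\<^sub>R sgn x))"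
  have g_V: "g x \<in> V" and g_norm: "norm (g x) \<le> 2 * K" if x: "x \<in> V" "x \<noteq> 0" for x
  proof -
    have p: "sgn x \<in> V" "norm (sgn x) = 1"
      using x subspace_V by (auto simp: sgn_div_norm subspace_scale)
    note Gp = G[OF p]
    show "g x \<in> V" unfolding g_def using p Gp subspace_V
      by (intro subspace_add subspace_diff subspace_scale) auto
    have "\<bar>\<Phi> (sgn x) - \<Phi> 0\<bar> \<le> K" using lip[OF in_W[OF p(1)] zero_W] p by simp
    then have "norm ((\<Phi> (sgn x) - \<Phi> 0) *\<^sub>R sgn x) \<le> K" using p by simp
    moreover have "norm (G (sgn x) - (sgn x \<bullet> G (sgn x)) *\<^sub>R sgn x) \<le> norm (G (sgn x))"
    proof (rule power2_le_imp_le)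
      have "sgn x \<bullet> sgn x = 1" using p(2) by (simp add: norm_eq_1)
      then have "(norm (G (sgn x) - (sgn x \<bullet> G (sgn x)) *\<^sub>R sgn x))\<^sup>2 = (norm (G (sgn x)))\<^sup>2 - (sgn x \<bullet> G (sgn x))\<^sup>2"
        unfolding power2_norm_eq_inner
        by (simp add: inner_diff_left inner_diff_right inner_commute power2_eq_square)
      then show "(norm (G (sgn x) - (sgn x \<bullet> G (sgn x)) *\<^sub>R sgn x))\<^sup>2 \<le> (norm (G (sgn x)))\<^sup>2" by simp
    qed simp
    ultimately show "norm (g x) \<le> 2 * K"
      unfolding g_def using Gp norm_triangle_ineq order_trans
      by (smt (verit))
  qed
  have F_deriv: "((\<lambda>h. (F (cos h *\<^sub>R x + sin h *\<^sub>R y) - F x) / h) \<longlongrightarrow> g x \<bullet> y) (at_right 0)"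
    if x: "x \<in> V" "x \<noteq> 0" and y: "y \<in> V" for x y
  proof -
    define p where "p = sgn x"
    have p: "p \<in> V" "norm p = 1"
      using x subspace_V by (auto simp: p_def sgn_div_norm subspace_scale)
    define c where "c = (\<lambda>h. cos h *\<^sub>R x + sin h *\<^sub>R y)"
    have cV: "c h \<in> V" for h using x y subspace_V by (auto simp: c_def intro!: subspace_add subspace_scale)
    define v where "v = (1 / norm x) *\<^sub>R (y - (p \<bullet> y) *\<^sub>R p)"
    have v: "v \<in> V" using p y subspace_V by (auto simp: v_def intro!: subspace_diff subspace_scale)
    have c0: "c 0 = x" by (simp add: c_def)
    have dc: "(c has_derivative (\<lambda>h. h *\<^sub>R y)) (at 0)"
      unfolding c_def by (auto intro!: derivative_eq_intros)
    have dn: "((\<lambda>h. norm (c h)) has_derivative (\<lambda>h. h * (p \<bullet> y))) (at 0)"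
    proof -
      have "(norm has_derivative (\<lambda>k. k \<bullet> sgn (c 0))) (at (c 0))"
        using x by (intro has_derivative_norm) (simp add: c0)
      from has_derivative_compose[OF dc this] show ?thesis
        by (simp add: c0 p_def inner_commute)
    qed
    have ds: "((\<lambda>h. sgn (c h)) has_vector_derivative v) (at 0)"
    proof -
      have di: "((\<lambda>h. inverse (norm (c h))) has_derivative (\<lambda>h. - (inverse (norm x) * (h * (p \<bullet> y)) * inverse (norm x)))) (at 0)"
        using Deriv.has_derivative_inverse[OF _ dn] x by (simp add: c0)
      have "((\<lambda>h. inverse (norm (c h)) *\<^sub>R c h) has_derivative
        (\<lambda>h. inverse (norm (c 0)) *\<^sub>R (h *\<^sub>R y) + (- (inverse (norm x) * (h * (p \<bullet> y)) * inverse (norm x))) *\<^sub>R c 0)) (at 0)"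
        by (rule has_derivative_scaleR[OF di dc])
      moreover have "inverse (norm (c 0)) *\<^sub>R (h *\<^sub>R y) + (- (inverse (norm x) * (h * (p \<bullet> y)) * inverse (norm x))) *\<^sub>R c 0 = h *\<^sub>R v" for h
        by (simp add: c0 v_def p_def sgn_div_norm divide_inverse algebra_simps)
      ultimately show ?thesis
        by (simp add: has_vector_derivative_def sgn_div_norm)
    qed
    have \<Phi>lim: "((\<lambda>h. (\<Phi> (sgn (c h)) - \<Phi> p) / h) \<longlongrightarrow> G p \<bullet> v) (at_right 0)"
    proof (rule lipschitz_curve_derivative[OF Lip ds])
      show "\<forall>\<^sub>F h in at_right 0. p + h *\<^sub>R v \<in> W"
        using eventually_openin_subspace[OF subspace_V W in_W[OF p(1)] v] p by simp
      show "((\<lambda>h. (\<Phi> (p + h *\<^sub>R v) - \<Phi> p) / h) \<longlongrightarrow> G p \<bullet> v) (at_right 0)"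
        using G[OF p] v by blast
    qed (use cV sgn_W c0 in \<open>auto simp: p_def\<close>)
    have nlim: "((\<lambda>h. (norm (c h) - norm x) / h) \<longlongrightarrow> p \<bullet> y) (at_right 0)"
    proof -
      have "((\<lambda>h. norm (c h)) has_real_derivative (p \<bullet> y)) (at 0)"
        using dn by (simp add: has_field_derivative_def mult_commute_abs)
      then have "((\<lambda>h. (norm (c h) - norm x) / h) \<longlongrightarrow> p \<bullet> y) (at 0)"
        by (simp add: has_field_derivative_iff c0)
      then show ?thesis by (rule filterlim_mono) (auto simp: at_le)
    qed
    have nc: "((\<lambda>h. norm (c h)) \<longlongrightarrow> norm x) (at_right 0)"
    proof -
      have "((\<lambda>h. norm (cos h *\<^sub>R x + sin h *\<^sub>R y)) \<longlongrightarrow> norm (cos 0 *\<^sub>R x + sin 0 *\<^sub>R y)) (at_right 0)"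
        by (intro tendsto_intros)
      then show ?thesis by (simp add: c_def)
    qed
    have "((\<lambda>h. norm (c h) * ((\<Phi> (sgn (c h)) - \<Phi> p) / h) + (\<Phi> p - \<Phi> 0) * ((norm (c h) - norm x) / h)) \<longlongrightarrow>
      norm x * (G p \<bullet> v) + (\<Phi> p - \<Phi> 0) * (p \<bullet> y)) (at_right 0)"
      by (intro tendsto_intros \<Phi>lim nlim nc)
    moreover have "norm (c h) * ((\<Phi> (sgn (c h)) - \<Phi> p) / h) + (\<Phi> p - \<Phi> 0) * ((norm (c h) - norm x) / h) =
      (F (c h) - F x) / h" for h
      unfolding times_divide_eq_right add_divide_distrib[symmetric]
      by (rule arg_cong[where f="\<lambda>t. t / h"]) (use cV x in \<open>simp add: F_V p_def algebra_simps\<close>)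
    moreover have "norm x * (G p \<bullet> v) + (\<Phi> p - \<Phi> 0) * (p \<bullet> y) = g x \<bullet> y"
      using x by (simp add: v_def g_def p_def[symmetric] inner_add_left inner_diff_left inner_diff_right algebra_simps inner_commute)
    ultimately show ?thesis by (simp add: c_def)
  qed
  \<comment> \<open>The indicator of the unit ball of pairs. It depends on
    \<open>r\<^sup>2 + s\<^sup>2\<close>, which rotations preserve, and on norms only, which allows
    polar coordinates in each factor.\<close>
  define \<rho> :: "real \<Rightarrow> real \<Rightarrow> real" where "\<rho> = (\<lambda>r s. if r\<^sup>2 + s\<^sup>2 \<le> 1 then 1 else 0 :: real)"
  have [measurable]: "case_prod \<rho> \<in> borel_measurable (borel \<Otimes>\<^sub>M borel)" unfolding \<rho>_def by measurable
  have \<rho>_comm: "\<rho> r s = \<rho> s r" for r s by (simp add: \<rho>_def add.commute)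
  have \<rho>01: "0 \<le> \<rho> r s" for r s by (simp add: \<rho>_def)
  define k where "k = (\<lambda>s. \<integral>\<^sup>+w. ennreal (\<rho> (norm w) s * (norm w)\<^sup>2) \<partial>L)"
  \<comment> \<open>The weight common to both sides of the final comparison; it cancels because it
    is finite and nonzero.\<close>
  define J where "J = (\<integral>\<^sup>+w. k (norm w) \<partial>L)"
  define \<psi> where "\<psi> = (\<lambda>e. (\<Phi>0 e - \<Phi>0 (- e))\<^sup>2)"
  have [measurable]: "\<psi> \<in> borel_measurable borel" unfolding \<psi>_def by measurable
  define E where "E = (\<integral>\<^sup>+e. ennreal (\<psi> e) \<partial>sphere_law)"
  have lhs: "(\<integral>\<^sup>+z. ennreal (\<rho> (norm (fst z)) (norm (snd z)) * (F (fst z) - F (- fst z))\<^sup>2) \<partial>L2) = J * E"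
  proof -
    have "(\<integral>\<^sup>+z. ennreal (\<rho> (norm (fst z)) (norm (snd z)) * (F (fst z) - F (- fst z))\<^sup>2) \<partial>L2) =
      (\<integral>\<^sup>+y. \<integral>\<^sup>+x. ennreal (\<rho> (norm x) (norm y) * (F x - F (- x))\<^sup>2) \<partial>L \<partial>L)"
      by (subst LL.nn_integral_snd[symmetric]) auto
    also have "\<dots> = (\<integral>\<^sup>+y. k (norm y) * E \<partial>L)"
    proof (rule nn_integral_cong)
      fix y :: 'a
      have "(F x - F (- x))\<^sup>2 = (norm x)\<^sup>2 * \<psi> (sgn x)" for x
      proof -
        have "sgn (- x) = - sgn x" by (simp add: sgn_div_norm)
        then have "F x - F (- x) = norm x * (\<Phi>0 (sgn x) - \<Phi>0 (- sgn x))"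
          by (simp add: F_def algebra_simps)
        then show ?thesis by (simp add: \<psi>_def power_mult_distrib)
      qed
      then have "(\<integral>\<^sup>+x. ennreal (\<rho> (norm x) (norm y) * (F x - F (- x))\<^sup>2) \<partial>L) =
        (\<integral>\<^sup>+x. ennreal (\<rho> (norm x) (norm y) * (norm x)\<^sup>2) * ennreal (\<psi> (sgn x)) \<partial>L)"
        using \<rho>01 by (intro nn_integral_cong) (simp add: ennreal_mult[symmetric] \<psi>_def mult.assoc)
      also have "\<dots> = k (norm y) * E"
        unfolding k_def E_def
        by (rule nn_integral_polar_mult[of "\<lambda>r. ennreal (\<rho> r (norm y) * r\<^sup>2)" "\<lambda>e. ennreal (\<psi> e)"]) measurable
      finally show "(\<integral>\<^sup>+x. ennreal (\<rho> (norm x) (norm y) * (F x - F (- x))\<^sup>2) \<partial>L) = k (norm y) * E" .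
    qed
    also have "\<dots> = J * E"
      unfolding J_def k_def by (rule nn_integral_multc) measurable
    finally show ?thesis .
  qed
  let ?X = "\<lambda>m z. cos (pi / real (Suc m)) *\<^sub>R fst z + sin (pi / real (Suc m)) *\<^sub>R snd z"
  define u where "u = (\<lambda>m z. indicator (V \<times> V) z * (\<rho> (norm (fst z)) (norm (snd z)) *
    (real (Suc m) * (F (fst z) - F (?X m z)))\<^sup>2))"
  define u' where "u' = (\<lambda>z. if fst z \<noteq> 0 then indicator (V \<times> V) z * (\<rho> (norm (fst z)) (norm (snd z)) * (pi\<^sup>2 * (g (fst z) \<bullet> snd z)\<^sup>2)) else 0)"
  have AE_VV: "AE z in L2. z \<in> V \<times> V \<and> fst z \<noteq> 0"
  proof -
    have "AE x in L. x \<noteq> 0" using AE_norm_neq[of 0] by auto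
    then have "AE x in L. AE y in L. (x, y) \<in> V \<times> V \<and> x \<noteq> 0"
      using AE_V by eventually_elim (use AE_V in auto)
    moreover have "{z \<in> space L2. z \<in> V \<times> V \<and> fst z \<noteq> 0} = (V - {0}) \<times> V"
      by (auto simp: space_pair_measure)
    then have "{z \<in> space L2. z \<in> V \<times> V \<and> fst z \<noteq> 0} \<in> sets L2"
      by auto
    ultimately show ?thesis
      by (intro LL.AE_pair_measure) auto
  qed
  have step: "J * E \<le> (\<integral>\<^sup>+z. ennreal (u m z) \<partial>L2)" for m
  proof -
    define M where "M = Suc m"
    define h where "h = pi / real M"
    define X where "X = (\<lambda>j z. cos (real j * h) *\<^sub>R fst z + sin (real j * h) *\<^sub>R snd (z::'a \<times> 'a))"
    have M: "0 < real M" by (simp add: M_def)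
    have h: "0 < h" "real M * h = pi" using M by (auto simp: h_def)
    have X0: "X 0 z = fst z" and XM: "X M z = - fst z" for z
      by (auto simp: X_def h)
    define a where "a = (\<lambda>j z. \<rho> (norm (fst z)) (norm (snd z)) * (F (X j z) - F (X (Suc j) z))\<^sup>2)"
    have meas [measurable]: "(\<lambda>z. a j z) \<in> borel_measurable (borel \<Otimes>\<^sub>M borel)" for j
      unfolding a_def X_def by measurable
    \<comment> \<open>Rotating the pair by the angle \<open>real j * h\<close> carries the first
      increment to increment \<open>j\<close> and leaves \<open>\<rho>\<close> unchanged.\<close>
    have a_eq: "(\<integral>\<^sup>+z. ennreal (a j z) \<partial>L2) = (\<integral>\<^sup>+z. ennreal (a 0 z) \<partial>L2)" if j: "j < M" for j
    proof -
      define \<theta> where "\<theta> = real j * h"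
      have \<theta>: "0 \<le> \<theta>" "\<theta> < pi" 
        using h(1) j mult_strict_right_mono[of "real j" "real M" h] unfolding h(2) \<theta>_def by auto
      have "a 0 (cos \<theta> *\<^sub>R fst z + sin \<theta> *\<^sub>R snd z, - sin \<theta> *\<^sub>R fst z + cos \<theta> *\<^sub>R snd z) = a j z" for z :: "'a \<times> 'a"
      proof -
        obtain x y where z: "z = (x, y)" by (cases z)
        let ?x = "cos \<theta> *\<^sub>R x + sin \<theta> *\<^sub>R y" and ?y = "- sin \<theta> *\<^sub>R x + cos \<theta> *\<^sub>R y"
        have alg: "(norm (c *\<^sub>R x + s *\<^sub>R y))\<^sup>2 + (norm (- s *\<^sub>R x + c *\<^sub>R y))\<^sup>2 =
          (s\<^sup>2 + c\<^sup>2) * ((norm x)\<^sup>2 + (norm y)\<^sup>2)" for c s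
          unfolding power2_norm_eq_inner
          by (simp add: inner_add_left inner_add_right inner_commute power2_eq_square algebra_simps)
        have 1: "(norm ?x)\<^sup>2 + (norm ?y)\<^sup>2 = (norm x)\<^sup>2 + (norm y)\<^sup>2"
          unfolding alg by simp
        have 2: "cos h *\<^sub>R ?x + sin h *\<^sub>R ?y = X (Suc j) z"
        proof -
          have "real (Suc j) * h = \<theta> + h" by (simp add: \<theta>_def algebra_simps)
          then have "X (Suc j) z = (cos \<theta> * cos h - sin \<theta> * sin h) *\<^sub>R x + (sin \<theta> * cos h + cos \<theta> * sin h) *\<^sub>R y"
            by (simp only: X_def cos_add sin_add z fst_conv snd_conv)
          then show ?thesis by (simp add: algebra_simps)
        qed
        have 3: "X j z = ?x" by (simp add: X_def z \<theta>_def)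
        have 4: "X 0 (?x, ?y) = ?x" "X (Suc 0) (?x, ?y) = cos h *\<^sub>R ?x + sin h *\<^sub>R ?y" by (auto simp: X_def)
        show ?thesis
          unfolding a_def \<rho>_def z fst_conv snd_conv 4 2 1 using 3 by (simp add: z)
      qed
      then show ?thesis
        using nn_integral_rotate[of "\<lambda>z. ennreal (a 0 z)" \<theta>] \<theta> by simp
    qed
    have pw: "\<rho> (norm (fst z)) (norm (snd z)) * (F (fst z) - F (- fst z))\<^sup>2 \<le> real M * (\<Sum>j<M. a j z)" for z
    proof -
      have "F (fst z) - F (- fst z) = (\<Sum>j<M. F (X j z) - F (X (Suc j) z))"
        using sum_lessThan_telescope'[of "\<lambda>j. F (X j z)" M] by (simp add: X0 XM)
      then have "(F (fst z) - F (- fst z))\<^sup>2 \<le> (\<Sum>j<M. (F (X j z) - F (X (Suc j) z))\<^sup>2) * real M"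
        using sum_squared_le_sum_of_squares[of "\<lambda>j. F (X j z) - F (X (Suc j) z)" "{..<M}"] by simp
      then have "\<rho> (norm (fst z)) (norm (snd z)) * (F (fst z) - F (- fst z))\<^sup>2 \<le>
        \<rho> (norm (fst z)) (norm (snd z)) * ((\<Sum>j<M. (F (X j z) - F (X (Suc j) z))\<^sup>2) * real M)"
        using \<rho>01 by (intro mult_left_mono)
      also have "\<dots> = real M * (\<Sum>j<M. a j z)" by (simp add: a_def sum_distrib_left mult_ac)
      finally show ?thesis .
    qed
    have a0: "0 \<le> a j z" for j z using \<rho>01 by (simp add: a_def)
    have "J * E \<le> (\<integral>\<^sup>+z. ennreal (real M * (\<Sum>j<M. a j z)) \<partial>L2)"
      unfolding lhs[symmetric] using pw by (intro nn_integral_mono ennreal_leI)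
    also have "\<dots> = (\<integral>\<^sup>+z. ennreal (real M) * (\<Sum>j<M. ennreal (a j z)) \<partial>L2)"
      using a0 by (intro nn_integral_cong) (simp add: ennreal_mult sum_nonneg)
    also have "\<dots> = ennreal (real M) * (\<Sum>j<M. (\<integral>\<^sup>+z. ennreal (a j z) \<partial>L2))"
      by (subst nn_integral_cmult) (auto simp: nn_integral_sum)
    also have "(\<Sum>j<M. (\<integral>\<^sup>+z. ennreal (a j z) \<partial>L2)) = ennreal (real M) * (\<integral>\<^sup>+z. ennreal (a 0 z) \<partial>L2)"
    proof -
      have "(\<Sum>j<M. (\<integral>\<^sup>+z. ennreal (a j z) \<partial>L2)) = (\<Sum>j<M. (\<integral>\<^sup>+z. ennreal (a 0 z) \<partial>L2))"
        by (intro sum.cong refl a_eq) auto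
      then show ?thesis by (simp add: ennreal_of_nat_eq_real_of_nat)
    qed
    also have "ennreal (real M) * (ennreal (real M) * (\<integral>\<^sup>+z. ennreal (a 0 z) \<partial>L2)) =
      (\<integral>\<^sup>+z. ennreal (real M * (real M * a 0 z)) \<partial>L2)"
      using a0 by (simp add: ennreal_mult nn_integral_cmult)
    also have "\<dots> = (\<integral>\<^sup>+z. ennreal (u m z) \<partial>L2)"
      by (intro nn_integral_cong_AE, use AE_VV in eventually_elim)
        (auto simp: u_def a_def X_def h_def M_def power2_eq_square mult_ac split: split_indicator)
    finally show ?thesis .
  qed
  have u_meas [measurable]: "u m \<in> borel_measurable L2" for m
    unfolding u_def by measurable
  \<comment> \<open>\<open>F\<close> need not be differentiable at 0; the leading factor removes
    this null set so that convergence holds everywhere. It is then a limit that shows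
    \<open>u'\<close> measurable, although \<open>G\<close> was merely chosen pointwise.\<close>
  have u_lim: "(\<lambda>m. (if fst z \<noteq> 0 then 1 else 0) * u m z) \<longlonglongrightarrow> u' z" for z
  proof (cases "z \<in> V \<times> V \<and> fst z \<noteq> 0")
    case True
    then have xy: "fst z \<in> V" "fst z \<noteq> 0" "snd z \<in> V" by auto
    have s: "(\<lambda>m. pi / real (Suc m)) \<longlonglongrightarrow> 0" by real_asymp
    then have s': "filterlim (\<lambda>m. pi / real (Suc m)) (at_right 0) sequentially"
      unfolding filterlim_at by simp
    have "(\<lambda>m. (F (?X m z) - F (fst z)) / (pi / real (Suc m))) \<longlonglongrightarrow> g (fst z) \<bullet> snd z"
      by (rule filterlim_compose[OF F_deriv[OF xy] s'])
    then have "(\<lambda>m. (- pi) * ((F (?X m z) - F (fst z)) / (pi / real (Suc m)))) \<longlonglongrightarrow> (- pi) * (g (fst z) \<bullet> snd z)"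
      by (intro tendsto_intros)
    moreover have "(- pi) * ((F (?X m z) - F (fst z)) / (pi / real (Suc m))) =
      real (Suc m) * (F (fst z) - F (?X m z))" for m
      by (simp add: field_simps)
    ultimately have *: "(\<lambda>m. real (Suc m) * (F (fst z) - F (?X m z))) \<longlonglongrightarrow> (- pi) * (g (fst z) \<bullet> snd z)"
      by (simp only:)
    have "(\<lambda>m. u m z) \<longlonglongrightarrow> indicator (V \<times> V) z * (\<rho> (norm (fst z)) (norm (snd z)) * ((- pi) * (g (fst z) \<bullet> snd z))\<^sup>2)"
      unfolding u_def by (intro tendsto_intros *)
    then show ?thesis using True by (simp add: u'_def power_mult_distrib)
  next
    case False
    then consider "fst z = 0" | "z \<notin> V \<times> V" by auto
    then show ?thesis by cases (auto simp: u_def u'_def)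
  qed
  have u'_meas [measurable]: "u' \<in> borel_measurable L2"
    by (rule borel_measurable_LIMSEQ_real[OF u_lim]) measurable
  \<comment> \<open>On the support the first increment moves \<open>x\<close> by at most
    \<open>3 * h\<close> with \<open>h = pi / real (Suc m)\<close>, and \<open>F\<close> is
    Lipschitz with constant \<open>3 * K\<close>; multiplying by \<open>real (Suc m)\<close> gives
    \<open>3 * K * (3 * pi)\<close>, uniformly in \<open>m\<close>.\<close>
  let ?w = "\<lambda>z. 9 * K\<^sup>2 * (3 * pi)\<^sup>2 * indicator (cball 0 1 \<times> cball 0 1) z"
  have u_bound: "u m z \<le> ?w z" for m z
  proof (cases "z \<in> V \<times> V \<and> (norm (fst z))\<^sup>2 + (norm (snd z))\<^sup>2 \<le> 1")
    case True
    obtain x y where z: "z = (x, y)" by (cases z)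
    have xy: "x \<in> V" "y \<in> V" using True z by auto
    have "(norm x)\<^sup>2 \<le> 1\<^sup>2" "(norm y)\<^sup>2 \<le> 1\<^sup>2"
      using True z zero_le_power2[of "norm x"] zero_le_power2[of "norm y"] by (simp, linarith, simp, linarith)
    then have n1: "norm x \<le> 1" "norm y \<le> 1" using power2_le_imp_le[of "norm x" 1] power2_le_imp_le[of "norm y" 1] by auto
    define h where "h = pi / real (Suc m)"
    have h: "0 < h" "real (Suc m) * h = pi" by (auto simp: h_def)
    have mem: "cos h *\<^sub>R x + sin h *\<^sub>R y \<in> V" using xy subspace_V by (intro subspace_add subspace_scale)
    have "norm (x - (cos h *\<^sub>R x + sin h *\<^sub>R y)) = norm ((1 - cos h) *\<^sub>R x - sin h *\<^sub>R y)"
      by (simp add: algebra_simps)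
    also have "\<dots> \<le> \<bar>1 - cos h\<bar> * norm x + \<bar>sin h\<bar> * norm y"
      using norm_triangle_ineq4[of "(1 - cos h) *\<^sub>R x" "sin h *\<^sub>R y"] by simp
    also have "\<dots> \<le> (2 * h) * 1 + h * 1"
    proof (intro add_mono mult_mono)
      show "\<bar>sin h\<bar> \<le> h" using abs_sin_x_le_abs_x[of h] h by simp
      have "1 - cos h = 2 * (sin (h / 2))\<^sup>2" using cos_double_sin[of "h / 2"] by simp
      also have "\<dots> \<le> 2 * (1 * \<bar>sin (h / 2)\<bar>)"
        unfolding power2_eq_square using abs_sin_le_one[of "h / 2"]
        by (metis abs_ge_zero abs_mult_self_eq mult_left_mono mult_right_mono zero_le_numeral)
      also have "\<dots> \<le> 2 * h" using abs_sin_x_le_abs_x[of "h / 2"] h by simp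
      finally show "\<bar>1 - cos h\<bar> \<le> 2 * h" by simp
    qed (use h n1 in auto)
    finally have "norm (x - (cos h *\<^sub>R x + sin h *\<^sub>R y)) \<le> 3 * h" by simp
    then have "3 * K * norm (x - (cos h *\<^sub>R x + sin h *\<^sub>R y)) \<le> 3 * K * (3 * h)"
      using K by (intro mult_left_mono) auto
    with F_lip[OF xy(1) mem] have "\<bar>F x - F (cos h *\<^sub>R x + sin h *\<^sub>R y)\<bar> \<le> 3 * K * (3 * h)" by linarith
    then have "real (Suc m) * \<bar>F x - F (cos h *\<^sub>R x + sin h *\<^sub>R y)\<bar> \<le> real (Suc m) * (3 * K * (3 * h))"
      by (intro mult_left_mono) auto
    also have "\<dots> = 3 * K * (3 * (real (Suc m) * h))" by (simp only: mult_ac)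
    also have "\<dots> = 3 * K * (3 * pi)" by (simp only: h)
    finally have "(real (Suc m) * \<bar>F x - F (cos h *\<^sub>R x + sin h *\<^sub>R y)\<bar>)\<^sup>2 \<le> (3 * K * (3 * pi))\<^sup>2"
      by (intro power_mono) auto
    then show ?thesis using True n1
      by (simp add: u_def z \<rho>_def h_def power_mult_distrib)
  next
    case False
    then have "u m z = 0" by (auto simp: u_def \<rho>_def)
    then show ?thesis by simp
  qed
  have u0: "0 \<le> u m z" for m z using \<rho>01 by (simp add: u_def)
  have "(\<lambda>m. \<integral>\<^sup>+z. ennreal (u m z) \<partial>L2) \<longlonglongrightarrow> (\<integral>\<^sup>+z. ennreal (u' z) \<partial>L2)"
  proof (rule nn_integral_dominated_convergence[where w="\<lambda>z. ennreal (?w z)"])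
    show "AE z in L2. ennreal (u m z) \<le> ennreal (?w z)" for m
      by (intro AE_I2 ennreal_leI u_bound)
    have "(\<integral>\<^sup>+z. ennreal (?w z) \<partial>L2) =
      (\<integral>\<^sup>+z. ennreal (9 * K\<^sup>2 * (3 * pi)\<^sup>2) * indicator (cball 0 1 \<times> cball 0 1) z \<partial>L2)"
      by (intro nn_integral_cong) (simp only: ennreal_indicator ennreal_mult'' indicator_pos_le)
    also have "\<dots> = ennreal (9 * K\<^sup>2 * (3 * pi)\<^sup>2) * (emeasure L (cball 0 1) * emeasure L (cball 0 1))"
      by (subst nn_integral_cmult_indicator) (auto simp: L.emeasure_pair_measure_Times)
    also have "\<dots> < \<infinity>" using ball by (simp add: ennreal_mult_less_top)
    finally show "(\<integral>\<^sup>+z. ennreal (?w z) \<partial>L2) < \<infinity>" .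
    show "AE z in L2. (\<lambda>m. ennreal (u m z)) \<longlonglongrightarrow> ennreal (u' z)"
      using AE_VV
    proof eventually_elim
      case (elim z)
      then show ?case using u_lim[of z] by (intro tendsto_ennrealI) simp
    qed
  qed (auto intro!: borel_measurable_times borel_measurable_indicator measurable_compose[OF _ measurable_ennreal])
  then have "J * E \<le> (\<integral>\<^sup>+z. ennreal (u' z) \<partial>L2)"
    by (rule LIMSEQ_le_const) (use step in auto)
  also have "\<dots> = (\<integral>\<^sup>+x. \<integral>\<^sup>+y. ennreal (u' (x, y)) \<partial>L \<partial>L)"
    by (subst L.nn_integral_fst[symmetric]) auto
  \<comment> \<open>For fixed \<open>x\<close> the inner integral is taken in polar coordinates of
    \<open>y\<close>. The constant is \<open>pi\<^sup>2\<close> times the bound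
    \<open>(2 * K)\<^sup>2 / real n\<close> on the mean of
    \<open>(e \<bullet> g x)\<^sup>2\<close>.\<close>
  also have "\<dots> \<le> (\<integral>\<^sup>+x. k (norm x) * ennreal (4 * pi\<^sup>2 * K\<^sup>2 / real n) \<partial>L)"
  proof (rule nn_integral_mono)
    fix x :: 'a
    show "(\<integral>\<^sup>+y. ennreal (u' (x, y)) \<partial>L) \<le> k (norm x) * ennreal (4 * pi\<^sup>2 * K\<^sup>2 / real n)"
    proof (cases "x \<in> V \<and> x \<noteq> 0")
      case True
      have "(\<integral>\<^sup>+y. ennreal (u' (x, y)) \<partial>L) \<le>
        (\<integral>\<^sup>+y. ennreal (\<rho> (norm y) (norm x) * (norm y)\<^sup>2) * ennreal (pi\<^sup>2 * (sgn y \<bullet> g x)\<^sup>2) \<partial>L)"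
      proof (rule nn_integral_mono)
        fix y :: 'a
        have "y = norm y *\<^sub>R sgn y" by (simp add: norm_scaleR_sgn)
        then have "g x \<bullet> y = norm y * (sgn y \<bullet> g x)"
          by (metis inner_commute inner_scaleR_left)
        then have "u' (x, y) \<le> \<rho> (norm y) (norm x) * (norm y)\<^sup>2 * (pi\<^sup>2 * (sgn y \<bullet> g x)\<^sup>2)"
          using True \<rho>01 by (auto simp: u'_def \<rho>_comm[of "norm x"] power_mult_distrib mult_ac split: split_indicator)
        then show "ennreal (u' (x, y)) \<le> ennreal (\<rho> (norm y) (norm x) * (norm y)\<^sup>2) * ennreal (pi\<^sup>2 * (sgn y \<bullet> g x)\<^sup>2)"
          using \<rho>01 by (simp add: ennreal_mult[symmetric] ennreal_leI)
      qed
      also have "\<dots> = k (norm x) * (\<integral>\<^sup>+e. ennreal (pi\<^sup>2 * (e \<bullet> g x)\<^sup>2) \<partial>sphere_law)"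
        unfolding k_def
        by (rule nn_integral_polar_mult[of "\<lambda>r. ennreal (\<rho> r (norm x) * r\<^sup>2)" "\<lambda>e. ennreal (pi\<^sup>2 * (e \<bullet> g x)\<^sup>2)"]) measurable
      also have "\<dots> \<le> k (norm x) * ennreal (4 * pi\<^sup>2 * K\<^sup>2 / real n)"
      proof (rule mult_left_mono)
        have eq: "(\<integral>\<^sup>+e. ennreal (pi\<^sup>2 * (e \<bullet> g x)\<^sup>2) \<partial>sphere_law) = ennreal (\<integral>e. pi\<^sup>2 * (e \<bullet> g x)\<^sup>2 \<partial>sphere_law)"
        proof (rule nn_integral_eq_integral)
          have "integrable sphere_law (\<lambda>e. (e \<bullet> g x)\<^sup>2)"
          proof (rule S.integrable_const_bound[where B="(norm (g x))\<^sup>2"])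
            show "AE e in sphere_law. norm ((e \<bullet> g x)\<^sup>2) \<le> (norm (g x))\<^sup>2"
              using AE_sphere_law
            proof eventually_elim
              case (elim e)
              then have "\<bar>e \<bullet> g x\<bar> \<le> norm (g x)" using Cauchy_Schwarz_ineq2[of e "g x"] by simp
              then have "\<bar>e \<bullet> g x\<bar>\<^sup>2 \<le> (norm (g x))\<^sup>2" by (intro power_mono) auto
              then show ?case by simp
            qed
          qed measurable
          then show "integrable sphere_law (\<lambda>e. pi\<^sup>2 * (e \<bullet> g x)\<^sup>2)" by simp
        qed auto
        have "(\<integral>e. (e \<bullet> g x)\<^sup>2 \<partial>sphere_law) \<le> (norm (g x))\<^sup>2 / real n"
          using sphere_second_moment[of "g x"] g_V True by blast
        also have "\<dots> \<le> (2 * K)\<^sup>2 / real n"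
          using g_norm[of x] True by (intro divide_right_mono power_mono) auto
        finally have "pi\<^sup>2 * (\<integral>e. (e \<bullet> g x)\<^sup>2 \<partial>sphere_law) \<le> pi\<^sup>2 * ((2 * K)\<^sup>2 / real n)"
          by (rule mult_left_mono) simp
        then have "(\<integral>e. pi\<^sup>2 * (e \<bullet> g x)\<^sup>2 \<partial>sphere_law) \<le> pi\<^sup>2 * ((2 * K)\<^sup>2 / real n)"
          by simp
        also have "\<dots> = 4 * pi\<^sup>2 * K\<^sup>2 / real n" by (simp add: power_mult_distrib)
        finally show "(\<integral>\<^sup>+e. ennreal (pi\<^sup>2 * (e \<bullet> g x)\<^sup>2) \<partial>sphere_law) \<le> ennreal (4 * pi\<^sup>2 * K\<^sup>2 / real n)"
          unfolding eq by (rule ennreal_leI)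
      qed simp
      finally show ?thesis .
    next
      case False
      then have "u' (x, y) = 0" for y by (auto simp: u'_def)
      then show ?thesis by simp
    qed
  qed
  also have "\<dots> = J * ennreal (4 * pi\<^sup>2 * K\<^sup>2 / real n)"
    unfolding J_def k_def by (rule nn_integral_multc) measurable
  finally have JE: "J * E \<le> J * ennreal (4 * pi\<^sup>2 * K\<^sup>2 / real n)" .
  have J_fin: "J < \<infinity>"
  proof -
    have k_le: "k (norm w) \<le> indicator (cball 0 1) w * emeasure L (cball 0 1)" for w :: 'a
    proof (cases "norm w \<le> 1")
      case True
      have "k (norm w) \<le> (\<integral>\<^sup>+v. indicator (cball 0 1) v \<partial>L)"
        unfolding k_def
      proof (intro nn_integral_mono)
        fix v :: 'a
        show "ennreal (\<rho> (norm v) (norm w) * (norm v)\<^sup>2) \<le> indicator (cball 0 1) v"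
        proof (cases "(norm v)\<^sup>2 + (norm w)\<^sup>2 \<le> 1")
          case True
          then have "(norm v)\<^sup>2 \<le> 1\<^sup>2" using zero_le_power2[of "norm w"] by (simp, linarith)
          then have "norm v \<le> 1" by (rule power2_le_imp_le) simp
          then show ?thesis using True \<open>(norm v)\<^sup>2 \<le> 1\<^sup>2\<close> by (simp add: \<rho>_def)
        qed (simp add: \<rho>_def)
      qed
      then show ?thesis using True by simp
    next
      case False
      then have "1\<^sup>2 < (norm w)\<^sup>2" by (intro power_strict_mono) auto
      then have "\<rho> (norm v) (norm w) = 0" for v :: 'a
        using zero_le_power2[of "norm v"] unfolding \<rho>_def by (simp, linarith)
      then show ?thesis by (simp add: k_def)
    qed
    have "J \<le> (\<integral>\<^sup>+w. indicator (cball 0 1) w * emeasure L (cball 0 1) \<partial>L)"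
      unfolding J_def using k_le by (intro nn_integral_mono)
    also have "\<dots> = emeasure L (cball 0 1) * emeasure L (cball 0 1)"
      by (subst nn_integral_multc) (auto intro!: borel_measurable_indicator)
    also have "\<dots> < \<infinity>" using ball by (simp add: ennreal_mult_less_top)
    finally show ?thesis .
  qed
  \<comment> \<open>Pairs with both norms at most \<open>1 / 2\<close> lie inside the support of
    \<open>\<rho>\<close>, and the ball of radius \<open>1 / 2\<close> has positive measure.\<close>
  have J_pos: "J \<noteq> 0"
  proof
    assume "J = 0"
    then have "AE w in L. k (norm w) = 0"
      unfolding J_def k_def by (subst (asm) nn_integral_0_iff_AE) auto
    moreover have small: "\<not> (AE w in L. \<not> norm w \<le> 1/2)"
    proof
      assume *: "AE w in L. \<not> norm w \<le> 1/2"
      have "emeasure L (cball 0 (1/2)) = 0"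
        using * by (subst (asm) AE_iff_measurable[where N="cball 0 (1/2)"]) auto
      then show False using emeasure_cball_gt_0[of "1/2"] by simp
    qed
    ultimately obtain w0 :: 'a where w0: "k (norm w0) = 0" "norm w0 \<le> 1/2"
      by (metis (mono_tags, lifting) AE_mp AE_I2)
    then have "AE w in L. ennreal (\<rho> (norm w) (norm w0) * (norm w)\<^sup>2) = 0"
      unfolding k_def by (subst (asm) nn_integral_0_iff_AE) auto
    then have "AE w in L. \<not> norm w \<le> 1/2"
      using AE_norm_neq[of 0]
    proof eventually_elim
      case (elim w)
      show ?case
      proof
        assume "norm w \<le> 1/2"
        then have "(norm w)\<^sup>2 \<le> (1/2)\<^sup>2" "(norm w0)\<^sup>2 \<le> (1/2)\<^sup>2"
          using w0 by (intro power_mono; simp)+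
        then have "\<rho> (norm w) (norm w0) = 1" by (simp add: \<rho>_def power2_eq_square)
        then show False using elim by (simp add: ennreal_eq_0_iff)
      qed
    qed
    then show False using small by blast
  qed
  have "E \<le> ennreal (4 * pi\<^sup>2 * K\<^sup>2 / real n)"
    using JE J_fin J_pos ennreal_mult_le_mult_iff[of J E] by (simp add: less_top)
  then show ?thesis by (simp add: E_def \<psi>_def \<Phi>0_def)
qed

subsection \<open>Lebesgue measure on the finite-dimensional subspaces\<close>

definition unit_seq :: "nat \<Rightarrow> fseq"
  where "unit_seq i = vec_of (Suc i) (\<lambda>j. if j = i then 1 else 0)"

lemma coord_unit_seq: "coord (unit_seq i) j = (if j = i then 1 else 0)"
  by (auto simp: unit_seq_def coord_vec_of)

lemma coord_sum: "coord (sum f A) i = (\<Sum>a\<in>A. coord (f a) i)"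
  by (induction A rule: infinite_finite_induct) (auto simp: zero_fseq.rep_eq plus_fseq.rep_eq)

lemma inner_Rn:
  assumes "x \<in> Rn n"
  shows "x \<bullet> y = (\<Sum>i<n. coord x i * coord y i)"
  using assms by (intro inner_fseq_alt) (auto simp: Rn_def not_less[symmetric])

lemma inner_unit_seq: "unit_seq i \<bullet> x = coord x i"
  by (subst inner_Rn[of _ "Suc i"]) (auto simp: Rn_def coord_unit_seq if_distrib[of "\<lambda>c. c * _"] cong: if_cong)

lemma norm_unit_seq: "norm (unit_seq i) = 1"
  by (simp add: norm_eq_1 inner_unit_seq coord_unit_seq)

lemma vec_of_Rn: "vec_of n f \<in> Rn n"
  by (simp add: Rn_def coord_vec_of)

lemma vec_of_coord: "x \<in> Rn n \<Longrightarrow> vec_of n (coord x) = x"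
  by (intro fseq_eqI) (auto simp: Rn_def coord_vec_of)

lemma vec_of_eq_sum: "vec_of n f = (\<Sum>i<n. f i *\<^sub>R unit_seq i)"
  by (intro fseq_eqI)
    (auto simp: coord_vec_of coord_sum scaleR_fseq.rep_eq coord_unit_seq if_distrib[of "\<lambda>c. _ * c"] cong: if_cong)

lemma exists_Rn: "\<exists>n. x \<in> Rn n"
proof -
  obtain m where "\<forall>i\<in>{i. coord x i \<noteq> 0}. i < m"
    using finite_coord[of x] finite_nat_set_iff_bounded by blast
  then have "x \<in> Rn m" by (auto simp: Rn_def leD)
  then show ?thesis ..
qed

lemma subspace_Rn: "subspace (Rn n)"
  by (auto simp: subspace_def Rn_def zero_fseq.rep_eq plus_fseq.rep_eq scaleR_fseq.rep_eq)

lemma closed_Rn: "closed (Rn n)"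
proof -
  have "Rn n = (\<Inter>i\<in>{n..}. {x. unit_seq i \<bullet> x = 0})"
    by (auto simp: Rn_def inner_unit_seq)
  then show ?thesis
    by (auto intro!: closed_INT closed_Collect_eq continuous_intros)
qed

text \<open>Finite rational sequences are dense, so balls around them with rational radii form a
  countable basis. This makes Borel sets of products agree with product Borel sets, as the
  measurability arguments on pairs require.\<close>

instance fseq :: second_countable_topology
proof
  define D where "D = range (\<lambda>qs :: rat list. vec_of (length qs) (\<lambda>i. of_rat (qs ! i)))"
  define B where "B = (\<lambda>(d, r). ball d (of_rat r)) ` (D \<times> (UNIV :: rat set))"
  have dense: "\<exists>d\<in>D. dist x d < e" if "0 < e" for x :: fseq and e :: real
  proof -
    obtain n where n: "x \<in> Rn n" using exists_Rn by blast
    have "\<exists>q. \<bar>coord x i - of_rat q\<bar> < e / (real n + 1)" for i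
    proof -
      obtain q where "coord x i - e / (real n + 1) < of_rat q" "of_rat q < coord x i"
        using of_rat_dense[of "coord x i - e / (real n + 1)" "coord x i"] \<open>0 < e\<close> by auto
      then show ?thesis by (intro exI[of _ q]) auto
    qed
    then obtain q where q: "\<And>i. \<bar>coord x i - of_rat (q i)\<bar> < e / (real n + 1)" by metis
    let ?d = "vec_of (length (map q [0..<n])) (\<lambda>i. of_rat (map q [0..<n] ! i))"
    have d: "?d = vec_of n (\<lambda>i. of_rat (q i))"
      by (intro fseq_eqI) (simp add: coord_vec_of)
    have "x - ?d = (\<Sum>i<n. (coord x i - of_rat (q i)) *\<^sub>R unit_seq i)"
      by (subst vec_of_coord[OF n, symmetric], unfold d vec_of_eq_sum)
        (simp add: sum_subtractf[symmetric] scaleR_diff_left)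
    then have "dist x ?d \<le> (\<Sum>i<n. \<bar>coord x i - of_rat (q i)\<bar>)"
      unfolding dist_norm by (auto intro!: sum_norm_le simp: norm_unit_seq)
    also have "\<dots> \<le> (\<Sum>i<n. e / (real n + 1))"
      using q by (intro sum_mono) (simp add: less_imp_le)
    also have "\<dots> < e" using \<open>0 < e\<close> by (simp add: field_simps)
    finally show ?thesis unfolding D_def by blast
  qed
  have "topological_basis B"
  proof (rule topological_basisI)
    fix b assume "b \<in> B" then show "open b" by (auto simp: B_def)
  next
    fix O' and x :: fseq assume "open O'" "x \<in> O'"
    then obtain e where e: "0 < e" "ball x e \<subseteq> O'" by (auto simp: open_contains_ball)
    obtain r :: rat where r: "0 < (of_rat r :: real)" "of_rat r < e / 2"
      using of_rat_dense[of 0 "e / 2"] e by auto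
    obtain d where d: "d \<in> D" "dist x d < of_rat r" using dense[OF r(1)] by blast
    have "ball d (of_rat r) \<subseteq> ball x e"
    proof
      fix y assume "y \<in> ball d (of_rat r)"
      then show "y \<in> ball x e"
        using d r dist_triangle[of x y d] by auto
    qed
    moreover have "x \<in> ball d (of_rat r)" using d by (simp add: dist_commute)
    moreover have "ball d (of_rat r) \<in> B" using d by (auto simp: B_def)
    ultimately show "\<exists>b\<in>B. x \<in> b \<and> b \<subseteq> O'" using e by blast
  qed
  moreover have "countable B" unfolding B_def D_def by auto
  ultimately show "\<exists>B::fseq set set. countable B \<and> open = generate_topology B"
    using topological_basis_imp_subbasis by blast
qed

text \<open>The coordinate map whose image measure is \<open>lebesgue_prod\<close>, named so that
  its linearity and norm can be stated.\<close>

definition vec_pair :: "nat \<Rightarrow> nat \<Rightarrow> (nat \<Rightarrow> real) \<Rightarrow> fseq \<times> fseq"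
  where "vec_pair nx ny f = (vec_of nx f, vec_of ny (\<lambda>i. f (nx + i)))"

lemma vec_pair_coord:
  assumes "z \<in> Rn nx \<times> Rn ny"
  shows "vec_pair nx ny (\<lambda>i. if i < nx then coord (fst z) i else coord (snd z) (i - nx)) = z"
proof (rule prod_eqI)
  have z: "fst z \<in> Rn nx" "snd z \<in> Rn ny" using assms by auto
  show "fst (vec_pair nx ny (\<lambda>i. if i < nx then coord (fst z) i else coord (snd z) (i - nx))) = fst z"
    by (subst vec_of_coord[OF z(1), symmetric]) (auto simp: vec_pair_def intro!: fseq_eqI simp: coord_vec_of)
  show "snd (vec_pair nx ny (\<lambda>i. if i < nx then coord (fst z) i else coord (snd z) (i - nx))) = snd z"
    by (subst vec_of_coord[OF z(2), symmetric]) (auto simp: vec_pair_def intro!: fseq_eqI simp: coord_vec_of)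
qed

lemma vec_pair_cong: "(\<And>i. i < nx + ny \<Longrightarrow> f i = g i) \<Longrightarrow> vec_pair nx ny f = vec_pair nx ny g"
  by (auto simp: vec_pair_def intro!: fseq_eqI simp: coord_vec_of)

lemma vec_pair_add: "vec_pair nx ny (\<lambda>i. f i + g i) = vec_pair nx ny f + vec_pair nx ny g"
  by (auto simp: vec_pair_def intro!: fseq_eqI simp: coord_vec_of plus_fseq.rep_eq)

lemma vec_pair_scale: "vec_pair nx ny (\<lambda>i. r * f i) = r *\<^sub>R vec_pair nx ny f"
  by (auto simp: vec_pair_def intro!: fseq_eqI simp: coord_vec_of scaleR_fseq.rep_eq)

lemma norm_vec_pair: "(norm (vec_pair nx ny f))\<^sup>2 = (\<Sum>i<nx + ny. (f i)\<^sup>2)"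
proof -
  have "(norm (vec_pair nx ny f))\<^sup>2 = (\<Sum>i<nx. (f i)\<^sup>2) + (\<Sum>i<ny. (f (nx + i))\<^sup>2)"
    unfolding power2_norm_eq_inner vec_pair_def inner_Pair inner_Rn[OF vec_of_Rn]
    by (simp add: coord_vec_of power2_eq_square)
  also have "(\<Sum>i<nx. (f i)\<^sup>2) + (\<Sum>i<m. (f (nx + i))\<^sup>2) = (\<Sum>i<nx + m. (f i)\<^sup>2)" for m
    by (induction m) (auto simp: algebra_simps)
  finally show ?thesis .
qed

lemma measurable_vec_pair [measurable]:
  "vec_pair nx ny \<in> borel_measurable (Pi\<^sub>M {..<nx + ny} (\<lambda>_. lborel))"
  unfolding vec_pair_def vec_of_eq_sum by measurable

section \<open>Translation and dilation of Lebesgue measure in coordinates\<close>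

context
  fixes n :: nat
begin

interpretation product_sigma_finite "\<lambda>_::nat. lborel :: real measure" ..

text \<open>Boxes determine a product measure, and on boxes the claim is one-dimensional.
  Restricting the shifted function to \<open>{..<n}\<close> keeps it extensional, hence in the
  product space.\<close>

lemma PiM_lborel_translate:
  "distr (Pi\<^sub>M {..<n} (\<lambda>_. lborel)) (Pi\<^sub>M {..<n} (\<lambda>_. lborel)) (\<lambda>f. \<lambda>i\<in>{..<n}. f i + d i) =
    Pi\<^sub>M {..<n} (\<lambda>_. lborel :: real measure)" (is "distr ?P _ ?s = _")
proof (rule PiM_eqI)
  fix A :: "nat \<Rightarrow> real set" assume A: "\<And>i. i \<in> {..<n} \<Longrightarrow> A i \<in> sets lborel"
  have [measurable]: "?s \<in> ?P \<rightarrow>\<^sub>M ?P" by measurable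
  have em: "emeasure lborel ((\<lambda>x. x + d i) -` A i) = emeasure lborel (A i)" if "i < n" for i
  proof -
    have "emeasure lborel (A i) = emeasure (distr lborel borel ((+) (d i))) (A i)"
      by (simp add: lborel_distr_plus)
    also have "(+) (d i) = (\<lambda>x. x + d i)" by auto
    also have "emeasure (distr lborel borel (\<lambda>x. x + d i)) (A i) = emeasure lborel ((\<lambda>x. x + d i) -` A i)"
      using A that by (subst emeasure_distr) auto
    finally show ?thesis ..
  qed
  have "emeasure (distr ?P ?P ?s) (Pi\<^sub>E {..<n} A) = emeasure ?P (?s -` Pi\<^sub>E {..<n} A \<inter> space ?P)"
    using A by (intro emeasure_distr) (auto intro!: sets_PiM_I_finite)
  also have "?s -` Pi\<^sub>E {..<n} A \<inter> space ?P = Pi\<^sub>E {..<n} (\<lambda>i. (\<lambda>x. x + d i) -` A i)"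
    by (auto simp: space_PiM PiE_iff)
  also have "emeasure ?P \<dots> = (\<Prod>i<n. emeasure lborel ((\<lambda>x. x + d i) -` A i))"
    using A by (intro emeasure_PiM) (auto intro!: measurable_sets_borel[of _ borel])
  also have "\<dots> = (\<Prod>i<n. emeasure lborel (A i))" using em by (intro prod.cong) auto
  finally show "emeasure (distr ?P ?P ?s) (Pi\<^sub>E {..<n} A) = (\<Prod>i<n. emeasure lborel (A i))" .
qed auto

lemma PiM_lborel_scale:
  assumes r: "0 < r"
  shows "distr (Pi\<^sub>M {..<n} (\<lambda>_. lborel)) (Pi\<^sub>M {..<n} (\<lambda>_. lborel)) (\<lambda>f. \<lambda>i\<in>{..<n}. inverse r * f i) =
    scale_measure (ennreal (r ^ n)) (Pi\<^sub>M {..<n} (\<lambda>_. lborel :: real measure))" (is "distr ?P _ ?s = _")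
proof -
  \<comment> \<open>Uniqueness on boxes is available for the unscaled product, so the scaling factor
    is put on the other side first and inverted at the end.\<close>
  have "scale_measure (ennreal (inverse r ^ n)) (distr ?P ?P ?s) = ?P"
  proof (rule PiM_eqI)
    fix A :: "nat \<Rightarrow> real set" assume A: "\<And>i. i \<in> {..<n} \<Longrightarrow> A i \<in> sets lborel"
    have [measurable]: "?s \<in> ?P \<rightarrow>\<^sub>M ?P" by measurable
    have meas: "(\<lambda>x. inverse r * x) -` A i \<in> sets borel" if "i < n" for i
      using A that by (intro measurable_sets_borel[of _ borel]) auto
    have em: "ennreal (inverse r) * emeasure lborel ((\<lambda>x. inverse r * x) -` A i) = emeasure lborel (A i)" if "i < n" for i
    proof -
      have "emeasure lborel (A i) = (\<integral>\<^sup>+x. indicator (A i) x \<partial>lborel)"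
        using A that by simp
      also have "\<dots> = ennreal \<bar>inverse r\<bar> * (\<integral>\<^sup>+x. indicator (A i) (0 + inverse r * x) \<partial>lborel)"
        using A that r by (intro nn_integral_real_affine) auto
      also have "(\<integral>\<^sup>+x. indicator (A i) (0 + inverse r * x) \<partial>lborel) =
        (\<integral>\<^sup>+x. indicator ((\<lambda>x. inverse r * x) -` A i) x \<partial>lborel)"
        by (intro nn_integral_cong) (auto split: split_indicator)
      also have "\<dots> = emeasure lborel ((\<lambda>x. inverse r * x) -` A i)"
        using meas[OF that] by simp
      finally show ?thesis using r by simp
    qed
    have "emeasure (distr ?P ?P ?s) (Pi\<^sub>E {..<n} A) = emeasure ?P (?s -` Pi\<^sub>E {..<n} A \<inter> space ?P)"
      using A by (intro emeasure_distr) (auto intro!: sets_PiM_I_finite)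
    also have "?s -` Pi\<^sub>E {..<n} A \<inter> space ?P = Pi\<^sub>E {..<n} (\<lambda>i. (\<lambda>x. inverse r * x) -` A i)"
      by (auto simp: space_PiM PiE_iff)
    also have "emeasure ?P \<dots> = (\<Prod>i<n. emeasure lborel ((\<lambda>x. inverse r * x) -` A i))"
      using meas by (intro emeasure_PiM) auto
    finally have 1: "emeasure (distr ?P ?P ?s) (Pi\<^sub>E {..<n} A) = \<dots>" .
    have "ennreal (inverse r ^ n) * (\<Prod>i<n. emeasure lborel ((\<lambda>x. inverse r * x) -` A i)) =
      (\<Prod>i<n. ennreal (inverse r) * emeasure lborel ((\<lambda>x. inverse r * x) -` A i))"
      using r by (simp add: prod.distrib ennreal_power)
    also have "\<dots> = (\<Prod>i<n. emeasure lborel (A i))" using em by (intro prod.cong) auto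
    finally show "emeasure (scale_measure (ennreal (inverse r ^ n)) (distr ?P ?P ?s)) (Pi\<^sub>E {..<n} A) =
      (\<Prod>i<n. emeasure lborel (A i))" by (simp add: 1)
  qed auto
  then have "scale_measure (ennreal (r ^ n)) ?P =
    scale_measure (ennreal (r ^ n)) (scale_measure (ennreal (inverse r ^ n)) (distr ?P ?P ?s))" by simp
  also have "\<dots> = distr ?P ?P ?s"
    using r by (simp add: ennreal_mult[symmetric] power_mult_distrib[symmetric])
  finally show ?thesis ..
qed

end

lemma homogeneous_lebesgue_prod:
  assumes "0 < nx + ny"
  shows "homogeneous_measure (lebesgue_prod nx ny) (Rn nx \<times> Rn ny) (nx + ny)"
proof -
  let ?n = "nx + ny" and ?T = "vec_pair nx ny"
  let ?P = "Pi\<^sub>M {..<nx + ny} (\<lambda>_. lborel :: real measure)"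
  interpret product_sigma_finite "\<lambda>_::nat. lborel :: real measure" ..
  have L: "lebesgue_prod nx ny = distr ?P borel ?T"
    unfolding lebesgue_prod_def vec_pair_def ..
  have norm1: "norm (?T f) \<le> 1 \<longleftrightarrow> (\<Sum>i<?n. (f i)\<^sup>2) \<le> 1" for f
    using norm_vec_pair[of nx ny f] by (metis abs_norm_cancel abs_square_le_1)
  have em: "emeasure (distr ?P borel ?T) (cball 0 1) = emeasure ?P {f \<in> space ?P. norm (?T f) \<le> 1}"
    by (subst emeasure_distr) (auto intro!: arg_cong[where f="emeasure ?P"])
  show ?thesis unfolding L
  proof
    show "subspace (Rn nx \<times> Rn ny)" by (intro subspace_Times subspace_Rn)
    show "closed (Rn nx \<times> Rn ny)" by (intro closed_Times closed_Rn)
    have "{w \<in> space borel. w \<in> Rn nx \<times> Rn ny} \<in> sets borel"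
      using closed_Times[OF closed_Rn[of nx] closed_Rn[of ny]] by (simp add: borel_closed)
    then show "AE w in distr ?P borel ?T. w \<in> Rn nx \<times> Rn ny"
      by (subst AE_distr_iff) (auto simp: vec_pair_def vec_of_Rn)
  next
    fix d :: "fseq \<times> fseq" assume d: "d \<in> Rn nx \<times> Rn ny"
    define d0 where "d0 = (\<lambda>i. if i < nx then coord (fst d) i else coord (snd d) (i - nx))"
    have T: "?T d0 = d" unfolding d0_def by (rule vec_pair_coord[OF d])
    let ?s = "\<lambda>f. \<lambda>i\<in>{..<?n}. f i + d0 i"
    have "distr (distr ?P borel ?T) borel (\<lambda>w. w + d) = distr ?P borel (\<lambda>f. ?T f + d)"
      by (subst distr_distr) (auto simp: comp_def)
    also have "(\<lambda>f. ?T f + d) = ?T \<circ> ?s"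
      unfolding T[symmetric] vec_pair_add[symmetric] by (intro ext) (auto intro!: vec_pair_cong)
    also have "distr ?P borel (?T \<circ> ?s) = distr (distr ?P ?P ?s) borel ?T"
      by (subst distr_distr) auto
    finally show "distr (distr ?P borel ?T) borel (\<lambda>w. w + d) = distr ?P borel ?T"
      by (simp add: PiM_lborel_translate)
  next
    fix r :: real and A :: "(fseq \<times> fseq) set" assume r: "0 < r" and A [measurable]: "A \<in> sets borel"
    let ?s = "\<lambda>f. \<lambda>i\<in>{..<?n}. inverse r * f i"
    have A': "(\<lambda>w. w /\<^sub>R r) -` A \<in> sets borel"
      by (rule measurable_sets_borel[OF _ A]) measurable
    have "(\<lambda>f. ?T f /\<^sub>R r) = ?T \<circ> ?s"
      unfolding vec_pair_scale[symmetric] by (intro ext) (auto intro!: vec_pair_cong)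
    then have "distr (distr ?P borel ?T) borel (\<lambda>w. w /\<^sub>R r) = distr (distr ?P ?P ?s) borel ?T"
      by (subst (1 2) distr_distr) (auto simp: comp_def)
    then have 1: "emeasure (distr (distr ?P borel ?T) borel (\<lambda>w. w /\<^sub>R r)) A =
      emeasure (distr (distr ?P ?P ?s) borel ?T) A" by simp
    have "emeasure (distr (distr ?P borel ?T) borel (\<lambda>w. w /\<^sub>R r)) A =
      emeasure (distr ?P borel ?T) ((\<lambda>w. w /\<^sub>R r) -` A)"
      by (subst emeasure_distr) auto
    moreover have "emeasure (distr (distr ?P ?P ?s) borel ?T) A = ennreal (r ^ ?n) * emeasure (distr ?P borel ?T) A"
      unfolding PiM_lborel_scale[OF r] by (subst (1 2) emeasure_distr) (auto simp: space_scale_measure)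
    ultimately show "emeasure (distr ?P borel ?T) ((\<lambda>w. w /\<^sub>R r) -` A) = ennreal (r ^ ?n) * emeasure (distr ?P borel ?T) A"
      using 1 by simp
  next
    \<comment> \<open>A cube inside the unit ball: with half side \<open>1 / real ?n\<close> the
      squared norm is at most \<open>real ?n * (1 / real ?n)\<^sup>2\<close>, hence at most 1. For
      finiteness the ball is later enclosed in the cube with half side 1.\<close>
    let ?A = "Pi\<^sub>E {..<?n} (\<lambda>_. {- (1 / real ?n)..1 / real ?n})"
    have inv: "(1 / N)\<^sup>2 \<le> 1 / N" if "1 \<le> N" for N :: real
      using that by (simp add: power2_eq_square field_simps)
    have "?A \<subseteq> {f \<in> space ?P. norm (?T f) \<le> 1}"
    proof
      fix f assume f: "f \<in> ?A"
      have "(\<Sum>i<?n. (f i)\<^sup>2) \<le> (\<Sum>i<?n. 1 / real ?n)"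
      proof (rule sum_mono)
        fix i assume "i \<in> {..<?n}"
        then have "- (1 / real ?n) \<le> f i" "f i \<le> 1 / real ?n" using f by (auto simp: PiE_iff)
        then have "\<bar>f i\<bar> \<le> 1 / real ?n" by linarith
        then have "\<bar>f i\<bar>\<^sup>2 \<le> (1 / real ?n)\<^sup>2" by (intro power_mono) auto
        also have "\<dots> \<le> 1 / real ?n"
          using inv[of "real ?n"] assms by simp
        finally show "(f i)\<^sup>2 \<le> 1 / real ?n" by simp
      qed
      also have "\<dots> \<le> 1" using assms by simp
      finally show "f \<in> {f \<in> space ?P. norm (?T f) \<le> 1}"
        using f by (auto simp: norm1 space_PiM PiE_iff)
    qed
    then have "emeasure ?P ?A \<le> emeasure ?P {f \<in> space ?P. norm (?T f) \<le> 1}"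
      by (intro emeasure_mono) measurable
    moreover have "emeasure ?P ?A = (\<Prod>i<?n. ennreal (2 / real ?n))"
      by (subst emeasure_PiM) auto
    moreover have "0 < (2 / real ?n) ^ ?n" using assms by (intro zero_less_power divide_pos_pos) auto
    then have "0 < (\<Prod>i<?n. ennreal (2 / real ?n))" by (simp add: ennreal_power)
    ultimately show "0 < emeasure (distr ?P borel ?T) (cball 0 1)" unfolding em by (simp only: less_le_trans)
  next
    let ?A = "Pi\<^sub>E {..<?n} (\<lambda>_. {- 1..1::real})"
    have "{f \<in> space ?P. norm (?T f) \<le> 1} \<subseteq> ?A"
    proof
      fix f assume f: "f \<in> {f \<in> space ?P. norm (?T f) \<le> 1}"
      then have "(f i)\<^sup>2 \<le> 1" if "i < ?n" for i
        using member_le_sum[of i "{..<?n}" "\<lambda>i. (f i)\<^sup>2"] that by (auto simp: norm1)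
      then have "- 1 \<le> f i \<and> f i \<le> 1" if "i < ?n" for i
        using that by (auto simp: abs_square_le_1 abs_le_iff minus_le_iff)
      then show "f \<in> ?A" using f by (auto simp: space_PiM PiE_iff)
    qed
    then have "emeasure ?P {f \<in> space ?P. norm (?T f) \<le> 1} \<le> emeasure ?P ?A"
      by (intro emeasure_mono) (auto intro!: sets_PiM_I_finite)
    also have "\<dots> = (\<Prod>i<?n. ennreal 2)" by (subst emeasure_PiM) auto
    also have "\<dots> < \<infinity>" by (simp add: power_less_top_ennreal)
    finally show "emeasure (distr ?P borel ?T) (cball 0 1) < \<infinity>" unfolding em .
  qed (use assms in auto)
qed

subsection \<open>Convexity and directional derivatives\<close>

text \<open>The gradient inequality at the intermediate point is applied to both endpoints with
  weights \<open>1 - h\<close> and \<open>h\<close>. The gradient terms cancel, and the quadratic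
  terms add up because \<open>(1 - h) * h\<^sup>2 + h * (1 - h)\<^sup>2 = h * (1 - h)\<close>. This
  is the chord form that \<open>sphere_gradient_bound\<close> expects.\<close>

lemma strongly_convex_on_segment:
  assumes f: "strongly_convex_on n \<mu> S f" and S: "convex S"
    and pq: "p \<in> S" "q \<in> S" and h: "0 \<le> h" "h \<le> 1"
  shows "f ((1 - h) *\<^sub>R p + h *\<^sub>R q) \<le> (1 - h) * f p + h * f q - h * (1 - h) * (\<mu> / 2 * (norm (p - q))\<^sup>2)"
proof -
  obtain G where G: "\<And>x y. x \<in> S \<Longrightarrow> y \<in> S \<Longrightarrow> f y \<ge> f x + G x \<bullet> (y - x) + \<mu> / 2 * (norm (y - x))\<^sup>2"
    using f unfolding strongly_convex_on_def by blast
  define m where "m = (1 - h) *\<^sub>R p + h *\<^sub>R q"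
  have m: "m \<in> S" unfolding m_def using S pq h by (intro convexD) auto
  have pm: "p - m = h *\<^sub>R (p - q)" and qm: "q - m = - ((1 - h) *\<^sub>R (p - q))"
    by (auto simp: m_def algebra_simps)
  have 1: "f m + h * (G m \<bullet> (p - q)) + \<mu> / 2 * (h\<^sup>2 * (norm (p - q))\<^sup>2) \<le> f p"
    using G[OF m pq(1)] unfolding pm by (simp add: power_mult_distrib)
  have 2: "f m - (1 - h) * (G m \<bullet> (p - q)) + \<mu> / 2 * ((1 - h)\<^sup>2 * (norm (p - q))\<^sup>2) \<le> f q"
    using G[OF m pq(2)] unfolding qm by (simp add: power_mult_distrib)
  have "(1 - h) * (f m + h * (G m \<bullet> (p - q)) + \<mu> / 2 * (h\<^sup>2 * (norm (p - q))\<^sup>2)) +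
    h * (f m - (1 - h) * (G m \<bullet> (p - q)) + \<mu> / 2 * ((1 - h)\<^sup>2 * (norm (p - q))\<^sup>2)) \<le> (1 - h) * f p + h * f q"
    using 1 2 h by (intro add_mono mult_left_mono) auto
  moreover have "(1 - h) * (f m + h * (G m \<bullet> (p - q)) + \<mu> / 2 * (h\<^sup>2 * (norm (p - q))\<^sup>2)) +
    h * (f m - (1 - h) * (G m \<bullet> (p - q)) + \<mu> / 2 * ((1 - h)\<^sup>2 * (norm (p - q))\<^sup>2)) =
    f m + h * (1 - h) * (\<mu> / 2 * (norm (p - q))\<^sup>2)"
    by (simp add: power2_eq_square field_simps)
  ultimately show ?thesis by (simp add: m_def)
qed

lemma strongly_convex_on_imp_convex_on:
  assumes "strongly_convex_on n \<mu> S f" "convex S" "0 \<le> \<mu>"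
  shows "convex_on S f"
proof (rule convex_onI)
  fix t :: real and p q assume *: "0 < t" "t < 1" "p \<in> S" "q \<in> S"
  have "0 \<le> t * (1 - t) * (\<mu> / 2 * (norm (p - q))\<^sup>2)" using * assms(3) by simp
  then show "f ((1 - t) *\<^sub>R p + t *\<^sub>R q) \<le> (1 - t) * f p + t * f q"
    using strongly_convex_on_segment[OF assms(1,2) *(3,4), of t] * by linarith
qed (rule assms)

text \<open>Chord slopes of a convex function increase to the right. A slope at a vanishing step
  \<open>h\<close> is thereby trapped between slopes at a fixed step \<open>t\<close>.\<close>

lemma convex_on_quotient_bounds:
  fixes f :: "'a::real_vector \<Rightarrow> real"
  assumes f: "convex_on S f" and x: "x \<in> S" "x + t *\<^sub>R a \<in> S" "x - t *\<^sub>R a \<in> S" and t: "0 < h" "h \<le> t"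
  shows "(f (x + h *\<^sub>R a) - f x) / h \<le> (f (x + t *\<^sub>R a) - f x) / t"
    and "(f x - f (x - t *\<^sub>R a)) / t \<le> (f (x + h *\<^sub>R a) - f x) / h"
proof -
  have S: "convex S" using f by (simp add: convex_on_def)
  have t0: "0 < t" using t by linarith
  have eq: "x + h *\<^sub>R a = (1 - h / t) *\<^sub>R x + (h / t) *\<^sub>R (x + t *\<^sub>R a)"
    using t0 by (simp add: algebra_simps)
  have ht: "0 \<le> h / t" "h / t \<le> 1" using t t0 by auto
  have xh: "x + h *\<^sub>R a \<in> S" unfolding eq using S x ht by (intro convexD) auto
  have "f (x + h *\<^sub>R a) \<le> (1 - h / t) * f x + (h / t) * f (x + t *\<^sub>R a)"
    unfolding eq using convex_onD[OF f ht x(1,2)] .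
  then have "f (x + h *\<^sub>R a) - f x \<le> (h / t) * (f (x + t *\<^sub>R a) - f x)" by (simp add: algebra_simps)
  then show "(f (x + h *\<^sub>R a) - f x) / h \<le> (f (x + t *\<^sub>R a) - f x) / t"
    using t t0 by (simp add: field_simps)
  have eq2: "x = (1 - h / (t + h)) *\<^sub>R (x + h *\<^sub>R a) + (h / (t + h)) *\<^sub>R (x - t *\<^sub>R a)"
  proof -
    have "(1 - h / (t + h)) *\<^sub>R (x + h *\<^sub>R a) + (h / (t + h)) *\<^sub>R (x - t *\<^sub>R a) =
      x + ((1 - h / (t + h)) * h - h / (t + h) * t) *\<^sub>R a" by (simp add: algebra_simps)
    also have "(1 - h / (t + h)) * h - h / (t + h) * t = 0" using t t0 by (simp add: field_simps)
    finally show ?thesis by simp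
  qed
  have w: "1 - h / (t + h) = t / (t + h)" using t t0 by (simp add: field_simps)
  have "f x \<le> (1 - h / (t + h)) * f (x + h *\<^sub>R a) + (h / (t + h)) * f (x - t *\<^sub>R a)"
    using convex_onD[OF f _ _ xh x(3), of "h / (t + h)"] t t0 eq2 by simp
  then have "f x \<le> (t * f (x + h *\<^sub>R a) + h * f (x - t *\<^sub>R a)) / (t + h)"
    unfolding w by (simp add: add_divide_distrib)
  then have "(t + h) * f x \<le> t * f (x + h *\<^sub>R a) + h * f (x - t *\<^sub>R a)"
    using t t0 by (simp add: pos_le_divide_eq mult.commute)
  then show "(f x - f (x - t *\<^sub>R a)) / t \<le> (f (x + h *\<^sub>R a) - f x) / h"
    using t t0 by (simp add: field_simps)
qed

lemma has_derivative_directional: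
  fixes f :: "'a::real_normed_vector \<Rightarrow> real"
  assumes f: "(f has_derivative f') (at x within S)"
    and ev: "\<forall>\<^sub>F t in at_right 0. x + t *\<^sub>R a \<in> S"
  shows "((\<lambda>t. (f (x + t *\<^sub>R a) - f x) / t) \<longlongrightarrow> f' a) (at_right 0)"
proof (cases "a = 0")
  case True
  have "f' 0 = 0" using f by (intro linear_0 has_derivative_linear)
  then show ?thesis using True by simp
next
  case False
  have lin: "linear f'" using f by (rule has_derivative_linear)
  have lim: "((\<lambda>y. norm (f y - f x - f' (y - x)) / norm (y - x)) \<longlongrightarrow> 0) (at x within S)"
    using f unfolding has_derivative_iff_norm by simp
  have "((\<lambda>t. x + t *\<^sub>R a) \<longlongrightarrow> x + 0 *\<^sub>R a) (at_right 0)" by (intro tendsto_intros)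
  moreover have "\<forall>\<^sub>F t in at_right 0. x + t *\<^sub>R a \<in> S \<and> x + t *\<^sub>R a \<noteq> x"
    using ev eventually_at_right_less[of "0::real"] by eventually_elim (use False in auto)
  ultimately have "filterlim (\<lambda>t. x + t *\<^sub>R a) (at x within S) (at_right 0)"
    by (simp add: filterlim_at)
  from filterlim_compose[OF lim this]
  have "((\<lambda>t. norm (f (x + t *\<^sub>R a) - f x - f' (t *\<^sub>R a)) / norm (t *\<^sub>R a)) \<longlongrightarrow> 0) (at_right 0)"
    by simp
  from tendsto_mult_right[OF this, of "norm a"]
  have l: "((\<lambda>t. norm (f (x + t *\<^sub>R a) - f x - f' (t *\<^sub>R a)) / norm (t *\<^sub>R a) * norm a) \<longlongrightarrow> 0) (at_right 0)"
    by simp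
  have "((\<lambda>t. (f (x + t *\<^sub>R a) - f x) / t - f' a) \<longlongrightarrow> 0) (at_right 0)"
  proof (rule Lim_null_comparison[OF _ l])
    show "\<forall>\<^sub>F t in at_right 0. norm ((f (x + t *\<^sub>R a) - f x) / t - f' a) \<le>
      norm (f (x + t *\<^sub>R a) - f x - f' (t *\<^sub>R a)) / norm (t *\<^sub>R a) * norm a"
      using eventually_at_right_less[of "0::real"]
    proof eventually_elim
      case (elim t)
      have "(f (x + t *\<^sub>R a) - f x) / t - f' a = (f (x + t *\<^sub>R a) - f x - f' (t *\<^sub>R a)) / t"
        using elim by (simp add: linear_scale[OF lin] diff_divide_distrib)
      then show ?case using elim False by (simp add: abs_divide)
    qed
  qed
  then show ?thesis by (simp add: LIM_zero_iff)
qed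

text \<open>Separate convexity and differentiability already give a joint Gateaux derivative: difference
  quotients of the convex functions \<open>\<phi>(\<cdot>, y + h b)\<close> are squeezed between their values at a
  fixed larger step, where \<open>h \<rightarrow> 0\<close> is harmless.\<close>

lemma scsc_on_gateaux:
  assumes UX: "openin (top_of_set (Rn nx)) UX" "convex UX"
    and UY: "openin (top_of_set (Rn ny)) UY" "convex UY"
    and scsc: "scsc_on nx ny \<mu> UX UY \<phi>" and \<mu>: "0 \<le> \<mu>"
    and Lip: "M-lipschitz_on (UX \<times> UY) \<phi>" and z: "z \<in> UX \<times> UY"
  shows "\<exists>g\<in>Rn nx \<times> Rn ny. norm g \<le> M \<and>
    (\<forall>v\<in>Rn nx \<times> Rn ny. ((\<lambda>h. (\<phi> (z + h *\<^sub>R v) - \<phi> z) / h) \<longlongrightarrow> g \<bullet> v) (at_right 0))"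
proof -
  obtain x y where z_eq: "z = (x, y)" by (cases z)
  have x: "x \<in> UX" and y: "y \<in> UY" using z z_eq by auto
  have M: "0 \<le> M" using Lip by (rule lipschitz_on_nonneg)
  have lip: "\<bar>\<phi> p - \<phi> q\<bar> \<le> M * norm (p - q)" if "p \<in> UX \<times> UY" "q \<in> UX \<times> UY" for p q
    using lipschitz_onD[OF Lip that] by (simp add: dist_norm)
  obtain Gx where Gx: "Gx \<in> Rn nx" "((\<lambda>x. \<phi> (x, y)) has_derivative (\<lambda>h. Gx \<bullet> h)) (at x within UX)"
    using scsc x y unfolding scsc_on_def strongly_convex_on_def by blast
  obtain Gy where Gy: "Gy \<in> Rn ny" "((\<lambda>y. - \<phi> (x, y)) has_derivative (\<lambda>h. Gy \<bullet> h)) (at y within UY)"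
    using scsc x y unfolding scsc_on_def strongly_concave_on_def strongly_convex_on_def by blast
  define g where "g = (Gx, - Gy)"
  have gV: "g \<in> Rn nx \<times> Rn ny" using Gx Gy by (simp add: g_def subspace_Rn subspace_neg)
  have lim: "((\<lambda>h. (\<phi> (z + h *\<^sub>R v) - \<phi> z) / h) \<longlongrightarrow> g \<bullet> v) (at_right 0)"
    if v: "v \<in> Rn nx \<times> Rn ny" for v
  proof -
    obtain a b where v_eq: "v = (a, b)" by (cases v)
    have a: "a \<in> Rn nx" and b: "b \<in> Rn ny" using v v_eq by auto
    have a': "- a \<in> Rn nx" using a by (simp add: subspace_Rn subspace_neg)
    have evx: "\<forall>\<^sub>F h in at_right 0. x + h *\<^sub>R a \<in> UX" "\<forall>\<^sub>F h in at_right 0. x + h *\<^sub>R (- a) \<in> UX"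
      by (rule eventually_openin_subspace[OF subspace_Rn UX(1) x]; fact)+
    have evy: "\<forall>\<^sub>F h in at_right 0. y + h *\<^sub>R b \<in> UY"
      by (rule eventually_openin_subspace[OF subspace_Rn UY(1) y]; fact)
    have limY: "((\<lambda>h. (\<phi> (x, y + h *\<^sub>R b) - \<phi> (x, y)) / h) \<longlongrightarrow> - (Gy \<bullet> b)) (at_right 0)"
    proof -
      have "((\<lambda>h. - ((- \<phi> (x, y + h *\<^sub>R b) - - \<phi> (x, y)) / h)) \<longlongrightarrow> - (Gy \<bullet> b)) (at_right 0)"
        by (intro tendsto_minus has_derivative_directional[OF Gy(2) evy])
      then show ?thesis by (simp add: minus_divide_left)
    qed
    \<comment> \<open>The order of choices matters: \<open>t\<close> is fixed first, so that both
      slopes of \<open>\<phi>(., y)\<close> at step \<open>t\<close> are within \<open>e / 2\<close>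
      of the derivative. Then \<open>h\<close> shrinks, and replacing
      \<open>y + h *\<^sub>R b\<close> by \<open>y\<close> costs
      \<open>2 * M * (h * norm b) / t\<close>, which falls below \<open>e / 2\<close>.\<close>
    have limX: "((\<lambda>h. (\<phi> (x + h *\<^sub>R a, y + h *\<^sub>R b) - \<phi> (x, y + h *\<^sub>R b)) / h) \<longlongrightarrow> Gx \<bullet> a) (at_right 0)"
    proof (rule tendstoI)
      fix e :: real assume e: "0 < e"
      have l1: "\<forall>\<^sub>F t in at_right 0. dist ((\<phi> (x + t *\<^sub>R a, y) - \<phi> (x, y)) / t) (Gx \<bullet> a) < e / 2"
        by (rule tendstoD[OF has_derivative_directional[OF Gx(2) evx(1)]]) (use e in simp)
      have l2: "\<forall>\<^sub>F t in at_right 0. dist ((\<phi> (x + t *\<^sub>R (- a), y) - \<phi> (x, y)) / t) (Gx \<bullet> (- a)) < e / 2"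
        by (rule tendstoD[OF has_derivative_directional[OF Gx(2) evx(2)]]) (use e in simp)
      have "\<forall>\<^sub>F t in at_right (0::real). 0 < t \<and> x + t *\<^sub>R a \<in> UX \<and> x - t *\<^sub>R a \<in> UX \<and>
        \<bar>(\<phi> (x + t *\<^sub>R a, y) - \<phi> (x, y)) / t - Gx \<bullet> a\<bar> < e / 2 \<and>
        \<bar>(\<phi> (x, y) - \<phi> (x - t *\<^sub>R a, y)) / t - Gx \<bullet> a\<bar> < e / 2"
        using l1 l2 evx eventually_at_right_less[of "0::real"]
      proof eventually_elim
        case (elim t)
        have eq: "(\<phi> (x, y) - \<phi> (x - t *\<^sub>R a, y)) / t - Gx \<bullet> a =
          - ((\<phi> (x + t *\<^sub>R (- a), y) - \<phi> (x, y)) / t - Gx \<bullet> (- a))"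
          by (simp add: diff_divide_distrib)
        have "\<bar>(\<phi> (x, y) - \<phi> (x - t *\<^sub>R a, y)) / t - Gx \<bullet> a\<bar> < e / 2"
          unfolding eq abs_minus_cancel using elim(2) unfolding dist_real_def .
        then show ?case using elim by (simp add: dist_real_def)
      qed
      then obtain t where t: "0 < t" "x + t *\<^sub>R a \<in> UX" "x - t *\<^sub>R a \<in> UX"
        "\<bar>(\<phi> (x + t *\<^sub>R a, y) - \<phi> (x, y)) / t - Gx \<bullet> a\<bar> < e / 2"
        "\<bar>(\<phi> (x, y) - \<phi> (x - t *\<^sub>R a, y)) / t - Gx \<bullet> a\<bar> < e / 2"
        using eventually_happens'[OF trivial_limit_at_right_real] by blast
      have "((\<lambda>h. 2 * M * (h * norm b) / t) \<longlongrightarrow> 2 * M * (0 * norm b) / t) (at_right 0)"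
        by (intro tendsto_intros) (use t in auto)
      then have small: "\<forall>\<^sub>F h in at_right 0. 2 * M * (h * norm b) / t < e / 2"
        using e by (intro order_tendstoD) auto
      have "\<forall>\<^sub>F h in at_right 0. h < t" using t(1) by (intro eventually_at_right_less[of 0] order_tendstoD(2)[OF tendsto_ident_at])
      then show "\<forall>\<^sub>F h in at_right 0. dist ((\<phi> (x + h *\<^sub>R a, y + h *\<^sub>R b) - \<phi> (x, y + h *\<^sub>R b)) / h) (Gx \<bullet> a) < e"
        using small evy eventually_at_right_less[of "0::real"]
      proof eventually_elim
        case (elim h)
        have conv: "convex_on UX (\<lambda>x. \<phi> (x, y + h *\<^sub>R b))"
          using scsc elim UX \<mu> by (auto simp: scsc_on_def intro: strongly_convex_on_imp_convex_on)
        have close: "\<bar>\<phi> (p, y + h *\<^sub>R b) - \<phi> (p, y)\<bar> \<le> M * (h * norm b)" if "p \<in> UX" for p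
          using lip[of "(p, y + h *\<^sub>R b)" "(p, y)"] that elim y by (simp add: norm_Pair)
        have "(\<phi> (x + h *\<^sub>R a, y + h *\<^sub>R b) - \<phi> (x, y + h *\<^sub>R b)) / h \<le> (\<phi> (x + t *\<^sub>R a, y + h *\<^sub>R b) - \<phi> (x, y + h *\<^sub>R b)) / t"
          by (rule convex_on_quotient_bounds(1)[OF conv x t(2,3)]) (use elim in auto)
        also have "\<dots> \<le> (\<phi> (x + t *\<^sub>R a, y) - \<phi> (x, y) + 2 * M * (h * norm b)) / t"
          using close[OF x] close[OF t(2)] t(1) by (intro divide_right_mono) auto
        finally have u: "(\<phi> (x + h *\<^sub>R a, y + h *\<^sub>R b) - \<phi> (x, y + h *\<^sub>R b)) / h \<le> (\<phi> (x + t *\<^sub>R a, y) - \<phi> (x, y)) / t + 2 * M * (h * norm b) / t"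
          by (simp add: add_divide_distrib)
        have "(\<phi> (x, y) - \<phi> (x - t *\<^sub>R a, y) - 2 * M * (h * norm b)) / t \<le> (\<phi> (x, y + h *\<^sub>R b) - \<phi> (x - t *\<^sub>R a, y + h *\<^sub>R b)) / t"
          using close[OF x] close[OF t(3)] t(1) by (intro divide_right_mono) auto
        also have "\<dots> \<le> (\<phi> (x + h *\<^sub>R a, y + h *\<^sub>R b) - \<phi> (x, y + h *\<^sub>R b)) / h"
          by (rule convex_on_quotient_bounds(2)[OF conv x t(2,3)]) (use elim in auto)
        finally have l: "(\<phi> (x, y) - \<phi> (x - t *\<^sub>R a, y)) / t - 2 * M * (h * norm b) / t \<le> (\<phi> (x + h *\<^sub>R a, y + h *\<^sub>R b) - \<phi> (x, y + h *\<^sub>R b)) / h"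
          by (simp add: diff_divide_distrib)
        show ?case using u l t(4,5) elim(2) unfolding dist_real_def by linarith
      qed
    qed
    have "((\<lambda>h. (\<phi> (x + h *\<^sub>R a, y + h *\<^sub>R b) - \<phi> (x, y + h *\<^sub>R b)) / h + (\<phi> (x, y + h *\<^sub>R b) - \<phi> (x, y)) / h) \<longlongrightarrow>
      Gx \<bullet> a + - (Gy \<bullet> b)) (at_right 0)"
      by (intro tendsto_add limX limY)
    then show ?thesis by (simp add: z_eq v_eq g_def diff_divide_distrib)
  qed
  \<comment> \<open>The derivative in the direction \<open>g\<close> itself is
    \<open>g \<bullet> g\<close>, while the Lipschitz bound limits every difference quotient in that
    direction to \<open>M * norm g\<close>.\<close>
  have "g \<bullet> g \<le> M * norm g"
  proof (rule tendsto_upperbound[OF lim[OF gV]])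
    have "openin (top_of_set (Rn nx \<times> Rn ny)) (UX \<times> UY)"
      using UX(1) UY(1) by (rule openin_Times)
    from eventually_openin_subspace[OF subspace_Times[OF subspace_Rn subspace_Rn] this z gV]
    show "\<forall>\<^sub>F h in at_right 0. (\<phi> (z + h *\<^sub>R g) - \<phi> z) / h \<le> M * norm g"
      using eventually_at_right_less[of "0::real"]
    proof eventually_elim
      case (elim h)
      have "\<phi> (z + h *\<^sub>R g) - \<phi> z \<le> M * (h * norm g)"
        using lip[OF elim(1) z] elim(2) by simp
      then show ?case using elim by (simp add: field_simps)
    qed
  qed simp
  then have "norm g * norm g \<le> M * norm g" by (simp add: power2_norm_eq_inner[symmetric] power2_eq_square)
  then have "norm g \<le> M" using M by (cases "norm g = 0") (auto simp: mult_le_cancel_right)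
  with gV lim show ?thesis by blast
qed

subsection \<open>Projection and fresh samples\<close>

context
  fixes Z :: "(fseq \<times> fseq) set"
  assumes Z: "compact Z" "convex Z" "Z \<noteq> {}"
begin

lemma proj_closest:
  shows proj_in: "proj Z w \<in> Z" and proj_le: "z \<in> Z \<Longrightarrow> dist w (proj Z w) \<le> dist w z"
proof -
  obtain x where "x \<in> Z" "\<And>z. z \<in> Z \<Longrightarrow> dist w x \<le> dist w z"
    using continuous_attains_inf[OF Z(1,3) continuous_on_dist[OF continuous_on_const continuous_on_id]]
    by blast
  then have "\<exists>x. is_arg_min (dist w) (\<lambda>x. x \<in> Z) x"
    unfolding is_arg_min_linorder by blast
  then have "is_arg_min (dist w) (\<lambda>x. x \<in> Z) (proj Z w)"
    unfolding proj_def arg_min_on_def arg_min_def by (rule someI_ex)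
  then show "proj Z w \<in> Z" "z \<in> Z \<Longrightarrow> dist w (proj Z w) \<le> dist w z"
    unfolding is_arg_min_linorder by (blast, blast)
qed

lemma proj_dot: "z \<in> Z \<Longrightarrow> (w - proj Z w) \<bullet> (z - proj Z w) \<le> 0"
  using Z by (intro any_closest_point_dot[of Z]) (auto intro: compact_imp_closed proj_in proj_le)

text \<open>The variational inequalities at the two projections are added and Cauchy-Schwarz is
  applied.\<close>

lemma proj_nonexpansive: "norm (proj Z v - proj Z w) \<le> norm (v - w)"
proof -
  let ?p = "proj Z v" and ?q = "proj Z w"
  have "(v - ?p) \<bullet> (?q - ?p) \<le> 0" "(w - ?q) \<bullet> (?p - ?q) \<le> 0"
    by (auto intro: proj_dot proj_in)
  then have "(norm (?p - ?q))\<^sup>2 \<le> (v - w) \<bullet> (?p - ?q)"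
    by (simp add: power2_norm_eq_inner inner_diff_left inner_diff_right inner_commute)
  also have "\<dots> \<le> norm (v - w) * norm (?p - ?q)"
    by (rule norm_cauchy_schwarz)
  finally show ?thesis
    by (cases "norm (?p - ?q) = 0") (auto simp: power2_eq_square)
qed

lemma proj_ident: "z \<in> Z \<Longrightarrow> proj Z z = z"
  using proj_le[of z z] by simp

lemma proj_norm_le: "u \<in> Z \<Longrightarrow> norm (proj Z w - u) \<le> norm (w - u)"
  using proj_nonexpansive[of w u] by (simp add: proj_ident)

text \<open>Nonexpansive maps are continuous, hence Borel. The codomain is restricted to
  \<open>Z\<close> because the next queries are meaningful only from points of
  \<open>Z\<close>.\<close>

lemma measurable_proj [measurable]: "proj Z \<in> borel \<rightarrow>\<^sub>M restrict_space borel Z"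
proof (rule measurable_restrict_space2)
  have "1-lipschitz_on UNIV (proj Z)"
    using proj_nonexpansive by (intro lipschitz_onI) (auto simp: dist_norm)
  then have "continuous_on UNIV (proj Z)" by (rule lipschitz_on_continuous_on)
  then show "proj Z \<in> borel_measurable borel" by (rule borel_measurable_continuous_onI)
qed (auto intro: proj_in)

end

text \<open>A random variable that ignores one coordinate is independent of it. Coordinate
  \<open>k\<close> is split off the product, \<open>\<zeta>\<close> is read as a function of the
  others, and rectangles are compared.\<close>

lemma distr_PiM_fresh_component:
  fixes M :: "'i \<Rightarrow> 'a measure"
  assumes M: "\<And>i. prob_space (M i)" and \<zeta> [measurable]: "\<zeta> \<in> Pi\<^sub>M UNIV M \<rightarrow>\<^sub>M N"
    and indep: "\<And>X x. \<zeta> (X(k := x)) = \<zeta> X"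
  shows "distr (Pi\<^sub>M UNIV M) (N \<Otimes>\<^sub>M M k) (\<lambda>\<omega>. (\<zeta> \<omega>, \<omega> k)) = distr (Pi\<^sub>M UNIV M) N \<zeta> \<Otimes>\<^sub>M M k"
proof -
  let ?P = "Pi\<^sub>M UNIV M" and ?P' = "Pi\<^sub>M (UNIV - {k}) M"
  interpret P: prob_space ?P using M by (rule prob_space_PiM)
  interpret P': prob_space ?P' using M by (intro prob_space_PiM)
  interpret Mk: prob_space "M k" by (rule M)
  interpret D: prob_space "distr ?P N \<zeta>" by (rule P.prob_space_distr) measurable
  have ins: "insert k (UNIV - {k}) = UNIV" by auto
  have P_eq: "distr (M k \<Otimes>\<^sub>M ?P') ?P (\<lambda>(x, X). X(k := x)) = ?P"
    using distr_pair_PiM_eq_PiM[of "UNIV - {k}" M k] M by (simp add: ins)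
  have upd [measurable]: "(\<lambda>(x, X). X(k := x)) \<in> M k \<Otimes>\<^sub>M ?P' \<rightarrow>\<^sub>M ?P"
    unfolding split_beta by (rule measurable_fun_upd[where J="UNIV - {k}"]) auto
  \<comment> \<open>Elements of the smaller product carry no value of \<open>M k\<close> at
    \<open>k\<close>. Inserting any point \<open>a\<close> there makes \<open>\<zeta>\<close>
    applicable, and \<open>indep\<close> says that the result is unchanged.\<close>
  obtain a where a: "a \<in> space (M k)" using Mk.not_empty by blast
  have \<zeta>' [measurable]: "\<zeta> \<in> ?P' \<rightarrow>\<^sub>M N"
  proof -
    have "(\<lambda>X. X(k := a)) \<in> ?P' \<rightarrow>\<^sub>M ?P"
      by (rule measurable_fun_upd[where J="UNIV - {k}"]) (use a in auto)
    from measurable_compose[OF this \<zeta>] show ?thesis by (simp add: indep)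
  qed
  have em1: "emeasure (distr ?P N \<zeta>) A = emeasure ?P' (\<zeta> -` A \<inter> space ?P')" if [measurable]: "A \<in> sets N" for A
  proof -
    have "distr ?P N \<zeta> = distr (M k \<Otimes>\<^sub>M ?P') N (\<lambda>z. \<zeta> (snd z))"
      by (subst P_eq[symmetric], subst distr_distr) (auto simp: comp_def indep split_beta)
    also have "emeasure \<dots> A = emeasure (M k \<Otimes>\<^sub>M ?P') (space (M k) \<times> (\<zeta> -` A \<inter> space ?P'))"
      by (subst emeasure_distr) (auto simp: space_pair_measure intro!: arg_cong2[where f=emeasure])
    also have "\<dots> = emeasure ?P' (\<zeta> -` A \<inter> space ?P')"
      by (subst P'.emeasure_pair_measure_Times) (auto simp: Mk.emeasure_space_1 intro!: measurable_sets)
    finally show ?thesis .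
  qed
  show ?thesis
  proof (rule pair_measure_eqI[symmetric])
    fix A B assume A: "A \<in> sets (distr ?P N \<zeta>)" and B [measurable]: "B \<in> sets (M k)"
    have A' [measurable]: "A \<in> sets N" using A by simp
    have "distr ?P (N \<Otimes>\<^sub>M M k) (\<lambda>\<omega>. (\<zeta> \<omega>, \<omega> k)) = distr (M k \<Otimes>\<^sub>M ?P') (N \<Otimes>\<^sub>M M k) (\<lambda>z. (\<zeta> (snd z), fst z))"
      by (subst P_eq[symmetric], subst distr_distr) (auto simp: comp_def indep split_beta)
    also have "emeasure \<dots> (A \<times> B) = emeasure (M k \<Otimes>\<^sub>M ?P') (B \<times> (\<zeta> -` A \<inter> space ?P'))"
      using sets.sets_into_space[OF B]
      by (subst emeasure_distr) (auto simp: space_pair_measure intro!: arg_cong2[where f=emeasure])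
    also have "\<dots> = emeasure (M k) B * emeasure ?P' (\<zeta> -` A \<inter> space ?P')"
      by (subst P'.emeasure_pair_measure_Times) (auto intro!: measurable_sets)
    finally show "emeasure (distr ?P N \<zeta>) A * emeasure (M k) B =
      emeasure (distr ?P (N \<Otimes>\<^sub>M M k) (\<lambda>\<omega>. (\<zeta> \<omega>, \<omega> k))) (A \<times> B)"
      by (simp add: em1[OF A'] mult.commute)
  qed (auto intro: D.sigma_finite_measure_axioms Mk.sigma_finite_measure_axioms intro!: sets_pair_measure_cong)
qed

subsection \<open>The gradient estimator\<close>

text \<open>The final theorem obtains the positivity of \<open>\<tau>\<close> from
  \<open>0 < c1\<close>, the lower bound on the normalised smoothing radius.\<close>

locale noisy_saddle_algorithm = noisy_saddle_problem +
  assumes \<tau>_pos: "0 < \<tau>"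
begin

abbreviation "n \<equiv> nx + ny"
abbreviation "Z \<equiv> X \<times> Y"
abbreviation "U \<equiv> UX \<times> UY"
abbreviation "V \<equiv> Rn nx \<times> Rn ny"

lemma Z_V: "Z \<subseteq> V" using X(1) Y(1) by auto

lemma Z_props: "compact Z" "convex Z" "Z \<noteq> {}"
  using X Y by (auto intro: compact_Times convex_Times)

text \<open>In dimension 0 the set \<open>Z\<close> would be a single point and its diameter
  0.\<close>

lemma n_pos: "0 < n"
proof (rule ccontr)
  assume "\<not> 0 < n"
  then have "nx = 0" "ny = 0" by auto
  then have "V = {0}" by (auto simp: Rn_def zero_prod_def zero_fseq.rep_eq intro: fseq_eqI)
  then have "Z \<subseteq> {0}" using Z_V by simp
  then have "Z = {0}" using Z_props(3) by (metis subset_singletonD)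
  then show False using diameter_pos by simp
qed

sublocale H: homogeneous_measure "lebesgue_prod nx ny" V n
  by (rule homogeneous_lebesgue_prod[OF n_pos])

lemma dist_Z: "z \<in> Z \<Longrightarrow> w \<in> Z \<Longrightarrow> norm (z - w) \<le> diameter Z"
  using diameter_bounded_bound[OF compact_imp_bounded[OF Z_props(1)], of z w] by (simp add: dist_norm)

lemma in_U: "z \<in> Z \<Longrightarrow> e \<in> V \<Longrightarrow> norm e \<le> 1 \<Longrightarrow> \<bar>c\<bar> = \<tau> \<Longrightarrow> z + c *\<^sub>R e \<in> U"
  using neighbourhood[of z e] neighbourhood[of z "- e"] subspace_neg[OF H.subspace_V, of e]
  by (auto simp: abs_if split: if_splits)

lemma Z_U: "z \<in> Z \<Longrightarrow> z \<in> U"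
  using in_U[of z 0 \<tau>] subspace_0[OF H.subspace_V] \<tau>_pos by simp

lemma openin_U: "openin (top_of_set V) U"
  using UX(1) UY(1) by (rule openin_Times)

lemma convex_U: "convex U"
  using UX(2) UY(2) by (rule convex_Times)

text \<open>With \<open>lipschitz_shift\<close> this prepares the sphere estimates for the rescaled
  map \<open>w \<mapsto> F (z + c *\<^sub>R w)\<close>, whose Lipschitz constant is
  \<open>M * \<tau>\<close>.\<close>

lemma openin_shift:
  assumes "z \<in> Z"
  shows "openin (top_of_set V) {w \<in> V. z + c *\<^sub>R w \<in> U}"
proof -
  have "{w \<in> V. z + c *\<^sub>R w \<in> U} = V \<inter> (\<lambda>w. z + c *\<^sub>R w) -` U" by auto
  moreover have "openin (top_of_set V) (V \<inter> (\<lambda>w. z + c *\<^sub>R w) -` U)"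
    using assms Z_V
    by (intro continuous_openin_preimage[OF _ _ openin_U] continuous_intros)
      (auto intro!: subspace_add[OF H.subspace_V] subspace_scale[OF H.subspace_V] simp del: mem_Times_iff)
  ultimately show ?thesis by simp
qed

lemma lipschitz_shift:
  assumes "M-lipschitz_on U F" "z \<in> Z" "\<bar>c\<bar> = \<tau>"
  shows "(M * \<tau>)-lipschitz_on {w \<in> V. z + c *\<^sub>R w \<in> U} (\<lambda>w. F (z + c *\<^sub>R w))"
proof (rule lipschitz_onI)
  fix w w' assume w: "w \<in> {w \<in> V. z + c *\<^sub>R w \<in> U}" "w' \<in> {w \<in> V. z + c *\<^sub>R w \<in> U}"
  have "dist (F (z + c *\<^sub>R w)) (F (z + c *\<^sub>R w')) \<le> M * dist (z + c *\<^sub>R w) (z + c *\<^sub>R w')"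
    using w by (intro lipschitz_onD[OF assms(1)]) auto
  also have "dist (z + c *\<^sub>R w) (z + c *\<^sub>R w') = \<tau> * dist w w'"
    using assms(3) by (simp add: dist_norm scaleR_diff_right[symmetric])
  finally show "dist (F (z + c *\<^sub>R w)) (F (z + c *\<^sub>R w')) \<le> M * \<tau> * dist w w'" by simp
qed (use pos \<tau>_pos in auto)

abbreviation "sphere_V \<equiv> {e \<in> V. norm e = 1}"

lemma unif_sphere_eq: "unif_sphere nx ny = restrict_space H.sphere_law sphere_V"
  by (simp add: unif_sphere_def H.sphere_law_def)

lemma sphere_V_sets: "sphere_V \<in> sets borel"
proof -
  have "sphere_V = V \<inter> {e. norm e = 1}" by auto
  moreover have "{e :: fseq \<times> fseq. norm e = 1} \<in> sets borel" by measurable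
  ultimately show ?thesis by simp
qed

lemma sets_unif_sphere [measurable_cong]: "sets (unif_sphere nx ny) = sets (restrict_space borel sphere_V)"
  unfolding unif_sphere_eq by (intro sets_restrict_space_cong) simp

lemma space_unif_sphere: "space (unif_sphere nx ny) = sphere_V"
  by (simp add: unif_sphere_eq space_restrict_space)

lemma prob_space_unif_sphere: "prob_space (unif_sphere nx ny)"
proof -
  have "AE e in H.sphere_law. e \<in> sphere_V" using H.AE_sphere_law by eventually_elim auto
  then have "emeasure H.sphere_law sphere_V = 1"
    using sphere_V_sets by (simp add: H.S.emeasure_eq_1_AE)
  then show ?thesis
    unfolding unif_sphere_eq using sphere_V_sets by (intro prob_space_restrict_space) auto
qed

abbreviation "\<nu> \<equiv> unif_sphere nx ny"

sublocale unif: prob_space \<nu>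
  by (rule prob_space_unif_sphere)

lemma measurable_direction: "(\<lambda>e. e) \<in> borel_measurable \<nu>"
  by (auto intro!: measurable_restrict_space1 simp: measurable_cong_sets[OF sets_unif_sphere refl])

lemma measurable_Z_ident: "(\<lambda>z. z) \<in> restrict_space borel Z \<rightarrow>\<^sub>M borel"
  by (simp add: measurable_restrict_space1)

text \<open>Here \<open>g\<close> need be meaningful on the sphere only, while \<open>f\<close> is a
  Borel function on the ambient space agreeing with it there; the sphere estimates are stated for
  the latter.\<close>

lemma integral_unif_sphere:
  fixes f g :: "fseq \<times> fseq \<Rightarrow> real"
  assumes f: "f \<in> borel_measurable borel" "g \<in> borel_measurable \<nu>"
    and eq: "\<And>e. e \<in> sphere_V \<Longrightarrow> f e = g e"
  shows "(\<integral>e. g e \<partial>\<nu>) = (\<integral>e. f e \<partial>H.sphere_law)"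
proof -
  have "(\<integral>e. g e \<partial>\<nu>) = (\<integral>e. f e \<partial>\<nu>)"
    by (intro Bochner_Integration.integral_cong) (simp_all add: space_unif_sphere eq)
  also have "\<dots> = (\<integral>e. indicator sphere_V e *\<^sub>R f e \<partial>H.sphere_law)"
    unfolding unif_sphere_eq using sphere_V_sets by (intro integral_restrict_space) simp
  also have "\<dots> = (\<integral>e. f e \<partial>H.sphere_law)"
  proof (rule integral_cong_AE)
    show "AE e in H.sphere_law. indicator sphere_V e *\<^sub>R f e = f e"
      using H.AE_sphere_law by eventually_elim simp
  qed (use f sphere_V_sets in auto)
  finally show ?thesis .
qed

lemma measurable_query:
  assumes "\<bar>c\<bar> = \<tau>"
  shows "(\<lambda>(z, e). z + c *\<^sub>R e) \<in> restrict_space borel Z \<Otimes>\<^sub>M \<nu> \<rightarrow>\<^sub>M restrict_space borel U"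
proof (rule measurable_restrict_space2)
  have [measurable]: "(\<lambda>p. fst p) \<in> restrict_space borel Z \<Otimes>\<^sub>M \<nu> \<rightarrow>\<^sub>M borel"
    "(\<lambda>p. snd p) \<in> restrict_space borel Z \<Otimes>\<^sub>M \<nu> \<rightarrow>\<^sub>M borel"
    by (rule measurable_compose[OF measurable_fst measurable_Z_ident] measurable_compose[OF measurable_snd measurable_direction])+
  show "(\<lambda>(z, e). z + c *\<^sub>R e) \<in> borel_measurable (restrict_space borel Z \<Otimes>\<^sub>M \<nu>)"
    unfolding split_beta by measurable
  show "(\<lambda>(z, e). z + c *\<^sub>R e) \<in> space (restrict_space borel Z \<Otimes>\<^sub>M \<nu>) \<rightarrow> U"
    using in_U[OF _ _ _ assms] by (auto simp: space_pair_measure space_restrict_space space_unif_sphere simp del: mem_Times_iff)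
qed

lemma measurable_query':
  assumes "z \<in> Z" "\<bar>c\<bar> = \<tau>"
  shows "(\<lambda>e. z + c *\<^sub>R e) \<in> \<nu> \<rightarrow>\<^sub>M restrict_space borel U"
proof -
  have "z \<in> space (restrict_space borel Z)" using assms by (simp add: space_restrict_space)
  from measurable_compose[OF measurable_Pair1'[OF this] measurable_query[OF assms(2)]]
  show ?thesis by simp
qed

lemma \<phi>_measurable: "\<phi> \<in> borel_measurable (restrict_space borel U)"
  by (rule borel_measurable_continuous_on_restrict[OF lipschitz_on_continuous_on[OF lipschitz]])

lemma lip: "p \<in> U \<Longrightarrow> q \<in> U \<Longrightarrow> \<bar>\<phi> p - \<phi> q\<bar> \<le> M * norm (p - q)"
  using lipschitz_onD[OF lipschitz, of p q] by (simp add: dist_norm)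

text \<open>Treating both signs \<open>s\<close> makes reflection invariance of the sphere law unnecessary for the
  central difference.\<close>

lemma directional_bound:
  assumes z: "z \<in> Z" "z' \<in> Z" and F: "M-lipschitz_on U F" and s: "\<bar>s\<bar> = 1"
    and conv: "\<And>p h. p \<in> V \<Longrightarrow> norm p \<le> 1 \<Longrightarrow> 0 < h \<Longrightarrow> h < 1 \<Longrightarrow>
      F (z + (s * \<tau>) *\<^sub>R p - h *\<^sub>R (z - z')) \<le>
        (1 - h) * F (z + (s * \<tau>) *\<^sub>R p) + h * F (z' + (s * \<tau>) *\<^sub>R p) - h * (1 - h) * c"
  shows "F z - F z' + c - 2 * M * \<tau> \<le>
    real n * (\<integral>e. F (z + (s * \<tau>) *\<^sub>R e) * (e \<bullet> ((s / \<tau>) *\<^sub>R (z - z'))) \<partial>\<nu>)"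
proof -
  let ?W = "{w \<in> V. z + (s * \<tau>) *\<^sub>R w \<in> U}" and ?\<Phi> = "\<lambda>w. F (z + (s * \<tau>) *\<^sub>R w)"
  \<comment> \<open>Scaled so that \<open>(s * \<tau>) *\<^sub>R ?d = z - z'\<close>: a shift by
    \<open>?d\<close> of the unit variable moves the query from around \<open>z\<close> to around
    \<open>z'\<close>.\<close>
  let ?d = "(s / \<tau>) *\<^sub>R (z - z')"
  have st: "\<bar>s * \<tau>\<bar> = \<tau>" using s \<tau>_pos by (simp add: abs_mult)
  have ss: "s * s = 1" using s by (metis abs_mult_self_eq mult_1)
  have dV: "?d \<in> V" using z Z_V by (intro subspace_scale[OF H.subspace_V] subspace_diff[OF H.subspace_V]) auto
  have sd: "(s * \<tau>) *\<^sub>R ?d = z - z'" using ss \<tau>_pos by simp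
  have W1: "p \<in> ?W" if "p \<in> V" "norm p \<le> 1" for p using in_U[OF z(1) that st] that by simp
  have \<Phi>_shift: "z + (s * \<tau>) *\<^sub>R (p - h *\<^sub>R ?d) = z + (s * \<tau>) *\<^sub>R p - h *\<^sub>R (z - z')" for p h
  proof -
    have "(s * \<tau>) *\<^sub>R (h *\<^sub>R ?d) = h *\<^sub>R ((s * \<tau>) *\<^sub>R ?d)" by (simp only: scaleR_left_commute)
    then show ?thesis unfolding scaleR_diff_right[of "s * \<tau>"] sd by (simp add: algebra_simps)
  qed
  have main: "?\<Phi> 0 - ?\<Phi> (- ?d) + c - 2 * (M * \<tau>) \<le>
    real n * (\<integral>e. (indicator ?W e * ?\<Phi> e) * (e \<bullet> ?d) \<partial>H.sphere_law)"
  proof (rule H.sphere_gradient_bound[OF openin_shift[OF z(1)] lipschitz_shift[OF F z(1) st] _ dV])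
    show "V \<inter> cball 0 1 \<subseteq> ?W" using W1 by auto
  next
    fix p and h :: real assume p: "p \<in> V" "norm p \<le> 1" and h: "0 \<le> h" "h \<le> 1"
    have "z + (s * \<tau>) *\<^sub>R (p - h *\<^sub>R ?d) = (1 - h) *\<^sub>R (z + (s * \<tau>) *\<^sub>R p) + h *\<^sub>R (z' + (s * \<tau>) *\<^sub>R p)"
      unfolding \<Phi>_shift by (simp add: algebra_simps)
    also have "\<dots> \<in> U"
      using in_U[OF z(1) p st] in_U[OF z(2) p st] h by (intro convexD[OF convex_U]) auto
    finally have "z + (s * \<tau>) *\<^sub>R (p - h *\<^sub>R ?d) \<in> U" .
    moreover have "p - h *\<^sub>R ?d \<in> V"
      by (rule subspace_diff[OF H.subspace_V p(1) subspace_scale[OF H.subspace_V dV]])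
    ultimately show "p - h *\<^sub>R ?d \<in> ?W" by blast
  next
    fix p and h :: real assume p: "p \<in> V" "norm p \<le> 1" and h: "0 < h" "h < 1"
    have "z + (s * \<tau>) *\<^sub>R (p - ?d) = z' + (s * \<tau>) *\<^sub>R p"
      using \<Phi>_shift[of p 1] by simp
    then show "?\<Phi> (p - h *\<^sub>R ?d) \<le> (1 - h) * ?\<Phi> p + h * ?\<Phi> (p - ?d) - h * (1 - h) * c"
      unfolding \<Phi>_shift using conv[OF p h] by simp
  qed
  have e1: "z + (s * \<tau>) *\<^sub>R (- ?d) = z'" using \<Phi>_shift[of 0 1] by simp
  have e2: "(\<integral>e. F (z + (s * \<tau>) *\<^sub>R e) * (e \<bullet> ?d) \<partial>\<nu>) =
    (\<integral>e. (indicator ?W e * ?\<Phi> e) * (e \<bullet> ?d) \<partial>H.sphere_law)"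
  proof (rule integral_unif_sphere)
    have "(\<lambda>w. indicator ?W w *\<^sub>R ?\<Phi> w) \<in> borel_measurable borel"
      by (rule borel_measurable_continuous_on_indicator[OF H.borel_openin_V[OF openin_shift[OF z(1)]]
        lipschitz_on_continuous_on[OF lipschitz_shift[OF F z(1) st]]])
    then have [measurable]: "(\<lambda>w. indicator ?W w * ?\<Phi> w) \<in> borel_measurable borel" by simp
    show "(\<lambda>e. (indicator ?W e * ?\<Phi> e) * (e \<bullet> ?d)) \<in> borel_measurable borel"
      by measurable
    have [measurable]: "F \<in> borel_measurable (restrict_space borel U)"
      by (rule borel_measurable_continuous_on_restrict[OF lipschitz_on_continuous_on[OF F]])
    have [measurable]: "(\<lambda>e. z + (s * \<tau>) *\<^sub>R e) \<in> \<nu> \<rightarrow>\<^sub>M restrict_space borel U"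
      by (rule measurable_query'[OF z(1) st])
    note [measurable] = measurable_direction
    show "(\<lambda>e. F (z + (s * \<tau>) *\<^sub>R e) * (e \<bullet> ?d)) \<in> borel_measurable \<nu>"
      by measurable
  qed (use W1 in auto)
  show ?thesis using main unfolding e1 e2 by (simp only: scaleR_zero_right add_0_right mult.assoc)
qed

abbreviation "\<phi>diff z e \<equiv> \<phi> (z + \<tau> *\<^sub>R e) - \<phi> (z - \<tau> *\<^sub>R e)"
abbreviation "\<delta>diff z e \<equiv> \<delta> (z + \<tau> *\<^sub>R e) - \<delta> (z - \<tau> *\<^sub>R e)"

lemma query_bound:
  assumes "z \<in> Z" "e \<in> sphere_V" "\<bar>c\<bar> = \<tau>"
  shows "\<bar>\<phi> (z + c *\<^sub>R e)\<bar> \<le> \<bar>\<phi> z\<bar> + M * \<tau>"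
  using lip[OF in_U[of z e c] Z_U[of z]] assms by simp

lemma query_integrable:
  assumes z: "z \<in> Z" and c: "\<bar>c\<bar> = \<tau>"
  shows "integrable \<nu> (\<lambda>e. \<phi> (z + c *\<^sub>R e) * (e \<bullet> v))"
proof (rule unif.integrable_const_bound[where B="(\<bar>\<phi> z\<bar> + M * \<tau>) * norm v"])
  have [measurable]: "(\<lambda>e. \<phi> (z + c *\<^sub>R e)) \<in> borel_measurable \<nu>"
    by (rule measurable_compose[OF measurable_query'[OF z c] \<phi>_measurable])
  note [measurable] = measurable_direction
  show "(\<lambda>e. \<phi> (z + c *\<^sub>R e) * (e \<bullet> v)) \<in> borel_measurable \<nu>" by measurable
  show "AE e in \<nu>. norm (\<phi> (z + c *\<^sub>R e) * (e \<bullet> v)) \<le> (\<bar>\<phi> z\<bar> + M * \<tau>) * norm v"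
  proof (rule AE_I2)
    fix e assume "e \<in> space \<nu>"
    then have e: "e \<in> sphere_V" by (simp add: space_unif_sphere)
    have "\<bar>e \<bullet> v\<bar> \<le> norm v" using Cauchy_Schwarz_ineq2[of e v] e by simp
    then show "norm (\<phi> (z + c *\<^sub>R e) * (e \<bullet> v)) \<le> (\<bar>\<phi> z\<bar> + M * \<tau>) * norm v"
      unfolding real_norm_def abs_mult using query_bound[OF z e c]
      by (intro mult_mono) auto
  qed
qed

text \<open>At \<open>u = (xs, ys)\<close> this is the error whose expectation the theorem
  bounds.\<close>

definition gap :: "fseq \<times> fseq \<Rightarrow> fseq \<times> fseq \<Rightarrow> real"
  where "gap z u = \<phi> (fst z, snd u) - \<phi> (fst u, snd z)"

text \<open>Separate convexity allows moving one block at a time, from \<open>z\<close> to the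
  corners \<open>(fst u, snd z)\<close> and \<open>(fst z, snd u)\<close>; the two increments add up
  to the gap because \<open>\<phi> z\<close> cancels, and the sign flip in the second block matches
  concavity. Two blocks and two signs give four bounds, each losing \<open>2 * M * \<tau>\<close>;
  the central difference halves their sum, hence \<open>4 * M * \<tau>\<close>.\<close>

lemma sphere_correlation:
  assumes z: "z \<in> Z" and u: "u \<in> Z"
  shows "gap z u + \<mu> / 2 * (norm (z - u))\<^sup>2 - 4 * M * \<tau> \<le>
    (\<integral>e. (real n * (\<phi>diff z e) / (2 * \<tau>)) * ((fst e, - snd e) \<bullet> (z - u)) \<partial>\<nu>)"
proof -
  let ?x = "(fst u, snd z)" and ?y = "(fst z, snd u)"
  have xy: "?x \<in> Z" "?y \<in> Z" using z u by auto
  define A where "A = (\<lambda>s. \<integral>e. \<phi> (z + (s * \<tau>) *\<^sub>R e) * (e \<bullet> ((s / \<tau>) *\<^sub>R (z - ?x))) \<partial>\<nu>)"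
  define B where "B = (\<lambda>s. \<integral>e. \<phi> (z + (s * \<tau>) *\<^sub>R e) * (e \<bullet> ((s / \<tau>) *\<^sub>R (z - ?y))) \<partial>\<nu>)"
  have A: "\<phi> z - \<phi> ?x + \<mu> / 2 * (norm (fst z - fst u))\<^sup>2 - 2 * M * \<tau> \<le> real n * A s" if s: "\<bar>s\<bar> = 1" for s
    unfolding A_def
  proof (rule directional_bound[OF z xy(1) lipschitz s])
    fix p and h :: real assume p: "p \<in> V" "norm p \<le> 1" and h: "0 < h" "h < 1"
    have st: "\<bar>s * \<tau>\<bar> = \<tau>" using s \<tau>_pos by (simp add: abs_mult)
    obtain a b where ab: "z + (s * \<tau>) *\<^sub>R p = (a, b)" by (cases "z + (s * \<tau>) *\<^sub>R p")
    have ab': "?x + (s * \<tau>) *\<^sub>R p = (a - (fst z - fst u), b)"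
      using ab by (auto simp: prod_eq_iff algebra_simps)
    have mem: "a \<in> UX" "b \<in> UY" "a - (fst z - fst u) \<in> UX"
      using in_U[OF z p st] in_U[OF xy(1) p st] unfolding ab ab' by auto
    have seg: "(1 - h) *\<^sub>R a + h *\<^sub>R (a - (fst z - fst u)) = a - h *\<^sub>R (fst z - fst u)"
      by (simp add: algebra_simps)
    have "strongly_convex_on nx \<mu> UX (\<lambda>x. \<phi> (x, b))" using scsc mem by (simp add: scsc_on_def)
    from strongly_convex_on_segment[OF this UX(2) mem(1,3), of h]
    have "\<phi> (a - h *\<^sub>R (fst z - fst u), b) \<le> (1 - h) * \<phi> (a, b) + h * \<phi> (a - (fst z - fst u), b) -
      h * (1 - h) * (\<mu> / 2 * (norm (fst z - fst u))\<^sup>2)"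
      using h by (simp add: seg)
    moreover have "(a, b) - h *\<^sub>R (z - ?x) = (a - h *\<^sub>R (fst z - fst u), b)" by (simp add: prod_eq_iff)
    ultimately show "\<phi> (z + (s * \<tau>) *\<^sub>R p - h *\<^sub>R (z - ?x)) \<le> (1 - h) * \<phi> (z + (s * \<tau>) *\<^sub>R p) +
      h * \<phi> (?x + (s * \<tau>) *\<^sub>R p) - h * (1 - h) * (\<mu> / 2 * (norm (fst z - fst u))\<^sup>2)"
      unfolding ab ab' by simp
  qed
  have B: "- \<phi> z + \<phi> ?y + \<mu> / 2 * (norm (snd z - snd u))\<^sup>2 - 2 * M * \<tau> \<le> - (real n * B s)" if s: "\<bar>s\<bar> = 1" for s
  proof -
    have "- \<phi> z - - \<phi> ?y + \<mu> / 2 * (norm (snd z - snd u))\<^sup>2 - 2 * M * \<tau> \<le>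
      real n * (\<integral>e. - \<phi> (z + (s * \<tau>) *\<^sub>R e) * (e \<bullet> ((s / \<tau>) *\<^sub>R (z - ?y))) \<partial>\<nu>)"
    proof (rule directional_bound[OF z xy(2) _ s])
      show "M-lipschitz_on U (\<lambda>z. - \<phi> z)" using lipschitz by (rule lipschitz_on_minus)
      fix p and h :: real assume p: "p \<in> V" "norm p \<le> 1" and h: "0 < h" "h < 1"
      have st: "\<bar>s * \<tau>\<bar> = \<tau>" using s \<tau>_pos by (simp add: abs_mult)
      obtain a b where ab: "z + (s * \<tau>) *\<^sub>R p = (a, b)" by (cases "z + (s * \<tau>) *\<^sub>R p")
      have ab': "?y + (s * \<tau>) *\<^sub>R p = (a, b - (snd z - snd u))"
        using ab by (auto simp: prod_eq_iff algebra_simps)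
      have mem: "a \<in> UX" "b \<in> UY" "b - (snd z - snd u) \<in> UY"
        using in_U[OF z p st] in_U[OF xy(2) p st] unfolding ab ab' by auto
      have seg: "(1 - h) *\<^sub>R b + h *\<^sub>R (b - (snd z - snd u)) = b - h *\<^sub>R (snd z - snd u)"
        by (simp add: algebra_simps)
      have "strongly_convex_on ny \<mu> UY (\<lambda>y. - \<phi> (a, y))"
        using scsc mem by (simp add: scsc_on_def strongly_concave_on_def)
      from strongly_convex_on_segment[OF this UY(2) mem(2,3), of h]
      have "- \<phi> (a, b - h *\<^sub>R (snd z - snd u)) \<le> (1 - h) * - \<phi> (a, b) + h * - \<phi> (a, b - (snd z - snd u)) -
        h * (1 - h) * (\<mu> / 2 * (norm (snd z - snd u))\<^sup>2)"
        using h by (simp add: seg)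
      moreover have "(a, b) - h *\<^sub>R (z - ?y) = (a, b - h *\<^sub>R (snd z - snd u))" by (simp add: prod_eq_iff)
      ultimately show "- \<phi> (z + (s * \<tau>) *\<^sub>R p - h *\<^sub>R (z - ?y)) \<le> (1 - h) * - \<phi> (z + (s * \<tau>) *\<^sub>R p) +
        h * - \<phi> (?y + (s * \<tau>) *\<^sub>R p) - h * (1 - h) * (\<mu> / 2 * (norm (snd z - snd u))\<^sup>2)"
        unfolding ab ab' by simp
    qed
    then show ?thesis by (simp add: B_def)
  qed
  have i1: "integrable \<nu> (\<lambda>e. \<phi> (z + (1 * \<tau>) *\<^sub>R e) * (e \<bullet> v))"
    and i2: "integrable \<nu> (\<lambda>e. \<phi> (z + (- 1 * \<tau>) *\<^sub>R e) * (e \<bullet> v))" for v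
    by (rule query_integrable[OF z], use \<tau>_pos in simp)+
  have "(\<integral>e. (real n * (\<phi>diff z e) / (2 * \<tau>)) * ((fst e, - snd e) \<bullet> (z - u)) \<partial>\<nu>) =
    (\<integral>e. (real n / 2) * (\<phi> (z + (1 * \<tau>) *\<^sub>R e) * (e \<bullet> ((1 / \<tau>) *\<^sub>R (z - ?x))) - \<phi> (z + (1 * \<tau>) *\<^sub>R e) * (e \<bullet> ((1 / \<tau>) *\<^sub>R (z - ?y)))
      + \<phi> (z + (- 1 * \<tau>) *\<^sub>R e) * (e \<bullet> ((- 1 / \<tau>) *\<^sub>R (z - ?x))) - \<phi> (z + (- 1 * \<tau>) *\<^sub>R e) * (e \<bullet> ((- 1 / \<tau>) *\<^sub>R (z - ?y)))) \<partial>\<nu>)"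
  proof (rule Bochner_Integration.integral_cong[OF refl])
    fix e :: "fseq \<times> fseq"
    obtain ex ey where e: "e = (ex, ey)" by (cases e)
    obtain zx zy where z: "z = (zx, zy)" by (cases z)
    obtain ux uy where u: "u = (ux, uy)" by (cases u)
    show "(real n * (\<phi>diff z e) / (2 * \<tau>)) * ((fst e, - snd e) \<bullet> (z - u)) =
      (real n / 2) * (\<phi> (z + (1 * \<tau>) *\<^sub>R e) * (e \<bullet> ((1 / \<tau>) *\<^sub>R (z - ?x))) - \<phi> (z + (1 * \<tau>) *\<^sub>R e) * (e \<bullet> ((1 / \<tau>) *\<^sub>R (z - ?y)))
      + \<phi> (z + (- 1 * \<tau>) *\<^sub>R e) * (e \<bullet> ((- 1 / \<tau>) *\<^sub>R (z - ?x))) - \<phi> (z + (- 1 * \<tau>) *\<^sub>R e) * (e \<bullet> ((- 1 / \<tau>) *\<^sub>R (z - ?y))))"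
      using \<tau>_pos by (simp add: e z u inner_diff_right divide_simps) (simp add: algebra_simps)
  qed
  also have "\<dots> = (real n / 2) * (A 1 - B 1 + A (- 1) - B (- 1))"
    unfolding A_def B_def integral_mult_right_zero
      Bochner_Integration.integral_diff[OF Bochner_Integration.integrable_add[OF Bochner_Integration.integrable_diff[OF i1 i1] i2] i2]
      Bochner_Integration.integral_add[OF Bochner_Integration.integrable_diff[OF i1 i1] i2]
      Bochner_Integration.integral_diff[OF i1 i1] ..
  also have "\<dots> = (real n * A 1 - real n * B 1 + real n * A (- 1) - real n * B (- 1)) / 2"
    by (simp add: field_simps)
  finally have eq: "(\<integral>e. (real n * (\<phi>diff z e) / (2 * \<tau>)) * ((fst e, - snd e) \<bullet> (z - u)) \<partial>\<nu>) =
    (real n * A 1 - real n * B 1 + real n * A (- 1) - real n * B (- 1)) / 2" .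
  have "(norm (z - u))\<^sup>2 = (norm (fst z - fst u))\<^sup>2 + (norm (snd z - snd u))\<^sup>2"
    by (cases z; cases u) (simp add: norm_Pair)
  then have norm_eq: "\<mu> / 2 * (norm (z - u))\<^sup>2 = \<mu> / 2 * (norm (fst z - fst u))\<^sup>2 + \<mu> / 2 * (norm (snd z - snd u))\<^sup>2"
    by (simp only: distrib_left)
  show ?thesis
    unfolding eq gap_def norm_eq using A[of 1] A[of "- 1"] B[of 1] B[of "- 1"] by simp
qed

text \<open>Poincare for the rescaled map, whose gradient is \<open>\<tau> *\<^sub>R g\<close>. The
  Lipschitz bound alone would give \<open>(2 * M * \<tau>)\<^sup>2\<close>, without the gain of
  order \<open>1 / n\<close>.\<close>

lemma sphere_difference_second_moment:
  assumes z: "z \<in> Z"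
  shows "(\<integral>e. (\<phi>diff z e)\<^sup>2 \<partial>\<nu>) \<le> 4 * pi\<^sup>2 * (M * \<tau>)\<^sup>2 / real n"
proof -
  let ?W = "{w \<in> V. z + \<tau> *\<^sub>R w \<in> U}" and ?\<Phi> = "\<lambda>w. \<phi> (z + \<tau> *\<^sub>R w)"
  have t: "\<bar>\<tau>\<bar> = \<tau>" "\<bar>- \<tau>\<bar> = \<tau>" using \<tau>_pos by auto
  have W1: "p \<in> ?W" if "p \<in> V" "norm p \<le> 1" for p using in_U[OF z that t(1)] that by simp
  have bound: "(\<integral>\<^sup>+e. ennreal ((indicator ?W e * ?\<Phi> e - indicator ?W (- e) * ?\<Phi> (- e))\<^sup>2) \<partial>H.sphere_law) \<le>
    ennreal (4 * pi\<^sup>2 * (M * \<tau>)\<^sup>2 / real n)"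
  proof (rule H.sphere_poincare_nn[OF openin_shift[OF z] lipschitz_shift[OF lipschitz z t(1)]])
    show "V \<inter> cball 0 1 \<subseteq> ?W" using W1 by auto
    fix p assume p: "p \<in> V" "norm p = 1"
    obtain g where g: "g \<in> V" "norm g \<le> M"
      "\<And>v. v \<in> V \<Longrightarrow> ((\<lambda>h. (\<phi> (z + \<tau> *\<^sub>R p + h *\<^sub>R v) - \<phi> (z + \<tau> *\<^sub>R p)) / h) \<longlongrightarrow> g \<bullet> v) (at_right 0)"
      using scsc_on_gateaux[OF UX UY scsc _ lipschitz in_U[OF z p(1) _ t(1)]] pos p(2) by fastforce
    show "\<exists>g\<in>V. norm g \<le> M * \<tau> \<and> (\<forall>v\<in>V. ((\<lambda>h. (?\<Phi> (p + h *\<^sub>R v) - ?\<Phi> p) / h) \<longlongrightarrow> g \<bullet> v) (at_right 0))"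
    proof (intro bexI[of _ "\<tau> *\<^sub>R g"] conjI ballI)
      show "norm (\<tau> *\<^sub>R g) \<le> M * \<tau>" using g(2) \<tau>_pos by (simp add: mult.commute)
      show "\<tau> *\<^sub>R g \<in> V" using g(1) by (rule subspace_scale[OF H.subspace_V])
      fix v assume "v \<in> V"
      then have "\<tau> *\<^sub>R v \<in> V" by (rule subspace_scale[OF H.subspace_V])
      from g(3)[OF this] show "((\<lambda>h. (?\<Phi> (p + h *\<^sub>R v) - ?\<Phi> p) / h) \<longlongrightarrow> \<tau> *\<^sub>R g \<bullet> v) (at_right 0)"
        by (simp add: algebra_simps)
    qed
  qed
  have [measurable]: "(\<lambda>e. \<phi> (z + \<tau> *\<^sub>R e)) \<in> borel_measurable \<nu>"
    by (rule measurable_compose[OF measurable_query'[OF z t(1)] \<phi>_measurable])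
  have [measurable]: "(\<lambda>e. \<phi> (z - \<tau> *\<^sub>R e)) \<in> borel_measurable \<nu>"
    using measurable_compose[OF measurable_query'[OF z t(2)] \<phi>_measurable] by simp
  have int: "integrable \<nu> (\<lambda>e. (\<phi>diff z e)\<^sup>2)"
  proof (rule unif.integrable_const_bound[where B="(2 * (\<bar>\<phi> z\<bar> + M * \<tau>))\<^sup>2"])
    show "AE e in \<nu>. norm ((\<phi>diff z e)\<^sup>2) \<le> (2 * (\<bar>\<phi> z\<bar> + M * \<tau>))\<^sup>2"
    proof (rule AE_I2)
      fix e assume "e \<in> space \<nu>"
      then have e: "e \<in> sphere_V" by (simp add: space_unif_sphere)
      have "\<bar>\<phi>diff z e\<bar> \<le> 2 * (\<bar>\<phi> z\<bar> + M * \<tau>)"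
        using query_bound[OF z e t(1)] query_bound[OF z e t(2)] by simp
      then have "\<bar>\<phi>diff z e\<bar>\<^sup>2 \<le> (2 * (\<bar>\<phi> z\<bar> + M * \<tau>))\<^sup>2"
        by (intro power_mono) auto
      then show "norm ((\<phi>diff z e)\<^sup>2) \<le> (2 * (\<bar>\<phi> z\<bar> + M * \<tau>))\<^sup>2" by simp
    qed
  qed measurable
  have "ennreal (\<integral>e. (\<phi>diff z e)\<^sup>2 \<partial>\<nu>) =
    (\<integral>\<^sup>+e. ennreal ((\<phi>diff z e)\<^sup>2) \<partial>\<nu>)"
    by (rule nn_integral_eq_integral[symmetric, OF int]) simp
  also have "\<dots> = (\<integral>\<^sup>+e. ennreal ((indicator ?W e * ?\<Phi> e - indicator ?W (- e) * ?\<Phi> (- e))\<^sup>2) \<partial>\<nu>)"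
  proof (rule nn_integral_cong)
    fix e assume "e \<in> space \<nu>"
    then have e: "e \<in> V" "norm e = 1" by (auto simp: space_unif_sphere)
    then have "e \<in> ?W" "- e \<in> ?W" using W1[of e] W1[of "- e"] subspace_neg[OF H.subspace_V e(1)] by auto
    then show "ennreal ((\<phi>diff z e)\<^sup>2) =
      ennreal ((indicator ?W e * ?\<Phi> e - indicator ?W (- e) * ?\<Phi> (- e))\<^sup>2)" by (simp del: mem_Times_iff)
  qed
  also have "\<dots> \<le> (\<integral>\<^sup>+e. ennreal ((indicator ?W e * ?\<Phi> e - indicator ?W (- e) * ?\<Phi> (- e))\<^sup>2) \<partial>H.sphere_law)"
    unfolding unif_sphere_eq
    by (subst nn_integral_restrict_space)
      (auto simp: sphere_V_sets simp del: mem_Times_iff intro!: nn_integral_mono split: split_indicator)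
  also note bound
  finally show ?thesis using n_pos by (simp add: ennreal_le_iff)
qed

end

section \<open>Moments of a single gradient estimate at a fixed point\<close>

context noisy_saddle_algorithm
begin

abbreviation "query_law k \<equiv> \<nu> \<Otimes>\<^sub>M (Dp k \<Otimes>\<^sub>M Dm k)"
abbreviation "ZQ k \<equiv> restrict_space borel Z \<Otimes>\<^sub>M query_law k"

definition grad :: "fseq \<times> fseq \<Rightarrow> (fseq \<times> fseq) \<times> real \<times> real \<Rightarrow> fseq \<times> fseq"
  where "grad z a = grad_est n \<phi> \<delta> \<tau> z (fst a) (fst (snd a)) (snd (snd a))"

definition est :: "fseq \<times> fseq \<Rightarrow> (fseq \<times> fseq) \<times> real \<times> real \<Rightarrow> real"
  where "est z a = real n / (2 * \<tau>) * ((\<phi>diff z (fst a)) + (fst (snd a) - snd (snd a))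
    + (\<delta>diff z (fst a)))"

lemma grad_eq: "grad z a = est z a *\<^sub>R (fst (fst a), - snd (fst a))"
proof -
  have "noisy_value \<phi> \<delta> (z + \<tau> *\<^sub>R fst a) (fst (snd a)) - noisy_value \<phi> \<delta> (z - \<tau> *\<^sub>R fst a) (snd (snd a)) =
    (\<phi>diff z (fst a)) + (fst (snd a) - snd (snd a))
    + (\<delta>diff z (fst a))"
    by (simp add: noisy_value_def)
  then show ?thesis
    by (simp only: grad_def grad_est_def est_def times_divide_eq_left)
qed

lemma noise_D:
  shows "prob_space (Dp k)" "prob_space (Dm k)"
    and sets_D [measurable_cong]: "sets (Dp k) = sets borel" "sets (Dm k) = sets borel"
    and "integrable (Dp k) (\<lambda>\<xi>. \<xi>)" "integrable (Dm k) (\<lambda>\<xi>. \<xi>)"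
    and "(\<integral>\<xi>. \<xi> \<partial>Dp k) = 0" "(\<integral>\<xi>. \<xi> \<partial>Dm k) = 0"
    and "integrable (Dp k) (\<lambda>\<xi>. \<xi>\<^sup>2)" "integrable (Dm k) (\<lambda>\<xi>. \<xi>\<^sup>2)"
    and "(\<integral>\<xi>. \<xi>\<^sup>2 \<partial>Dp k) \<le> \<sigma>\<^sup>2" "(\<integral>\<xi>. \<xi>\<^sup>2 \<partial>Dm k) \<le> \<sigma>\<^sup>2"
  using noise[of k] by (auto simp: noise_law_def)

lemma prob_space_noise: "prob_space (Dp k \<Otimes>\<^sub>M Dm k)"
proof -
  interpret D1: prob_space "Dp k" by (rule noise_D)
  interpret D2: prob_space "Dm k" by (rule noise_D)
  interpret N: pair_prob_space "Dp k" "Dm k" ..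
  show ?thesis by (rule N.P.prob_space_axioms)
qed

lemma prob_space_query_law: "prob_space (query_law k)"
proof -
  interpret N: prob_space "Dp k \<Otimes>\<^sub>M Dm k" by (rule prob_space_noise)
  interpret Q: pair_prob_space "\<nu>" "Dp k \<Otimes>\<^sub>M Dm k" ..
  show ?thesis by (rule Q.P.prob_space_axioms)
qed

lemma measurable_noise [measurable]:
  "(\<lambda>\<xi>. fst \<xi>) \<in> borel_measurable (Dp k \<Otimes>\<^sub>M Dm k)" "(\<lambda>\<xi>. snd \<xi>) \<in> borel_measurable (Dp k \<Otimes>\<^sub>M Dm k)"
  "(\<lambda>a. fst (snd a)) \<in> borel_measurable (query_law k)" "(\<lambda>a. snd (snd a)) \<in> borel_measurable (query_law k)"
  by measurable

lemma measurable_flip: "(\<lambda>e. (fst e, - snd e)) \<in> borel_measurable (borel :: (fseq \<times> fseq) measure)"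
  by (intro borel_measurable_continuous_onI continuous_intros)

lemma measurable_value:
  assumes "\<bar>c\<bar> = \<tau>"
  shows "(\<lambda>p. \<phi> (fst p + c *\<^sub>R fst (snd p))) \<in> borel_measurable (ZQ k)"
    and "(\<lambda>p. \<delta> (fst p + c *\<^sub>R fst (snd p))) \<in> borel_measurable (ZQ k)"
proof -
  have "(\<lambda>p. (fst p, fst (snd p))) \<in> ZQ k \<rightarrow>\<^sub>M restrict_space borel Z \<Otimes>\<^sub>M \<nu>"
    by measurable
  from measurable_compose[OF this measurable_query[OF assms]]
  have q: "(\<lambda>p. fst p + c *\<^sub>R fst (snd p)) \<in> ZQ k \<rightarrow>\<^sub>M restrict_space borel U"
    by simp
  show "(\<lambda>p. \<phi> (fst p + c *\<^sub>R fst (snd p))) \<in> borel_measurable (ZQ k)"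
    by (rule measurable_compose[OF q \<phi>_measurable])
  show "(\<lambda>p. \<delta> (fst p + c *\<^sub>R fst (snd p))) \<in> borel_measurable (ZQ k)"
    by (rule measurable_compose[OF q \<delta>_measurable])
qed

lemma measurable_est: "(\<lambda>p. est (fst p) (snd p)) \<in> borel_measurable (ZQ k)"
proof -
  have t: "\<bar>\<tau>\<bar> = \<tau>" "\<bar>- \<tau>\<bar> = \<tau>" using \<tau>_pos by auto
  note [measurable] = measurable_value[OF t(1), of k] measurable_value[OF t(2), of k, simplified]
  show ?thesis unfolding est_def by measurable
qed

lemma measurable_grad: "(\<lambda>p. grad (fst p) (snd p)) \<in> borel_measurable (ZQ k)"
proof -
  have "(\<lambda>p. fst (snd p)) \<in> ZQ k \<rightarrow>\<^sub>M \<nu>" by measurable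
  from measurable_compose[OF measurable_compose[OF this measurable_direction] measurable_flip]
  have [measurable]: "(\<lambda>p. (fst (fst (snd p)), - snd (fst (snd p)))) \<in> borel_measurable (ZQ k)" .
  note [measurable] = measurable_est[of k]
  show ?thesis unfolding grad_eq by measurable
qed

lemma measurable_grad':
  assumes "z \<in> Z"
  shows "grad z \<in> borel_measurable (query_law k)"
proof -
  have "z \<in> space (restrict_space borel Z)" using assms by (simp add: space_restrict_space)
  from measurable_compose[OF measurable_Pair1'[OF this] measurable_grad] show ?thesis by simp
qed

lemma distr_query_law:
  shows "distr (query_law k) \<nu> fst = \<nu>"
    and "distr (query_law k) (Dp k) (\<lambda>a. fst (snd a)) = Dp k"
    and "distr (query_law k) (Dm k) (\<lambda>a. snd (snd a)) = Dm k"
proof -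
  interpret D1: prob_space "Dp k" by (rule noise_D)
  interpret D2: prob_space "Dm k" by (rule noise_D)
  interpret N: pair_prob_space "Dp k" "Dm k" ..
  interpret Q: pair_prob_space "\<nu>" "Dp k \<Otimes>\<^sub>M Dm k" ..
  show "distr (query_law k) \<nu> fst = \<nu>"
    by (rule N.distr_pair_fst)
  have snd: "distr (query_law k) (Dp k \<Otimes>\<^sub>M Dm k) snd = Dp k \<Otimes>\<^sub>M Dm k"
  proof (rule measure_eqI)
    fix A assume "A \<in> sets (distr (query_law k) (Dp k \<Otimes>\<^sub>M Dm k) snd)"
    then have A: "A \<in> sets (Dp k \<Otimes>\<^sub>M Dm k)" by simp
    have "snd -` A \<inter> space (query_law k) = space \<nu> \<times> A"
      using sets.sets_into_space[OF A] by (auto simp: space_pair_measure)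
    then show "emeasure (distr (query_law k) (Dp k \<Otimes>\<^sub>M Dm k) snd) A = emeasure (Dp k \<Otimes>\<^sub>M Dm k) A"
      using A by (simp add: emeasure_distr N.emeasure_pair_measure_Times unif.emeasure_space_1)
  qed simp
  have "distr (Dp k \<Otimes>\<^sub>M Dm k) (Dm k) snd = Dm k"
  proof (rule measure_eqI)
    fix A assume "A \<in> sets (distr (Dp k \<Otimes>\<^sub>M Dm k) (Dm k) snd)"
    then have A: "A \<in> sets (Dm k)" by simp
    have "snd -` A \<inter> space (Dp k \<Otimes>\<^sub>M Dm k) = space (Dp k) \<times> A"
      using sets.sets_into_space[OF A] by (auto simp: space_pair_measure)
    then show "emeasure (distr (Dp k \<Otimes>\<^sub>M Dm k) (Dm k) snd) A = emeasure (Dm k) A"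
      using A by (simp add: emeasure_distr D2.emeasure_pair_measure_Times D1.emeasure_space_1)
  qed simp
  moreover have "distr (query_law k) (Dm k) (\<lambda>a. snd (snd a)) = distr (distr (query_law k) (Dp k \<Otimes>\<^sub>M Dm k) snd) (Dm k) snd"
    by (subst distr_distr) (auto simp: comp_def)
  ultimately show "distr (query_law k) (Dm k) (\<lambda>a. snd (snd a)) = Dm k" by (simp add: snd)
  have "distr (Dp k \<Otimes>\<^sub>M Dm k) (Dp k) fst = Dp k" by (rule D2.distr_pair_fst)
  moreover have "distr (query_law k) (Dp k) (\<lambda>a. fst (snd a)) = distr (distr (query_law k) (Dp k \<Otimes>\<^sub>M Dm k) snd) (Dp k) fst"
    by (subst distr_distr) (auto simp: comp_def)
  ultimately show "distr (query_law k) (Dp k) (\<lambda>a. fst (snd a)) = Dp k" by (simp add: snd)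
qed

lemma direction_moment:
  fixes f :: "fseq \<times> fseq \<Rightarrow> real"
  assumes "integrable \<nu> f"
  shows "integrable (query_law k) (\<lambda>a. f (fst a))" "(\<integral>a. f (fst a) \<partial>query_law k) = (\<integral>e. f e \<partial>\<nu>)"
proof -
  have f: "f \<in> borel_measurable \<nu>" using assms by auto
  show "integrable (query_law k) (\<lambda>a. f (fst a))"
    using assms integrable_distr_eq[of fst "query_law k" "\<nu>" f] f by (simp add: distr_query_law)
  show "(\<integral>a. f (fst a) \<partial>query_law k) = (\<integral>e. f e \<partial>\<nu>)"
    using integral_distr[of fst "query_law k" "\<nu>" f] f by (simp add: distr_query_law)
qed

lemma noise_moment:
  fixes f :: "real \<Rightarrow> real"
  assumes [measurable]: "f \<in> borel_measurable borel"
  shows "integrable (Dp k) f \<Longrightarrow> integrable (query_law k) (\<lambda>a. f (fst (snd a)))"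
    and "integrable (Dm k) f \<Longrightarrow> integrable (query_law k) (\<lambda>a. f (snd (snd a)))"
    and "(\<integral>a. f (fst (snd a)) \<partial>query_law k) = (\<integral>\<xi>. f \<xi> \<partial>Dp k)"
    and "(\<integral>a. f (snd (snd a)) \<partial>query_law k) = (\<integral>\<xi>. f \<xi> \<partial>Dm k)"
proof -
  have 1: "(\<lambda>a. fst (snd a)) \<in> query_law k \<rightarrow>\<^sub>M Dp k" "(\<lambda>a. snd (snd a)) \<in> query_law k \<rightarrow>\<^sub>M Dm k" by measurable
  have 2: "f \<in> borel_measurable (Dp k)" "f \<in> borel_measurable (Dm k)" by measurable
  show "integrable (query_law k) (\<lambda>a. f (fst (snd a)))" if "integrable (Dp k) f"
    using integrable_distr_eq[OF 1(1) 2(1)] that by (simp add: distr_query_law)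
  show "integrable (query_law k) (\<lambda>a. f (snd (snd a)))" if "integrable (Dm k) f"
    using integrable_distr_eq[OF 1(2) 2(2)] that by (simp add: distr_query_law)
  show "(\<integral>a. f (fst (snd a)) \<partial>query_law k) = (\<integral>\<xi>. f \<xi> \<partial>Dp k)"
    using integral_distr[OF 1(1) 2(1)] by (simp add: distr_query_law)
  show "(\<integral>a. f (snd (snd a)) \<partial>query_law k) = (\<integral>\<xi>. f \<xi> \<partial>Dm k)"
    using integral_distr[OF 1(2) 2(2)] by (simp add: distr_query_law)
qed

text \<open>The factor 3 is the cost of squaring a sum of value, noise and error differences. Their
  mean squares are at most \<open>4 * pi\<^sup>2 * (M * \<tau>)\<^sup>2 / real n\<close>,
  \<open>4 * \<sigma>\<^sup>2\<close> and \<open>4 * \<Delta>\<^sup>2\<close>, and each is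
  multiplied by \<open>(real n / (2 * \<tau>))\<^sup>2\<close>.\<close>

definition second_moment :: real
  where "second_moment = 3 * (pi\<^sup>2 * real n * M\<^sup>2 + (real n)\<^sup>2 * \<sigma>\<^sup>2 / \<tau>\<^sup>2 + (real n)\<^sup>2 * \<Delta>\<^sup>2 / \<tau>\<^sup>2)"

lemma norm_flip: "norm (fst e, - snd e) = norm e"
  by (cases e) (simp add: norm_Pair)

lemma value_facts:
  assumes z: "z \<in> Z"
  shows "(\<lambda>e. \<phi> (z + \<tau> *\<^sub>R e)) \<in> borel_measurable \<nu>"
    and "(\<lambda>e. \<phi> (z - \<tau> *\<^sub>R e)) \<in> borel_measurable \<nu>"
    and "(\<lambda>e. \<delta> (z + \<tau> *\<^sub>R e)) \<in> borel_measurable \<nu>"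
    and "(\<lambda>e. \<delta> (z - \<tau> *\<^sub>R e)) \<in> borel_measurable \<nu>"
    and "e \<in> sphere_V \<Longrightarrow> \<bar>\<phi>diff z e\<bar> \<le> 2 * M * \<tau>"
    and "e \<in> sphere_V \<Longrightarrow> \<bar>\<delta>diff z e\<bar> \<le> 2 * \<Delta>"
proof -
  have t: "\<bar>\<tau>\<bar> = \<tau>" "\<bar>- \<tau>\<bar> = \<tau>" using \<tau>_pos by auto
  note q = measurable_query'[OF z t(1)] measurable_query'[OF z t(2), simplified]
  show "(\<lambda>e. \<phi> (z + \<tau> *\<^sub>R e)) \<in> borel_measurable \<nu>"
    "(\<lambda>e. \<phi> (z - \<tau> *\<^sub>R e)) \<in> borel_measurable \<nu>"
    "(\<lambda>e. \<delta> (z + \<tau> *\<^sub>R e)) \<in> borel_measurable \<nu>"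
    "(\<lambda>e. \<delta> (z - \<tau> *\<^sub>R e)) \<in> borel_measurable \<nu>"
    using measurable_compose[OF q(1)] measurable_compose[OF q(2)] \<phi>_measurable \<delta>_measurable by blast+
  assume e: "e \<in> sphere_V"
  then have U: "z + \<tau> *\<^sub>R e \<in> U" "z - \<tau> *\<^sub>R e \<in> U"
    using in_U[OF z, of e \<tau>] in_U[OF z, of e "- \<tau>"] t by (simp_all del: mem_Times_iff)
  have "z + \<tau> *\<^sub>R e - (z - \<tau> *\<^sub>R e) = (2 * \<tau>) *\<^sub>R e" by (simp add: scaleR_2[symmetric])
  then have "norm (z + \<tau> *\<^sub>R e - (z - \<tau> *\<^sub>R e)) = 2 * \<tau>" using e \<tau>_pos by simp
  then show "\<bar>\<phi>diff z e\<bar> \<le> 2 * M * \<tau>" using lip[OF U] by simp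
  show "\<bar>\<delta>diff z e\<bar> \<le> 2 * \<Delta>"
    using \<delta>_bound[OF U(1)] \<delta>_bound[OF U(2)] by linarith
qed

text \<open>The estimate splits into three parts. The value part \<open>f1\<close> is covered by
  \<open>sphere_correlation\<close>; the noise part \<open>f2\<close> has mean 0, because the noises
  are centred and independent of the direction; the error part \<open>f3\<close> is bounded
  pointwise.\<close>

lemma grad_first_moment:
  assumes z: "z \<in> Z" and u: "u \<in> Z"
  shows "integrable (query_law k) (\<lambda>a. grad z a \<bullet> (z - u))"
    and "gap z u + \<mu> / 2 * (norm (z - u))\<^sup>2 - (4 * M * \<tau> + real n * \<Delta> * diameter Z / \<tau>) \<le>
      (\<integral>a. grad z a \<bullet> (z - u) \<partial>query_law k)"
proof -
  note [measurable] = value_facts(1-4)[OF z]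
  have [measurable]: "(\<lambda>e. (fst e, - snd e)) \<in> borel_measurable \<nu>"
    by (rule measurable_compose[OF measurable_direction measurable_flip])
  define h where "h = (\<lambda>e. (fst e, - snd e) \<bullet> (z - u))"
  have [measurable]: "h \<in> borel_measurable \<nu>" unfolding h_def by measurable
  have h_le: "\<bar>h e\<bar> \<le> diameter Z" if "e \<in> sphere_V" for e
    using Cauchy_Schwarz_ineq2[of "(fst e, - snd e)" "z - u"] that dist_Z[OF z u] unfolding h_def norm_flip by simp
  have D0: "0 \<le> diameter Z" using diameter_pos by simp
  define f1 where "f1 = (\<lambda>e. (real n * (\<phi>diff z e) / (2 * \<tau>)) * h e)"
  define f2 where "f2 = (\<lambda>a. (real n / (2 * \<tau>)) * (h (fst a) * (fst (snd a) - snd (snd a))))"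
  define f3 where "f3 = (\<lambda>e. (real n / (2 * \<tau>)) * ((\<delta>diff z e) * h e))"
  have c0: "0 \<le> real n / (2 * \<tau>)" using \<tau>_pos by simp
  have i1: "integrable \<nu> f1"
  proof (rule unif.integrable_const_bound[where B="(real n / (2 * \<tau>)) * (2 * M * \<tau> * diameter Z)"])
    show "AE e in \<nu>. norm (f1 e) \<le> (real n / (2 * \<tau>)) * (2 * M * \<tau> * diameter Z)"
    proof (rule AE_I2)
      fix e assume "e \<in> space \<nu>"
      then have e: "e \<in> sphere_V" by (simp add: space_unif_sphere)
      have "\<bar>\<phi>diff z e\<bar> * \<bar>h e\<bar> \<le> (2 * M * \<tau>) * diameter Z"
        using value_facts(5)[OF z e] h_le[OF e] pos \<tau>_pos by (intro mult_mono) auto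
      from mult_left_mono[OF this c0]
      show "norm (f1 e) \<le> (real n / (2 * \<tau>)) * (2 * M * \<tau> * diameter Z)"
        using \<tau>_pos by (simp add: f1_def abs_mult)
    qed
  qed (simp add: f1_def)
  have f3_le: "\<bar>f3 e\<bar> \<le> real n * \<Delta> * diameter Z / \<tau>" if e: "e \<in> sphere_V" for e
  proof -
    have "\<bar>\<delta>diff z e\<bar> * \<bar>h e\<bar> \<le> (2 * \<Delta>) * diameter Z"
      using value_facts(6)[OF z e] h_le[OF e] pos by (intro mult_mono) auto
    from mult_left_mono[OF this c0]
    show ?thesis using \<tau>_pos by (simp add: f3_def abs_mult)
  qed
  have i3: "integrable \<nu> f3"
    by (rule unif.integrable_const_bound[where B="real n * \<Delta> * diameter Z / \<tau>"])
      (use f3_le in \<open>auto simp: space_unif_sphere f3_def intro!: AE_I2\<close>)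
  have [measurable]: "f2 \<in> borel_measurable (query_law k)" unfolding f2_def by measurable
  have i2: "integrable (query_law k) f2"
  proof (rule Bochner_Integration.integrable_bound)
    show "integrable (query_law k) (\<lambda>a. (real n / (2 * \<tau>)) * (diameter Z * (\<bar>fst (snd a)\<bar> + \<bar>snd (snd a)\<bar>)))"
      by (intro integrable_mult_right Bochner_Integration.integrable_add
        noise_moment(1)[OF _ integrable_abs[OF noise_D(5)]] noise_moment(2)[OF _ integrable_abs[OF noise_D(6)]]) measurable
    show "AE a in query_law k. norm (f2 a) \<le> norm ((real n / (2 * \<tau>)) * (diameter Z * (\<bar>fst (snd a)\<bar> + \<bar>snd (snd a)\<bar>)))"
    proof (rule AE_I2)
      fix a assume "a \<in> space (query_law k)"
      then have e: "fst a \<in> sphere_V" by (auto simp: space_pair_measure space_unif_sphere)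
      have "\<bar>h (fst a)\<bar> * \<bar>fst (snd a) - snd (snd a)\<bar> \<le> diameter Z * (\<bar>fst (snd a)\<bar> + \<bar>snd (snd a)\<bar>)"
        using h_le[OF e] D0 by (intro mult_mono) auto
      from mult_left_mono[OF this c0]
      show "norm (f2 a) \<le> norm ((real n / (2 * \<tau>)) * (diameter Z * (\<bar>fst (snd a)\<bar> + \<bar>snd (snd a)\<bar>)))"
        using \<tau>_pos D0 by (simp add: f2_def abs_mult)
    qed
  qed measurable
  have grad_sum: "grad z a \<bullet> (z - u) = f1 (fst a) + f2 a + f3 (fst a)" for a
  proof -
    have "grad z a \<bullet> (z - u) = est z a * h (fst a)"
      by (simp only: grad_eq inner_scaleR_left h_def)
    then show ?thesis unfolding est_def f1_def f2_def f3_def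
      by (simp only: distrib_left distrib_right mult_ac times_divide_eq_left times_divide_eq_right add_divide_distrib)
  qed
  show "integrable (query_law k) (\<lambda>a. grad z a \<bullet> (z - u))"
    unfolding grad_sum using direction_moment(1)[OF i1] direction_moment(1)[OF i3] i2 by auto
  have "(\<integral>a. f2 a \<partial>query_law k) = 0"
  proof -
    interpret N: prob_space "Dp k \<Otimes>\<^sub>M Dm k" by (rule prob_space_noise)
    interpret Q: pair_prob_space "\<nu>" "Dp k \<Otimes>\<^sub>M Dm k" ..
    have "(\<integral>a. f2 a \<partial>query_law k) = (\<integral>e. (\<integral>\<xi>. f2 (e, \<xi>) \<partial>(Dp k \<Otimes>\<^sub>M Dm k)) \<partial>\<nu>)"
      by (rule Q.integral_fst'[OF i2, symmetric])
    also have "\<dots> = (\<integral>e. 0 \<partial>\<nu>)"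
    proof (rule Bochner_Integration.integral_cong[OF refl])
      fix e
      interpret D1: prob_space "Dp k" by (rule noise_D)
      interpret D2: prob_space "Dm k" by (rule noise_D)
      interpret N': pair_prob_space "Dp k" "Dm k" ..
      have j1: "integrable (Dp k \<Otimes>\<^sub>M Dm k) (\<lambda>\<xi>. fst \<xi>)"
        by (rule N'.Fubini_integrable) (use noise_D(5)[of k] in auto)
      have j2: "integrable (Dp k \<Otimes>\<^sub>M Dm k) (\<lambda>\<xi>. snd \<xi>)"
        by (rule N'.Fubini_integrable) (use noise_D(6)[of k] in auto)
      have "(\<integral>\<xi>. fst \<xi> \<partial>(Dp k \<Otimes>\<^sub>M Dm k)) = 0" "(\<integral>\<xi>. snd \<xi> \<partial>(Dp k \<Otimes>\<^sub>M Dm k)) = 0"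
        using N'.integral_fst'[OF j1] N'.integral_fst'[OF j2] noise_D(7,8)[of k] by auto
      then show "(\<integral>\<xi>. f2 (e, \<xi>) \<partial>(Dp k \<Otimes>\<^sub>M Dm k)) = 0"
        using j1 j2 by (simp add: f2_def)
    qed
    finally show ?thesis by simp
  qed
  then have eq: "(\<integral>a. grad z a \<bullet> (z - u) \<partial>query_law k) = (\<integral>e. f1 e \<partial>\<nu>) + (\<integral>e. f3 e \<partial>\<nu>)"
    unfolding grad_sum using direction_moment[OF i1, of k] direction_moment[OF i3, of k] i2 by simp
  have "- (real n * \<Delta> * diameter Z / \<tau>) = (\<integral>e. - (real n * \<Delta> * diameter Z / \<tau>) \<partial>\<nu>)"
    by (simp add: unif.prob_space)
  also have "\<dots> \<le> (\<integral>e. f3 e \<partial>\<nu>)"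
    using f3_le by (intro integral_mono i3) (auto simp: space_unif_sphere abs_le_iff minus_le_iff)
  finally show "gap z u + \<mu> / 2 * (norm (z - u))\<^sup>2 - (4 * M * \<tau> + real n * \<Delta> * diameter Z / \<tau>) \<le>
      (\<integral>a. grad z a \<bullet> (z - u) \<partial>query_law k)"
    using sphere_correlation[OF z u] unfolding eq f1_def h_def by linarith
qed

lemma grad_second_moment:
  assumes z: "z \<in> Z"
  shows "integrable (query_law k) (\<lambda>a. (norm (grad z a))\<^sup>2)"
    and "(\<integral>a. (norm (grad z a))\<^sup>2 \<partial>query_law k) \<le> second_moment"
proof -
  note [measurable] = value_facts(1-4)[OF z] measurable_grad'[OF z]
  interpret Q: prob_space "query_law k" by (rule prob_space_query_law)
  define f1 where "f1 = (\<lambda>e. (\<phi>diff z e)\<^sup>2)"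
  define C where "C = 3 * (real n / (2 * \<tau>))\<^sup>2"
  define b where "b = (\<lambda>a. C * (f1 (fst a) + (2 * (fst (snd a))\<^sup>2 + 2 * (snd (snd a))\<^sup>2) + 4 * \<Delta>\<^sup>2))"
  have C0: "0 \<le> C" by (simp add: C_def)
  have i1: "integrable \<nu> f1"
  proof (rule unif.integrable_const_bound[where B="(2 * M * \<tau>)\<^sup>2"])
    show "AE e in \<nu>. norm (f1 e) \<le> (2 * M * \<tau>)\<^sup>2"
    proof (rule AE_I2)
      fix e assume "e \<in> space \<nu>"
      then have "\<bar>\<phi>diff z e\<bar> \<le> 2 * M * \<tau>"
        using value_facts(5)[OF z] by (simp add: space_unif_sphere)
      then have "\<bar>\<phi>diff z e\<bar>\<^sup>2 \<le> (2 * M * \<tau>)\<^sup>2" by (intro power_mono) auto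
      then show "norm (f1 e) \<le> (2 * M * \<tau>)\<^sup>2" by (simp add: f1_def)
    qed
  qed (simp add: f1_def)
  have ip: "integrable (query_law k) (\<lambda>a. (fst (snd a))\<^sup>2)" and im: "integrable (query_law k) (\<lambda>a. (snd (snd a))\<^sup>2)"
    by (rule noise_moment(1)[OF _ noise_D(9)], measurable) (rule noise_moment(2)[OF _ noise_D(10)], measurable)
  have ib: "integrable (query_law k) b"
    unfolding b_def using direction_moment(1)[OF i1] ip im by (intro integrable_mult_right Bochner_Integration.integrable_add) auto
  have le: "(norm (grad z a))\<^sup>2 \<le> b a" if "a \<in> space (query_law k)" for a
  proof -
    have e: "fst a \<in> sphere_V" using that by (auto simp: space_pair_measure space_unif_sphere)
    let ?x = "\<phi>diff z (fst a)" and ?y = "fst (snd a) - snd (snd a)"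
      and ?w = "\<delta>diff z (fst a)"
    have three: "(x + y + w)\<^sup>2 \<le> 3 * (x\<^sup>2 + y\<^sup>2 + w\<^sup>2)" for x y w :: real
    proof -
      have "3 * (x\<^sup>2 + y\<^sup>2 + w\<^sup>2) - (x + y + w)\<^sup>2 = (x - y)\<^sup>2 + (y - w)\<^sup>2 + (x - w)\<^sup>2"
        by (simp add: power2_eq_square algebra_simps)
      then show ?thesis using zero_le_power2[of "x - y"] zero_le_power2[of "y - w"] zero_le_power2[of "x - w"] by linarith
    qed
    have two: "(x - y)\<^sup>2 \<le> 2 * x\<^sup>2 + 2 * y\<^sup>2" for x y :: real
    proof -
      have "2 * x\<^sup>2 + 2 * y\<^sup>2 - (x - y)\<^sup>2 = (x + y)\<^sup>2" by (simp add: power2_eq_square algebra_simps)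
      then show ?thesis using zero_le_power2[of "x + y"] by linarith
    qed
    have "\<bar>?w\<bar>\<^sup>2 \<le> (2 * \<Delta>)\<^sup>2" using value_facts(6)[OF z e] by (intro power_mono) auto
    then have w: "?w\<^sup>2 \<le> 4 * \<Delta>\<^sup>2" by (simp add: power_mult_distrib)
    have "norm (fst (fst a), - snd (fst a)) = 1" using e norm_flip[of "fst a"] by simp
    then have "(norm (grad z a))\<^sup>2 = (est z a)\<^sup>2" by (simp only: grad_eq norm_scaleR mult_1_right power2_abs)
    also have "\<dots> = (real n / (2 * \<tau>))\<^sup>2 * (?x + ?y + ?w)\<^sup>2" by (simp only: est_def power_mult_distrib)
    also have "\<dots> \<le> (real n / (2 * \<tau>))\<^sup>2 * (3 * (?x\<^sup>2 + ?y\<^sup>2 + ?w\<^sup>2))"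
      by (rule mult_left_mono[OF three]) simp
    also have "\<dots> = C * (?x\<^sup>2 + ?y\<^sup>2 + ?w\<^sup>2)" by (simp only: C_def mult_ac)
    also have "\<dots> \<le> b a"
      unfolding b_def f1_def using two[of "fst (snd a)" "snd (snd a)"] w C0 by (intro mult_left_mono add_mono) auto
    finally show ?thesis .
  qed
  show int: "integrable (query_law k) (\<lambda>a. (norm (grad z a))\<^sup>2)"
  proof (rule Bochner_Integration.integrable_bound[OF ib])
    show "AE a in query_law k. norm ((norm (grad z a))\<^sup>2) \<le> norm (b a)"
      using le by (intro AE_I2) (auto intro: order_trans[OF _ abs_ge_self])
  qed measurable
  have "(\<integral>a. (norm (grad z a))\<^sup>2 \<partial>query_law k) \<le> (\<integral>a. b a \<partial>query_law k)"
    by (rule integral_mono[OF int ib le])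
  also have "\<dots> = C * ((\<integral>e. f1 e \<partial>\<nu>) + (2 * (\<integral>\<xi>. \<xi>\<^sup>2 \<partial>Dp k) + 2 * (\<integral>\<xi>. \<xi>\<^sup>2 \<partial>Dm k)) + 4 * \<Delta>\<^sup>2)"
    unfolding b_def using direction_moment[OF i1, of k] ip im noise_moment(3)[of "\<lambda>\<xi>. \<xi>\<^sup>2" k] noise_moment(4)[of "\<lambda>\<xi>. \<xi>\<^sup>2" k]
    by (simp add: Q.prob_space)
  also have "\<dots> \<le> C * (4 * pi\<^sup>2 * (M * \<tau>)\<^sup>2 / real n + (2 * \<sigma>\<^sup>2 + 2 * \<sigma>\<^sup>2) + 4 * \<Delta>\<^sup>2)"
    using sphere_difference_second_moment[OF z] noise_D(11,12)[of k] C0 unfolding f1_def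
    by (intro mult_left_mono add_mono) auto
  also have "\<dots> = second_moment"
  proof -
    define m where "m = real n"
    have "0 < m" using n_pos unfolding m_def by (simp only: of_nat_0_less_iff)
    then show ?thesis unfolding C_def second_moment_def m_def[symmetric] using \<tau>_pos
      by (simp add: power2_eq_square field_simps)
  qed
  finally show "(\<integral>a. (norm (grad z a))\<^sup>2 \<partial>query_law k) \<le> second_moment" .
qed

end

subsection \<open>Stochastic descent\<close>

context noisy_saddle_algorithm
begin

abbreviation "P \<equiv> sample_space nx ny Dp Dm"
abbreviation "iter \<equiv> iterate Z n \<mu> \<phi> \<delta> \<tau> z0"

definition step :: "nat \<Rightarrow> real"
  where "step k = 1 / (\<mu> * (real k + 1))"

lemma step_pos: "0 < step k"
  using pos by (simp add: step_def add_nonneg_pos)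

lemma iterate_Suc: "iter \<omega> (Suc k) = proj Z (iter \<omega> k - step k *\<^sub>R grad (iter \<omega> k) (\<omega> k))"
  by (simp add: grad_def step_def Let_def split_beta)

lemma iterate_in: "iter \<omega> k \<in> Z"
proof (cases k)
  case 0
  then show ?thesis using z0 by (simp del: mem_Times_iff)
next
  case (Suc j)
  show ?thesis unfolding Suc iterate_Suc by (rule proj_in[OF Z_props])
qed

lemma iterate_fresh: "j \<le> k \<Longrightarrow> iter (\<lambda>i. if i = k then x else f i) j = iter f j"
proof (induction j)
  case (Suc j)
  then show ?case unfolding iterate_Suc by simp
qed simp

sublocale P: prob_space P
  unfolding sample_space_def by (rule prob_space_PiM) (rule prob_space_query_law)

lemma measurable_sample: "(\<lambda>\<omega>. \<omega> k) \<in> P \<rightarrow>\<^sub>M query_law k"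
  unfolding sample_space_def by (rule measurable_component_singleton) simp

lemma measurable_iterate: "(\<lambda>\<omega>. iter \<omega> k) \<in> P \<rightarrow>\<^sub>M restrict_space borel Z"
proof (induction k)
  case 0
  then show ?case using z0 by (simp add: space_restrict_space del: mem_Times_iff)
next
  case (Suc k)
  have id: "(\<lambda>z. z) \<in> restrict_space borel Z \<rightarrow>\<^sub>M borel" by (simp add: measurable_restrict_space1)
  have [measurable]: "(\<lambda>\<omega>. iter \<omega> k) \<in> borel_measurable P"
    using measurable_compose[OF Suc measurable_Z_ident] .
  have "(\<lambda>\<omega>. (iter \<omega> k, \<omega> k)) \<in> P \<rightarrow>\<^sub>M ZQ k"
    by (intro measurable_Pair Suc measurable_sample)
  from measurable_compose[OF this measurable_grad]
  have [measurable]: "(\<lambda>\<omega>. grad (iter \<omega> k) (\<omega> k)) \<in> borel_measurable P" by simp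
  have "(\<lambda>\<omega>. iter \<omega> k - step k *\<^sub>R grad (iter \<omega> k) (\<omega> k)) \<in> borel_measurable P"
    by measurable
  from measurable_compose[OF this measurable_proj[OF Z_props]]
  show ?case unfolding iterate_Suc .
qed

lemma distr_iterate_sample:
  "distr P (ZQ k) (\<lambda>\<omega>. (iter \<omega> k, \<omega> k)) =
    distr P (restrict_space borel Z) (\<lambda>\<omega>. iter \<omega> k) \<Otimes>\<^sub>M query_law k"
  unfolding sample_space_def
proof (rule distr_PiM_fresh_component)
  show "(\<lambda>\<omega>. iter \<omega> k) \<in> Pi\<^sub>M UNIV query_law \<rightarrow>\<^sub>M restrict_space borel Z"
    using measurable_iterate[of k] by (simp add: sample_space_def)
  show "iter (f(k := x)) k = iter f k" for f x
    using iterate_fresh[of k k x f] by (simp add: fun_upd_def)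
qed (rule prob_space_query_law)

text \<open>Replaces conditioning on the past: iterate \<open>k\<close> does not read sample
  \<open>k\<close>, so the two are independent and the fresh sample can be integrated first with the
  iterate frozen. The uniform bound \<open>C\<close> yields joint integrability for Fubini.\<close>

lemma integral_fresh_sample:
  fixes F :: "fseq \<times> fseq \<Rightarrow> (fseq \<times> fseq) \<times> real \<times> real \<Rightarrow> real"
  assumes F: "(\<lambda>p. F (fst p) (snd p)) \<in> borel_measurable (ZQ k)"
    and int: "\<And>z. z \<in> Z \<Longrightarrow> integrable (query_law k) (F z)"
    and bound: "\<And>z. z \<in> Z \<Longrightarrow> (\<integral>a. \<bar>F z a\<bar> \<partial>query_law k) \<le> C"
  shows "integrable P (\<lambda>\<omega>. F (iter \<omega> k) (\<omega> k))"
    and "integrable P (\<lambda>\<omega>. \<integral>a. F (iter \<omega> k) a \<partial>query_law k)"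
    and "(\<integral>\<omega>. F (iter \<omega> k) (\<omega> k) \<partial>P) = (\<integral>\<omega>. (\<integral>a. F (iter \<omega> k) a \<partial>query_law k) \<partial>P)"
proof -
  let ?Q = "query_law k" and ?D = "distr P (restrict_space borel Z) (\<lambda>\<omega>. iter \<omega> k)"
  interpret Q: prob_space ?Q by (rule prob_space_query_law)
  interpret D: prob_space ?D by (rule P.prob_space_distr[OF measurable_iterate])
  interpret DQ: pair_prob_space ?D ?Q ..
  have F' [measurable]: "(\<lambda>p. F (fst p) (snd p)) \<in> borel_measurable (?D \<Otimes>\<^sub>M ?Q)"
    using F by (simp cong: measurable_cong_sets)
  have m1: "(\<lambda>z. \<integral>a. F z a \<partial>?Q) \<in> borel_measurable (restrict_space borel Z)"
    using Q.borel_measurable_lebesgue_integral[of "\<lambda>z a. F z a" "restrict_space borel Z"] F by (simp add: split_beta)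
  have m2: "(\<lambda>z. \<integral>a. \<bar>F z a\<bar> \<partial>?Q) \<in> borel_measurable (restrict_space borel Z)"
    using Q.borel_measurable_lebesgue_integral[of "\<lambda>z a. \<bar>F z a\<bar>" "restrict_space borel Z"] F by (simp add: split_beta)
  have i0: "integrable (?D \<Otimes>\<^sub>M ?Q) (\<lambda>p. F (fst p) (snd p))"
  proof (rule DQ.Fubini_integrable[OF F'])
    show "integrable ?D (\<lambda>z. \<integral>a. norm (F (fst (z, a)) (snd (z, a))) \<partial>?Q)"
    proof (rule D.integrable_const_bound[where B=C])
      show "AE z in ?D. norm (\<integral>a. norm (F (fst (z, a)) (snd (z, a))) \<partial>?Q) \<le> C"
        using bound by (intro AE_I2) (simp add: space_restrict_space del: mem_Times_iff)
    qed (use m2 in simp)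
    show "AE z in ?D. integrable ?Q (\<lambda>a. F (fst (z, a)) (snd (z, a)))"
      using int by (intro AE_I2) (simp add: space_restrict_space del: mem_Times_iff)
  qed
  have pm: "(\<lambda>\<omega>. (iter \<omega> k, \<omega> k)) \<in> P \<rightarrow>\<^sub>M ZQ k"
    by (intro measurable_Pair measurable_iterate measurable_sample)
  show "integrable P (\<lambda>\<omega>. F (iter \<omega> k) (\<omega> k))"
    using i0 integrable_distr_eq[OF pm F] by (simp add: distr_iterate_sample)
  have i1: "integrable ?D (\<lambda>z. \<integral>a. F z a \<partial>?Q)"
    using DQ.integrable_fst'[OF i0] by simp
  then show "integrable P (\<lambda>\<omega>. \<integral>a. F (iter \<omega> k) a \<partial>?Q)"
    by (simp add: integrable_distr_eq[OF measurable_iterate m1])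
  have "(\<integral>\<omega>. F (iter \<omega> k) (\<omega> k) \<partial>P) = (\<integral>p. F (fst p) (snd p) \<partial>(?D \<Otimes>\<^sub>M ?Q))"
    using integral_distr[OF pm F] by (simp add: distr_iterate_sample)
  also have "\<dots> = (\<integral>z. (\<integral>a. F z a \<partial>?Q) \<partial>?D)"
    using DQ.integral_fst'[OF i0] by simp
  also have "\<dots> = (\<integral>\<omega>. (\<integral>a. F (iter \<omega> k) a \<partial>?Q) \<partial>P)"
    by (rule integral_distr[OF measurable_iterate m1])
  finally show "(\<integral>\<omega>. F (iter \<omega> k) (\<omega> k) \<partial>P) = (\<integral>\<omega>. (\<integral>a. F (iter \<omega> k) a \<partial>?Q) \<partial>P)" .
qed

text \<open>Both arguments of \<open>\<phi>\<close> lie in \<open>Z\<close>. Besides integrability,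
  this settles the final theorem when \<open>\<epsilon>\<close> is at least
  \<open>M * diameter Z\<close>.\<close>

lemma gap_bound:
  assumes "z \<in> Z" "u \<in> Z"
  shows "\<bar>gap z u\<bar> \<le> M * diameter Z"
proof -
  have "\<bar>gap z u\<bar> \<le> M * norm ((fst z, snd u) - (fst u, snd z))"
    unfolding gap_def using assms Z_U[of "(fst z, snd u)"] Z_U[of "(fst u, snd z)"] by (intro lip) auto
  also have "\<dots> \<le> M * diameter Z"
    using assms pos by (intro mult_left_mono dist_Z) auto
  finally show ?thesis .
qed

lemma measurable_gap:
  assumes "u \<in> Z"
  shows "(\<lambda>z. gap z u) \<in> borel_measurable (restrict_space borel Z)"
proof -
  have 1: "(\<lambda>z. (fst z, snd u)) \<in> restrict_space borel Z \<rightarrow>\<^sub>M restrict_space borel U"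
    using assms Z_U
    by (intro measurable_restrict_space2 measurable_restrict_space1 borel_measurable_continuous_onI continuous_intros)
      (auto simp: space_restrict_space)
  have 2: "(\<lambda>z. (fst u, snd z)) \<in> restrict_space borel Z \<rightarrow>\<^sub>M restrict_space borel U"
    using assms Z_U
    by (intro measurable_restrict_space2 measurable_restrict_space1 borel_measurable_continuous_onI continuous_intros)
      (auto simp: space_restrict_space)
  note [measurable] = measurable_compose[OF 1 \<phi>_measurable] measurable_compose[OF 2 \<phi>_measurable]
  show ?thesis unfolding gap_def by measurable
qed

definition bias :: real
  where "bias = 4 * M * \<tau> + real n * \<Delta> * diameter Z / \<tau>"

lemma integrable_gap:
  assumes u: "u \<in> Z" and \<zeta>: "\<zeta> \<in> P \<rightarrow>\<^sub>M restrict_space borel Z" "\<And>\<omega>. \<zeta> \<omega> \<in> Z"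
  shows "integrable P (\<lambda>\<omega>. gap (\<zeta> \<omega>) u)"
  by (rule P.integrable_const_bound[where B="M * diameter Z"])
    (use gap_bound[OF \<zeta>(2) u] measurable_compose[OF \<zeta>(1) measurable_gap[OF u]] in auto)

lemma integrable_dist:
  assumes u: "u \<in> Z"
  shows "integrable P (\<lambda>\<omega>. (norm (iter \<omega> k - u))\<^sup>2)"
proof (rule P.integrable_const_bound[where B="(diameter Z)\<^sup>2"])
  show "AE \<omega> in P. norm ((norm (iter \<omega> k - u))\<^sup>2) \<le> (diameter Z)\<^sup>2"
    using dist_Z[OF iterate_in u] by (intro AE_I2) (auto intro!: power_mono)
  have id: "(\<lambda>z. z) \<in> restrict_space borel Z \<rightarrow>\<^sub>M borel" by (simp add: measurable_restrict_space1)
  have [measurable]: "(\<lambda>\<omega>. iter \<omega> k) \<in> borel_measurable P"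
    using measurable_compose[OF measurable_iterate measurable_Z_ident] .
  show "(\<lambda>\<omega>. (norm (iter \<omega> k - u))\<^sup>2) \<in> borel_measurable P" by measurable
qed

lemma second_moment_nonneg: "0 \<le> second_moment"
  by (simp add: second_moment_def)

text \<open>The projection does not increase the distance to \<open>u\<close>; the square is
  expanded and both moment bounds are inserted. The strong convexity term reduces the weight of the
  old distance from \<open>real k + 1\<close> to \<open>real k\<close>, which is what makes the sum
  over \<open>k\<close> telescope.\<close>

lemma descent:
  assumes u: "u \<in> Z"
  shows "(\<integral>\<omega>. gap (iter \<omega> k) u \<partial>P) \<le> bias +
    \<mu> / 2 * (real k * (\<integral>\<omega>. (norm (iter \<omega> k - u))\<^sup>2 \<partial>P) - (real k + 1) * (\<integral>\<omega>. (norm (iter \<omega> (Suc k) - u))\<^sup>2 \<partial>P)) +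
    second_moment / (2 * \<mu> * (real k + 1))"
proof -
  let ?z = "\<lambda>\<omega>. iter \<omega> k" and ?g = "\<lambda>\<omega>. grad (iter \<omega> k) (\<omega> k)" and ?Q = "query_law k"
  interpret Q: prob_space ?Q by (rule prob_space_query_law)
  define r where "r = (\<lambda>k. \<integral>\<omega>. (norm (iter \<omega> k - u))\<^sup>2 \<partial>P)"
  define q where "q = (\<integral>\<omega>. gap (iter \<omega> k) u \<partial>P)"
  have id: "(\<lambda>z. z) \<in> restrict_space borel Z \<rightarrow>\<^sub>M borel" by (simp add: measurable_restrict_space1)
  have [measurable]: "(\<lambda>p. fst p) \<in> ZQ k \<rightarrow>\<^sub>M borel"
    by (rule measurable_compose[OF measurable_fst measurable_Z_ident])
  note [measurable] = measurable_grad[of k]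
  have F1: "(\<lambda>p. grad (fst p) (snd p) \<bullet> (fst p - u)) \<in> borel_measurable (ZQ k)"
    by measurable
  have F2: "(\<lambda>p. (norm (grad (fst p) (snd p)))\<^sup>2) \<in> borel_measurable (ZQ k)"
    by measurable
  have b1: "(\<integral>a. \<bar>grad z a \<bullet> (z - u)\<bar> \<partial>?Q) \<le> second_moment + (diameter Z)\<^sup>2" if z: "z \<in> Z" for z
  proof -
    have "(\<integral>a. \<bar>grad z a \<bullet> (z - u)\<bar> \<partial>?Q) \<le> (\<integral>a. (norm (grad z a))\<^sup>2 + (diameter Z)\<^sup>2 \<partial>?Q)"
    proof (rule integral_mono)
      show "integrable ?Q (\<lambda>a. \<bar>grad z a \<bullet> (z - u)\<bar>)"
        using grad_first_moment(1)[OF z u] by (rule integrable_abs)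
      show "integrable ?Q (\<lambda>a. (norm (grad z a))\<^sup>2 + (diameter Z)\<^sup>2)"
        using grad_second_moment(1)[OF z] by simp
      fix a
      have "\<bar>grad z a \<bullet> (z - u)\<bar> \<le> norm (grad z a) * norm (z - u)"
        by (rule Cauchy_Schwarz_ineq2)
      also have "\<dots> \<le> norm (grad z a) * diameter Z"
        using dist_Z[OF z u] by (intro mult_left_mono) auto
      also have "\<dots> \<le> (norm (grad z a))\<^sup>2 + (diameter Z)\<^sup>2"
      proof -
        have "0 \<le> (norm (grad z a) - diameter Z)\<^sup>2" by simp
        then have "2 * (norm (grad z a) * diameter Z) \<le> (norm (grad z a))\<^sup>2 + (diameter Z)\<^sup>2"
          by (simp add: power2_diff)
        moreover have "0 \<le> norm (grad z a) * diameter Z" using diameter_pos by simp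
        ultimately show ?thesis by linarith
      qed
      finally show "\<bar>grad z a \<bullet> (z - u)\<bar> \<le> (norm (grad z a))\<^sup>2 + (diameter Z)\<^sup>2" .
    qed
    also have "\<dots> = (\<integral>a. (norm (grad z a))\<^sup>2 \<partial>?Q) + (diameter Z)\<^sup>2"
      using grad_second_moment(1)[OF z] by (simp add: Q.prob_space)
    also have "\<dots> \<le> second_moment + (diameter Z)\<^sup>2" using grad_second_moment(2)[OF z] by simp
    finally show ?thesis .
  qed
  have b2: "(\<integral>a. \<bar>(norm (grad z a))\<^sup>2\<bar> \<partial>?Q) \<le> second_moment" if z: "z \<in> Z" for z
    using grad_second_moment(2)[OF z] by simp
  note A = integral_fresh_sample[of "\<lambda>z a. grad z a \<bullet> (z - u)", OF F1 grad_first_moment(1)[OF _ u] b1]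
  note B = integral_fresh_sample[of "\<lambda>z a. (norm (grad z a))\<^sup>2", OF F2 grad_second_moment(1) b2]
  have ig: "integrable P (\<lambda>\<omega>. gap (?z \<omega>) u)" by (rule integrable_gap[OF u measurable_iterate iterate_in])
  have corr: "q + \<mu> / 2 * r k - bias \<le> (\<integral>\<omega>. ?g \<omega> \<bullet> (?z \<omega> - u) \<partial>P)"
  proof -
    have "q + \<mu> / 2 * r k - bias = (\<integral>\<omega>. gap (?z \<omega>) u + \<mu> / 2 * (norm (?z \<omega> - u))\<^sup>2 - bias \<partial>P)"
      using ig integrable_dist[OF u, of k] by (simp add: q_def r_def P.prob_space)
    also have "\<dots> \<le> (\<integral>\<omega>. (\<integral>a. grad (?z \<omega>) a \<bullet> (?z \<omega> - u) \<partial>?Q) \<partial>P)"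
      using ig integrable_dist[OF u, of k] A(2) grad_first_moment(2)[OF iterate_in u]
      by (intro integral_mono) (auto simp: bias_def)
    finally show ?thesis using A(3) by simp
  qed
  have sec: "(\<integral>\<omega>. (norm (?g \<omega>))\<^sup>2 \<partial>P) \<le> second_moment"
  proof -
    have "(\<integral>\<omega>. (\<integral>a. (norm (grad (?z \<omega>) a))\<^sup>2 \<partial>?Q) \<partial>P) \<le> (\<integral>\<omega>. second_moment \<partial>P)"
      using B(2) grad_second_moment(2)[OF iterate_in] by (intro integral_mono) auto
    then show ?thesis using B(3) by (simp add: P.prob_space)
  qed
  have "r (Suc k) \<le> (\<integral>\<omega>. (norm (?z \<omega> - u))\<^sup>2 - 2 * step k * (?g \<omega> \<bullet> (?z \<omega> - u)) + (step k)\<^sup>2 * (norm (?g \<omega>))\<^sup>2 \<partial>P)"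
    unfolding r_def
  proof (rule integral_mono)
    show "integrable P (\<lambda>\<omega>. (norm (?z \<omega> - u))\<^sup>2 - 2 * step k * (?g \<omega> \<bullet> (?z \<omega> - u)) + (step k)\<^sup>2 * (norm (?g \<omega>))\<^sup>2)"
      using integrable_dist[OF u, of k] A(1) B(1) by simp
    fix \<omega>
    have "norm (iter \<omega> (Suc k) - u) \<le> norm (?z \<omega> - step k *\<^sub>R ?g \<omega> - u)"
      unfolding iterate_Suc by (rule proj_norm_le[OF Z_props u])
    then have "(norm (iter \<omega> (Suc k) - u))\<^sup>2 \<le> (norm (?z \<omega> - step k *\<^sub>R ?g \<omega> - u))\<^sup>2" by (intro power_mono) auto
    also have "?z \<omega> - step k *\<^sub>R ?g \<omega> - u = (?z \<omega> - u) - step k *\<^sub>R ?g \<omega>" by simp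
    also have "(norm ((?z \<omega> - u) - step k *\<^sub>R ?g \<omega>))\<^sup>2 =
      (norm (?z \<omega> - u))\<^sup>2 - 2 * step k * (?g \<omega> \<bullet> (?z \<omega> - u)) + (step k)\<^sup>2 * (norm (?g \<omega>))\<^sup>2"
      unfolding power2_norm_eq_inner inner_diff_left[of "?z \<omega> - u"] inner_diff_right[of _ "?z \<omega> - u"]
      by (simp add: inner_commute[of "?z \<omega> - u" "?g \<omega>"] power2_eq_square)
    finally show "(norm (iter \<omega> (Suc k) - u))\<^sup>2 \<le>
      (norm (?z \<omega> - u))\<^sup>2 - 2 * step k * (?g \<omega> \<bullet> (?z \<omega> - u)) + (step k)\<^sup>2 * (norm (?g \<omega>))\<^sup>2" .
  qed (rule integrable_dist[OF u])
  also have "\<dots> = r k - 2 * step k * (\<integral>\<omega>. ?g \<omega> \<bullet> (?z \<omega> - u) \<partial>P) + (step k)\<^sup>2 * (\<integral>\<omega>. (norm (?g \<omega>))\<^sup>2 \<partial>P)"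
    using integrable_dist[OF u, of k] A(1) B(1) by (simp add: r_def)
  also have "\<dots> \<le> r k - 2 * step k * (q + \<mu> / 2 * r k - bias) + (step k)\<^sup>2 * second_moment"
    using corr sec step_pos[of k] by (intro add_mono diff_mono mult_left_mono) auto
  finally have main: "r (Suc k) \<le> r k - 2 * step k * (q + \<mu> / 2 * r k - bias) + (step k)\<^sup>2 * second_moment" .
  \<comment> \<open>Multiplying by \<open>\<mu> * t / 2\<close>, the inverse of
    \<open>2 * step k\<close>, isolates the expected gap.\<close>
  define t where "t = real k + 1"
  have t: "0 < t" by (simp add: t_def)
  have st: "step k = 1 / (\<mu> * t)" by (simp add: step_def t_def)
  have \<mu>: "0 < \<mu>" by (rule pos)
  have "\<mu> * t / 2 * r (Suc k) \<le> \<mu> * t / 2 * (r k - 2 * step k * (q + \<mu> / 2 * r k - bias) + (step k)\<^sup>2 * second_moment)"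
    using main \<mu> t by (intro mult_left_mono) auto
  also have "\<dots> = \<mu> * t / 2 * r k - (q + \<mu> / 2 * r k - bias) + second_moment / (2 * \<mu> * t)"
    unfolding st using \<mu> t by (simp add: power2_eq_square field_simps)
  finally have "q \<le> bias + \<mu> / 2 * ((t - 1) * r k - t * r (Suc k)) + second_moment / (2 * \<mu> * t)"
    by (simp add: algebra_simps)
  then show ?thesis by (simp add: q_def r_def t_def)
qed

text \<open>Inductively, the new term is absorbed by \<open>ln (1 - x) \<le> - x\<close> at
  \<open>x = 1 / (real N + 2)\<close>.\<close>

lemma harmonic_le: "(\<Sum>k\<le>N. 1 / (real k + 1)) \<le> 1 + ln (real N + 1)"
proof (induction N)
  case (Suc N)
  have "ln (1 - 1 / (real N + 2)) \<le> - (1 / (real N + 2))"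
    using ln_add_one_self_le_self2[of "- (1 / (real N + 2))"] by simp
  moreover have "1 - 1 / (real N + 2) = (real N + 1) / (real N + 2)" by (simp add: field_simps)
  ultimately have "ln (real N + 1) - ln (real N + 2) \<le> - (1 / (real N + 2))"
    by (simp add: ln_div)
  then show ?case using Suc by (simp add: add.commute)
qed simp

section \<open>From single steps to the averaged iterate\<close>

definition avg :: "nat \<Rightarrow> sample \<Rightarrow> fseq \<times> fseq"
  where "avg N \<omega> = avg_iterate Z n \<mu> \<phi> \<delta> \<tau> z0 N \<omega>"

lemma avg_eq: "avg N \<omega> = (\<Sum>k\<le>N. (1 / (real N + 1)) *\<^sub>R iter \<omega> k)"
  by (simp add: avg_def avg_iterate_def scaleR_sum_right)

lemma avg_in: "avg N \<omega> \<in> Z"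
  unfolding avg_eq
  by (intro convex_sum Z_props iterate_in) (auto simp: add_nonneg_pos)

lemma measurable_avg: "avg N \<in> P \<rightarrow>\<^sub>M restrict_space borel Z"
proof (rule measurable_restrict_space2)
  have id: "(\<lambda>z. z) \<in> restrict_space borel Z \<rightarrow>\<^sub>M borel" by (simp add: measurable_restrict_space1)
  have [measurable]: "(\<lambda>\<omega>. iter \<omega> k) \<in> borel_measurable P" for k
    using measurable_compose[OF measurable_iterate measurable_Z_ident] .
  show "avg N \<in> borel_measurable P" unfolding avg_eq by measurable
qed (use avg_in in auto)

text \<open>Jensen in each block: for fixed \<open>u\<close> the gap is a convex function of
  \<open>fst z\<close> plus a convex function of \<open>snd z\<close>.\<close>

lemma gap_avg_le:
  assumes u: "u \<in> Z"
  shows "gap (avg N \<omega>) u \<le> (\<Sum>k\<le>N. (1 / (real N + 1)) * gap (iter \<omega> k) u)"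
proof -
  let ?w = "1 / (real N + 1)"
  have w: "(\<Sum>k\<le>N. ?w) = 1" by simp
  have \<mu>: "0 \<le> \<mu>" using pos by simp
  have UX': "fst z \<in> UX" and UY': "snd z \<in> UY" if "z \<in> Z" for z
    using Z_U[OF that] by auto
  have fst_avg: "fst (avg N \<omega>) = (\<Sum>k\<le>N. ?w *\<^sub>R fst (iter \<omega> k))"
    and snd_avg: "snd (avg N \<omega>) = (\<Sum>k\<le>N. ?w *\<^sub>R snd (iter \<omega> k))"
    by (simp_all add: avg_eq fst_sum snd_sum)
  have cx: "convex_on UX (\<lambda>x. \<phi> (x, snd u))"
    using scsc UY'[OF u] UX \<mu> by (auto simp: scsc_on_def intro: strongly_convex_on_imp_convex_on)
  have cy: "convex_on UY (\<lambda>y. - \<phi> (fst u, y))"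
    using scsc UX'[OF u] UY \<mu> by (auto simp: scsc_on_def strongly_concave_on_def intro: strongly_convex_on_imp_convex_on)
  have "\<phi> (fst (avg N \<omega>), snd u) \<le> (\<Sum>k\<le>N. ?w * \<phi> (fst (iter \<omega> k), snd u))"
    unfolding fst_avg by (rule convex_on_sum[OF _ _ cx w]) (auto intro: UX'[OF iterate_in])
  moreover have "- \<phi> (fst u, snd (avg N \<omega>)) \<le> (\<Sum>k\<le>N. ?w * - \<phi> (fst u, snd (iter \<omega> k)))"
    unfolding snd_avg by (rule convex_on_sum[OF _ _ cy w]) (auto intro: UY'[OF iterate_in])
  ultimately have "gap (avg N \<omega>) u \<le> (\<Sum>k\<le>N. ?w * \<phi> (fst (iter \<omega> k), snd u)) + (\<Sum>k\<le>N. ?w * - \<phi> (fst u, snd (iter \<omega> k)))"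
    unfolding gap_def by linarith
  also have "\<dots> = (\<Sum>k\<le>N. ?w * gap (iter \<omega> k) u)"
    unfolding gap_def sum.distrib[symmetric] by (intro sum.cong refl) (simp add: algebra_simps)
  finally show ?thesis .
qed

lemma expected_gap:
  assumes u: "u \<in> Z"
  shows "integrable P (\<lambda>\<omega>. gap (avg N \<omega>) u)"
    and "(\<integral>\<omega>. gap (avg N \<omega>) u \<partial>P) \<le> bias + second_moment * (1 + ln (real N + 1)) / (2 * \<mu> * (real N + 1))"
proof -
  show i: "integrable P (\<lambda>\<omega>. gap (avg N \<omega>) u)"
    by (rule integrable_gap[OF u measurable_avg avg_in])
  define r where "r = (\<lambda>k. \<integral>\<omega>. (norm (iter \<omega> k - u))\<^sup>2 \<partial>P)"
  have ig: "integrable P (\<lambda>\<omega>. gap (iter \<omega> k) u)" for k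
    by (rule integrable_gap[OF u measurable_iterate iterate_in])
  have \<mu>: "0 < \<mu>" by (rule pos)
  have avg: "(\<integral>\<omega>. gap (avg N \<omega>) u \<partial>P) \<le> (1 / (real N + 1)) * (\<Sum>k\<le>N. \<integral>\<omega>. gap (iter \<omega> k) u \<partial>P)"
  proof -
    have "(\<integral>\<omega>. gap (avg N \<omega>) u \<partial>P) \<le> (\<integral>\<omega>. (\<Sum>k\<le>N. (1 / (real N + 1)) * gap (iter \<omega> k) u) \<partial>P)"
      using i ig gap_avg_le[OF u] by (intro integral_mono) auto
    also have "\<dots> = (1 / (real N + 1)) * (\<Sum>k\<le>N. \<integral>\<omega>. gap (iter \<omega> k) u \<partial>P)"
      using ig by (simp add: sum_divide_distrib)
    finally show ?thesis .
  qed
  have "(\<Sum>k\<le>N. \<integral>\<omega>. gap (iter \<omega> k) u \<partial>P) \<le>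
    (\<Sum>k\<le>N. bias + \<mu> / 2 * (real k * r k - real (Suc k) * r (Suc k)) + second_moment / (2 * \<mu>) * (1 / (real k + 1)))"
    using descent[OF u] by (intro sum_mono) (simp add: r_def add.commute)
  \<comment> \<open>The telescope starts with \<open>0 * r 0\<close>, so the initial distance leaves
    no trace; the last term is nonpositive and is dropped next.\<close>
  also have "\<dots> = (real N + 1) * bias - \<mu> / 2 * (real (Suc N) * r (Suc N)) + second_moment / (2 * \<mu>) * (\<Sum>k\<le>N. 1 / (real k + 1))"
  proof -
    have "(\<Sum>k\<le>N. real k * r k - real (Suc k) * r (Suc k)) = - (real (Suc N) * r (Suc N))"
      by (subst sum_telescope[of "\<lambda>k. real k * r k"]) simp
    then show ?thesis
      by (simp only: sum.distrib sum_distrib_left[symmetric] sum_constant card_atMost) (simp add: algebra_simps)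
  qed
  also have "\<dots> \<le> (real N + 1) * bias - 0 + second_moment / (2 * \<mu>) * (1 + ln (real N + 1))"
    using harmonic_le[of N] \<mu> second_moment_nonneg
    by (intro add_mono diff_mono mult_left_mono mult_nonneg_nonneg) (auto simp: r_def)
  finally have "(1 / (real N + 1)) * (\<Sum>k\<le>N. \<integral>\<omega>. gap (iter \<omega> k) u \<partial>P) \<le>
    (1 / (real N + 1)) * ((real N + 1) * bias - 0 + second_moment / (2 * \<mu>) * (1 + ln (real N + 1)))"
    by (rule mult_left_mono) simp
  also have "\<dots> = bias + second_moment * (1 + ln (real N + 1)) / (2 * \<mu> * (real N + 1))"
  proof -
    have "(1 / t) * (t * bias - 0 + second_moment / (2 * \<mu>) * l) = bias + second_moment * l / (2 * \<mu> * t)" if "0 < t" for t l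
      using that \<mu> by (simp add: field_simps)
    then show ?thesis by simp
  qed
  finally show "(\<integral>\<omega>. gap (avg N \<omega>) u \<partial>P) \<le> bias + second_moment * (1 + ln (real N + 1)) / (2 * \<mu> * (real N + 1))"
    using avg by linarith
qed

end

subsection \<open>The rate\<close>

text \<open>Each of the five contributions to the error is at most \<open>\<epsilon> / 5\<close>.\<close>

lemma rate_bound:
  fixes \<tau> \<sigma> \<mu> M D \<Delta> \<epsilon> N n a c1 c2 l :: real
  assumes pos: "0 < \<tau>" "0 < \<sigma>" "0 < \<mu>" "0 < M" "0 < D" "0 < \<Delta>" "0 < \<epsilon>" "0 < N" "1 \<le> n" "0 < c1"
    and a: "c1 \<le> a" "a \<le> c2" and \<tau>: "\<tau> ^ 3 = a ^ 3 * (\<sigma>\<^sup>2 * n\<^sup>2 / (\<mu> * M * N))"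
    and l: "1 / 2 \<le> l" and K: "K = 40 + 25 / c1 ^ 3" and c4: "c4 = (c2 * K) ^ 3 + 1440"
    and \<Delta>: "\<Delta> \<le> 1 / 5 * (\<epsilon> * \<tau> / (D * n))" and small: "\<epsilon> < M * D"
    and N: "c4 * (n * M\<^sup>2 / (\<mu> * \<epsilon>) + M\<^sup>2 * n\<^sup>2 * \<sigma>\<^sup>2 / (\<mu> * \<epsilon> ^ 3)) \<le> N / l ^ 3"
  shows "4 * M * \<tau> + n * \<Delta> * D / \<tau> +
    3 * (pi\<^sup>2 * n * M\<^sup>2 + n\<^sup>2 * \<sigma>\<^sup>2 / \<tau>\<^sup>2 + n\<^sup>2 * \<Delta>\<^sup>2 / \<tau>\<^sup>2) * (1 + l) / (2 * \<mu> * (N + 1)) \<le> \<epsilon>"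
proof -
  have a0: "0 < a" "0 < c2" using a pos by auto
  \<comment> \<open>Origin of the constants: \<open>40\<close> serves \<open>t1\<close>, where
    \<open>4 * M * \<tau> \<le> 8 * (M * \<tau> * l) \<le> 8 * \<epsilon> / 40\<close>;
    \<open>25 / c1 ^ 3\<close> serves \<open>t4\<close>, where
    \<open>9 / 2 / 25 \<le> 1 / 5\<close>; and \<open>1440\<close> serves \<open>t3\<close>, where
    \<open>9 / 2 * 16 * 4 / 1440 = 1 / 5\<close>.\<close>
  have K0: "40 \<le> K" "25 / c1 ^ 3 \<le> K" using pos by (auto simp: K)
  have c4': "1440 \<le> c4" "(c2 * K) ^ 3 \<le> c4" using a0 K0 by (auto simp: c4)
  have l0: "0 < l" using l by linarith
  have n0: "0 < n" using pos by linarith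
  \<comment> \<open>The two rates per iteration: \<open>A\<close> governs the part of the second
    moment without noise, and \<open>B\<close> is \<open>(M * \<tau>) ^ 3 / a ^ 3\<close>.\<close>
  define A where "A = n * M\<^sup>2 / (\<mu> * N)"
  define B where "B = M\<^sup>2 * n\<^sup>2 * \<sigma>\<^sup>2 / (\<mu> * N)"
  have A0: "0 \<le> A" and B0: "0 \<le> B" using pos by (auto simp: A_def B_def)
  have N': "c4 * (A / \<epsilon> + B / \<epsilon> ^ 3) \<le> 1 / l ^ 3"
  proof -
    have "c4 * (A / \<epsilon> + B / \<epsilon> ^ 3) = c4 * (n * M\<^sup>2 / (\<mu> * \<epsilon>) + M\<^sup>2 * n\<^sup>2 * \<sigma>\<^sup>2 / (\<mu> * \<epsilon> ^ 3)) / N"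
      unfolding A_def B_def using pos by (simp add: add_divide_distrib algebra_simps)
    also have "\<dots> \<le> N / l ^ 3 / N" using N pos by (intro divide_right_mono) auto
    finally show ?thesis using pos by simp
  qed
  have cA: "0 \<le> c4 * (A / \<epsilon>)" and cB: "0 \<le> c4 * (B / \<epsilon> ^ 3)" using A0 B0 c4' pos by auto
  have A1: "c4 * (A / \<epsilon>) \<le> 1 / l ^ 3" and B1: "c4 * (B / \<epsilon> ^ 3) \<le> 1 / l ^ 3"
    using N' cA cB by (simp_all add: distrib_left)
  \<comment> \<open>The hypothesis offers \<open>l ^ 3\<close> where one factor \<open>l\<close> is
    needed; since \<open>l \<ge> 1 / 2\<close>, discarding \<open>l\<^sup>2\<close> costs the factor
    4.\<close>
  have A2: "l * A \<le> 4 * \<epsilon> / 1440"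
  proof -
    have "1440 * (A / \<epsilon>) \<le> c4 * (A / \<epsilon>)" using c4' A0 pos by (intro mult_right_mono) auto
    then have "1440 * (A / \<epsilon>) \<le> 1 / l ^ 3" using A1 by linarith
    then have "1440 * A * l ^ 3 \<le> \<epsilon>" using pos l0 by (simp add: field_simps)
    moreover have "(1 / 2)\<^sup>2 \<le> l\<^sup>2" using l by (intro power_mono) auto
    then have "(1440 * A * l) * (1 / 4) \<le> (1440 * A * l) * l\<^sup>2"
      using A0 l0 by (intro mult_left_mono) (auto simp: power2_eq_square)
    ultimately have "(1440 * A * l) * (1 / 4) \<le> \<epsilon>" by (simp add: power3_eq_cube power2_eq_square mult_ac)
    then show ?thesis by (simp add: mult_ac)
  qed
  \<comment> \<open>The logarithm is attached to \<open>M * \<tau>\<close> before cubing, because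
    \<open>t4\<close> needs the bound with that factor; this uses the full power
    \<open>l ^ 3\<close>.\<close>
  have T: "M * \<tau> * l \<le> \<epsilon> / K"
  proof -
    have "(M * \<tau>) ^ 3 = a ^ 3 * B"
      unfolding power_mult_distrib \<tau> B_def using pos by (simp add: power3_eq_cube power2_eq_square)
    also have "\<dots> \<le> c2 ^ 3 * B" using a a0 B0 by (intro mult_right_mono power_mono) auto
    finally have "(M * \<tau>) ^ 3 \<le> c2 ^ 3 * B" .
    then have "(M * \<tau> * l * K) ^ 3 \<le> (c2 * K) ^ 3 * B * l ^ 3"
      using l0 K0 by (simp add: power_mult_distrib mult_right_mono mult_ac)
    also have "\<dots> \<le> c4 * B * l ^ 3" using c4' B0 l0 by (intro mult_right_mono) auto
    also have "\<dots> \<le> \<epsilon> ^ 3" using B1 pos l0 by (simp add: field_simps)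
    finally have cube: "(M * \<tau> * l * K) ^ 3 \<le> \<epsilon> ^ 3" .
    have "M * \<tau> * l * K \<le> \<epsilon>"
      by (rule power_le_imp_le_base[of _ 2]) (use cube pos in simp_all)
    then show ?thesis using K0 by (simp add: field_simps)
  qed
  have K_inv: "\<epsilon> / K \<le> \<epsilon> / 40" using K0 pos by (intro divide_left_mono) auto
  have t1: "4 * M * \<tau> \<le> \<epsilon> / 5"
  proof -
    have "M * \<tau> * (1 / 2) \<le> M * \<tau> * l" using l pos by (intro mult_left_mono) auto
    then show ?thesis using T K_inv by linarith
  qed
  have nD: "n * \<Delta> / \<tau> \<le> \<epsilon> / (5 * D)"
  proof -
    have "n * \<Delta> / \<tau> \<le> n * (1 / 5 * (\<epsilon> * \<tau> / (D * n))) / \<tau>"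
      using \<Delta> pos n0 by (intro divide_right_mono mult_left_mono) auto
    also have "\<dots> = \<epsilon> / (5 * D)" using pos n0 by simp
    finally show ?thesis .
  qed
  have t2: "n * \<Delta> * D / \<tau> \<le> \<epsilon> / 5"
  proof -
    have "n * \<Delta> / \<tau> * D \<le> \<epsilon> / (5 * D) * D" using nD pos by (intro mult_right_mono) auto
    then show ?thesis using pos by simp
  qed
  have t3: "9 / 2 * l * (pi\<^sup>2 * n * M\<^sup>2) / (\<mu> * N) \<le> \<epsilon> / 5"
  proof -
    have "9 / 2 * l * (pi\<^sup>2 * n * M\<^sup>2) / (\<mu> * N) = 9 / 2 * (pi\<^sup>2 * (l * A))"
      by (simp add: A_def)
    also have "\<dots> \<le> 9 / 2 * (4\<^sup>2 * (l * A))"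
      using pi_less_4 A0 l0 by (intro mult_left_mono mult_right_mono power_mono) auto
    also have "\<dots> \<le> \<epsilon> / 5" using A2 by (simp add: mult_ac)
    finally show ?thesis .
  qed
  \<comment> \<open>Inserting the formula for \<open>\<tau> ^ 3\<close> turns the noise term into a
    multiple of \<open>M * \<tau> * l / a ^ 3\<close>, the same quantity as the bias up to
    \<open>l\<close> and constants. This is the balance behind the choice of
    \<open>\<tau>\<close>.\<close>
  have t4: "9 / 2 * l * (n\<^sup>2 * \<sigma>\<^sup>2 / \<tau>\<^sup>2) / (\<mu> * N) \<le> \<epsilon> / 5"
  proof -
    have "n\<^sup>2 * \<sigma>\<^sup>2 / (\<mu> * N) = M * \<tau> ^ 3 / a ^ 3"
      unfolding \<tau> using pos a0 by simp
    moreover have "9 / 2 * l * (n\<^sup>2 * \<sigma>\<^sup>2 / \<tau>\<^sup>2) / (\<mu> * N) = 9 / 2 * l * (n\<^sup>2 * \<sigma>\<^sup>2 / (\<mu> * N)) / \<tau>\<^sup>2"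
      by (simp add: mult_ac)
    ultimately have "9 / 2 * l * (n\<^sup>2 * \<sigma>\<^sup>2 / \<tau>\<^sup>2) / (\<mu> * N) = 9 / 2 * l * (M * \<tau> ^ 3 / a ^ 3) / \<tau>\<^sup>2"
      by (simp only:)
    also have "\<dots> = 9 / 2 * (M * \<tau> * l) / a ^ 3"
      using pos by (simp add: power3_eq_cube power2_eq_square mult_ac)
    also have "\<dots> \<le> 9 / 2 * (\<epsilon> / K) / c1 ^ 3"
      using T pos a a0 K0 l0 by (intro frac_le mult_left_mono power_mono) auto
    also have "\<dots> \<le> \<epsilon> / 5"
    proof -
      have "25 \<le> K * c1 ^ 3" using K0(2) pos by (simp add: field_simps)
      then have "9 / 2 * \<epsilon> / (K * c1 ^ 3) \<le> 9 / 2 * \<epsilon> / 25" using pos by (intro divide_left_mono) auto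
      then show ?thesis using pos by simp
    qed
    finally show ?thesis .
  qed
  \<comment> \<open>The bound on \<open>\<Delta>\<close> controls
    \<open>n * \<Delta> / \<tau>\<close> by \<open>\<epsilon> / (5 * D)\<close> only. With
    \<open>\<epsilon> < M * D\<close> this is below \<open>M / 5\<close>, and the square is absorbed
    by the \<open>A\<close> term because \<open>n \<ge> 1\<close>.\<close>
  have t5: "9 / 2 * l * (n\<^sup>2 * \<Delta>\<^sup>2 / \<tau>\<^sup>2) / (\<mu> * N) \<le> \<epsilon> / 5"
  proof -
    have "n * \<Delta> / \<tau> \<le> M / 5"
    proof -
      have "\<epsilon> / (5 * D) \<le> M / 5" using small pos by (simp add: field_simps)
      then show ?thesis using nD by linarith
    qed
    then have "(n * \<Delta> / \<tau>)\<^sup>2 \<le> (M / 5)\<^sup>2" using pos n0 by (intro power_mono) auto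
    then have "n\<^sup>2 * \<Delta>\<^sup>2 / \<tau>\<^sup>2 \<le> M\<^sup>2 / 25" by (simp add: power_mult_distrib power_divide)
    also have "\<dots> \<le> n * M\<^sup>2 / 25" using pos by (intro divide_right_mono) auto
    finally have "9 / 2 * l * (n\<^sup>2 * \<Delta>\<^sup>2 / \<tau>\<^sup>2) / (\<mu> * N) \<le> 9 / 2 * l * (n * M\<^sup>2 / 25) / (\<mu> * N)"
      using pos l0 by (intro divide_right_mono mult_left_mono) auto
    also have "\<dots> = 9 / 50 * (l * A)" by (simp add: A_def)
    also have "\<dots> \<le> \<epsilon> / 5" using A2 pos by linarith
    finally show ?thesis .
  qed
  let ?G = "pi\<^sup>2 * n * M\<^sup>2 + n\<^sup>2 * \<sigma>\<^sup>2 / \<tau>\<^sup>2 + n\<^sup>2 * \<Delta>\<^sup>2 / \<tau>\<^sup>2"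
  have G0: "0 \<le> ?G" using pos n0 by (intro add_nonneg_nonneg) auto
  \<comment> \<open>\<open>1 + l \<le> 3 * l\<close> because \<open>l \<ge> 1 / 2\<close>.\<close>
  have "3 * ?G * (1 + l) / (2 * \<mu> * (N + 1)) \<le> 3 * ?G * (3 * l) / (2 * \<mu> * N)"
    using G0 l pos by (intro frac_le mult_left_mono mult_nonneg_nonneg) auto
  also have "\<dots> = 9 / 2 * l * (pi\<^sup>2 * n * M\<^sup>2) / (\<mu> * N) + 9 / 2 * l * (n\<^sup>2 * \<sigma>\<^sup>2 / \<tau>\<^sup>2) / (\<mu> * N) + 9 / 2 * l * (n\<^sup>2 * \<Delta>\<^sup>2 / \<tau>\<^sup>2) / (\<mu> * N)"
  proof -
    have "3 * (x + y + z) * (3 * l) / (2 * \<mu> * N) = 9 / 2 * l * x / (\<mu> * N) + 9 / 2 * l * y / (\<mu> * N) + 9 / 2 * l * z / (\<mu> * N)" for x y z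
      using pos by (simp add: field_simps)
    then show ?thesis .
  qed
  finally show ?thesis using t1 t2 t3 t4 t5 by linarith
qed

text \<open>Integrability belongs to the conclusion because the Bochner integral of a non-integrable
  function is 0, so the inequality alone could hold vacuously. The constants are chosen before the
  dimensions and all problem data.\<close>

theorem corollary2:
  fixes c1 c2 :: real
  assumes "0 < c1" and "c1 \<le> c2"
  shows "\<exists>c3 c4 s :: real. c3 > 0 \<and> c4 > 0 \<and> s > 0 \<and>
    (\<forall>(nx :: nat) ny X Y UX UY \<phi> \<delta> Dp Dm \<mu> M \<sigma> \<Delta> \<tau> xs ys z0 (\<epsilon> :: real) (N :: nat) (n :: nat).
      noisy_saddle_problem nx ny X Y UX UY \<phi> \<delta> Dp Dm \<mu> M \<sigma> \<Delta> \<tau> xs ys z0 \<longrightarrow>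
      n = nx + ny \<longrightarrow> \<epsilon> > 0 \<longrightarrow> N \<ge> 1 \<longrightarrow>
      c1 \<le> \<tau> * inverse (root 3 (\<sigma>\<^sup>2 / (\<mu> * M)) * root 3 ((real n)\<^sup>2 / real N)) \<longrightarrow>
      \<tau> * inverse (root 3 (\<sigma>\<^sup>2 / (\<mu> * M)) * root 3 ((real n)\<^sup>2 / real N)) \<le> c2 \<longrightarrow>
      \<Delta> \<le> c3 * (\<epsilon> * \<tau> / (diameter (X \<times> Y) * real n)) \<longrightarrow>
      real N / ln (real N + 1) powr s \<ge>
        c4 * (real n * M\<^sup>2 / (\<mu> * \<epsilon>) + M\<^sup>2 * (real n)\<^sup>2 * \<sigma>\<^sup>2 / (\<mu> * \<epsilon> ^ 3)) \<longrightarrow>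
      (let gap = (\<lambda>\<omega>. case avg_iterate (X \<times> Y) n \<mu> \<phi> \<delta> \<tau> z0 N \<omega> of
                   (x, y) \<Rightarrow> \<phi> (x, ys) - \<phi> (xs, y));
           P = sample_space nx ny Dp Dm
       in integrable P gap \<and> (\<integral>\<omega>. gap \<omega> \<partial>P) \<le> \<epsilon>))"
proof -
  define K where "K = 40 + 25 / c1 ^ 3"
  define c4 where "c4 = (c2 * K) ^ 3 + 1440"
  have "0 < K" using assms by (simp add: K_def add_pos_pos)
  then have c4_pos: "0 < c4" using assms by (simp add: c4_def add_pos_pos)
  show ?thesis
  \<comment> \<open>\<open>1 / 5\<close> is the share of the error granted to the deterministic
    perturbation, and the exponent 3 is the power of the logarithm consumed in
    \<open>rate_bound\<close>.\<close>
  proof (rule exI[of _ "1 / 5"], rule exI[of _ c4], rule exI[of _ 3], intro conjI allI impI)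
    fix nx ny :: nat and X Y UX UY \<phi> \<delta> Dp Dm \<mu> M \<sigma> \<Delta> \<tau> xs ys z0 and \<epsilon> :: real and N n :: nat
    assume prob: "noisy_saddle_problem nx ny X Y UX UY \<phi> \<delta> Dp Dm \<mu> M \<sigma> \<Delta> \<tau> xs ys z0"
      and n: "n = nx + ny" and \<epsilon>: "\<epsilon> > 0" and N: "N \<ge> 1"
      and a1: "c1 \<le> \<tau> * inverse (root 3 (\<sigma>\<^sup>2 / (\<mu> * M)) * root 3 ((real n)\<^sup>2 / real N))"
      and a2: "\<tau> * inverse (root 3 (\<sigma>\<^sup>2 / (\<mu> * M)) * root 3 ((real n)\<^sup>2 / real N)) \<le> c2"
      and \<Delta>: "\<Delta> \<le> 1 / 5 * (\<epsilon> * \<tau> / (diameter (X \<times> Y) * real n))"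
      and N_large: "real N / ln (real N + 1) powr 3 \<ge>
        c4 * (real n * M\<^sup>2 / (\<mu> * \<epsilon>) + M\<^sup>2 * (real n)\<^sup>2 * \<sigma>\<^sup>2 / (\<mu> * \<epsilon> ^ 3))"
    define R where "R = root 3 (\<sigma>\<^sup>2 / (\<mu> * M)) * root 3 ((real n)\<^sup>2 / real N)"
    define a where "a = \<tau> * inverse R"
    interpret NP: noisy_saddle_problem nx ny X Y UX UY \<phi> \<delta> Dp Dm \<mu> M \<sigma> \<Delta> \<tau> xs ys z0 by (rule prob)
    have R_nonneg: "0 \<le> R" using NP.pos by (simp add: R_def)
    have a: "c1 \<le> a" "a \<le> c2" "0 < a" using a1 a2 assms by (auto simp: a_def R_def)
    \<comment> \<open>Since \<open>inverse 0 = 0\<close>, a vanishing \<open>R\<close> would force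
      \<open>a = 0\<close>.\<close>
    have R: "0 < R" using R_nonneg a(3) by (cases "R = 0") (auto simp: a_def)
    have \<tau>_eq: "\<tau> = a * R" using R by (simp add: a_def)
    have \<tau>: "0 < \<tau>" using a(3) R by (simp add: \<tau>_eq)
    interpret A: noisy_saddle_algorithm nx ny X Y UX UY \<phi> \<delta> Dp Dm \<mu> M \<sigma> \<Delta> \<tau> xs ys z0
      by standard (rule \<tau>)
    have u: "(xs, ys) \<in> X \<times> Y" using NP.saddle by (simp add: saddle_point_def)
    have gap_eq: "(case avg_iterate (X \<times> Y) n \<mu> \<phi> \<delta> \<tau> z0 N \<omega> of (x, y) \<Rightarrow> \<phi> (x, ys) - \<phi> (xs, y)) =
      A.gap (A.avg N \<omega>) (xs, ys)" for \<omega>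
      by (simp add: A.gap_def A.avg_def n split_beta)
    have int: "integrable (sample_space nx ny Dp Dm) (\<lambda>\<omega>. A.gap (A.avg N \<omega>) (xs, ys))"
      by (rule A.expected_gap(1)[OF u])
    have le: "(\<integral>\<omega>. A.gap (A.avg N \<omega>) (xs, ys) \<partial>sample_space nx ny Dp Dm) \<le> \<epsilon>"
    \<comment> \<open>For large \<open>\<epsilon>\<close> the Lipschitz bound on the gap is enough.
      The other case supplies the hypothesis \<open>small\<close> of \<open>rate_bound\<close>,
      without which the squared error term is not dominated by \<open>M\<^sup>2\<close>.\<close>
    proof (cases "M * diameter (X \<times> Y) \<le> \<epsilon>")
      case True
      have "(\<integral>\<omega>. A.gap (A.avg N \<omega>) (xs, ys) \<partial>sample_space nx ny Dp Dm) \<le> M * diameter (X \<times> Y)"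
        using A.gap_bound[OF A.avg_in u] by (intro A.P.integral_le_const int AE_I2) (auto simp: abs_le_iff)
      then show ?thesis using True by linarith
    next
      case False
      have n1: "1 \<le> real n" using A.n_pos unfolding n by linarith
      have \<tau>3: "\<tau> ^ 3 = a ^ 3 * (\<sigma>\<^sup>2 * (real n)\<^sup>2 / (\<mu> * M * real N))"
      proof -
        have "R ^ 3 = \<sigma>\<^sup>2 / (\<mu> * M) * ((real n)\<^sup>2 / real N)"
          unfolding R_def power_mult_distrib using NP.pos by (simp add: odd_real_root_pow)
        then show ?thesis by (simp add: \<tau>_eq power_mult_distrib)
      qed
      have l: "1 / 2 \<le> ln (real N + 1)"
      proof -
        have "exp (1 / 2) \<le> (2 :: real)"
        proof -
          have "exp (1 / 2) \<le> 1 + 1 / 2 + (1 / 2 :: real)\<^sup>2" by (rule exp_bound) auto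
          then show ?thesis by (simp add: power2_eq_square)
        qed
        also have "2 \<le> real N + 1" using N by simp
        finally show ?thesis by (subst ln_ge_iff) auto
      qed
      have "ln (real N + 1) powr 3 = ln (real N + 1) ^ 3"
        using l powr_realpow[of "ln (real N + 1)" 3] by simp
      then have NL: "c4 * (real n * M\<^sup>2 / (\<mu> * \<epsilon>) + M\<^sup>2 * (real n)\<^sup>2 * \<sigma>\<^sup>2 / (\<mu> * \<epsilon> ^ 3)) \<le> real N / ln (real N + 1) ^ 3"
        using N_large by simp
      have "A.bias + A.second_moment * (1 + ln (real N + 1)) / (2 * \<mu> * (real N + 1)) \<le> \<epsilon>"
        unfolding A.bias_def A.second_moment_def n[symmetric]
        by (rule rate_bound[OF \<tau> NP.pos(3,1,2) NP.diameter_pos NP.pos(4) \<epsilon> _ n1 assms(1) a(1,2) \<tau>3 l K_def c4_def \<Delta> _ NL])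
          (use N False in auto)
      then show ?thesis using A.expected_gap(2)[OF u, of N] by linarith
    qed
    show "let gap = (\<lambda>\<omega>. case avg_iterate (X \<times> Y) n \<mu> \<phi> \<delta> \<tau> z0 N \<omega> of (x, y) \<Rightarrow> \<phi> (x, ys) - \<phi> (xs, y));
           P = sample_space nx ny Dp Dm
       in integrable P gap \<and> (\<integral>\<omega>. gap \<omega> \<partial>P) \<le> \<epsilon>"
      unfolding Let_def gap_eq using int le by simp
  qed (use c4_pos in auto)
qed

end
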